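(* Let $H$ be a finite dimensional quasi-Hopf algebra over a field $\mathbf k$, and let $\mathcal L\subset\hat H=\mathrm{Hom}_{\mathbf k}(H,\mathbf k)$ be its space of left cointegrals. Then $\dim\mathcal L=1$ and every nonzero left cointegral on $H$ is nondegenerate (i.e. the bilinear form $(a,b)\mapsto\lambda(ab)$ on $H$ is nondegenerate for $0\neq\lambda\in\mathcal L$). In particular $H$ is a Frobenius algebra, and therefore the space of left integrals $\{l\in H\mid al=\epsilon(a)l\ \forall a\in H\}$ and the space of right integrals $\{r\in H\mid ra=\epsilon(a)r\ \forall a\in H\}$ are both one dimensional.
   Context: Quasi-Hopf algebras. $\mathbf k$ is a field, algebras are unital. A quasi-bialgebra $(H,\Delta,\epsilon,\phi)$ is a unital $\mathbf k$-algebra $H$ with unital algebra morphisms $\Delta:H\to H\otimes H$, $\epsilon:H\to\mathbf k$ and an invertible $\phi\in H\otimes H\otimes H$ such that $(\mathrm{id}\otimes\Delta)(\Delta(a))\,\phi=\phi\,(\Delta\otimes\mathrm{id})(\Delta(a))$ for all $a\in H$; $(\mathrm{id}\otimes\mathrm{id}\otimes\Delta)(\phi)(\Delta\otimes\mathrm{id}\otimes\mathrm{id})(\phi)=(\mathbf 1\otimes\phi)(\mathrm{id}\otimes\Delta\otimes\mathrm{id})(\phi)(\phi\otimes\mathbf 1)$; $(\epsilon\otimes\mathrm{id})\circ\Delta=\mathrm{id}=(\mathrm{id}\otimes\epsilon)\circ\Delta$; $(\mathrm{id}\otimes\epsilon\otimes\mathrm{id})(\phi)=\mathbf 1\otimes\mathbf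 1$. Write $\Delta(a)=a_{(1)}\otimes a_{(2)}$, $\Delta^{op}(a)=a_{(2)}\otimes a_{(1)}$, $\phi=X^j\otimes Y^j\otimes Z^j$, $\phi^{-1}=\bar X^j\otimes\bar Y^j\otimes\bar Z^j$ (summation suppressed); for $x=x^1\otimes x^2$ put $x^{21}=x^2\otimes x^1$. $H$ is a quasi-Hopf algebra if there are an algebra anti-morphism $S:H\to H$ and $\alpha,\beta\in H$ with $S(a_{(1)})\alpha a_{(2)}=\epsilon(a)\alpha$, $a_{(1)}\beta S(a_{(2)})=\epsilon(a)\beta$ for all $a$, and $X^j\beta S(Y^j)\alpha Z^j=\mathbf 1=S(\bar X^j)\alpha\bar Y^j\beta S(\bar Z^j)$. Standing conventions: $S$ is invertible and $\epsilon(\alpha)=\epsilon(\beta)=1$. Special elements. $q_R=q_R^1\otimes q_R^2:=X^i\otimes S^{-1}(\alpha Z^i)Y^i$, $p_R:=\bar X^i\otimes\bar Y^i\beta S(\bar Z^i)$. With $T^i\otimes U^i\otimes V^i\otimes W^i:=(\mathbf 1\otimes\phi^{-1})(\mathrm{id}\otimes\mathrm{id}\otimes\Delta)(\phi)$ let $\gamma:=S(U^i)\alpha V^i\otimes S(T^i)\alpha W^i$. Drinfeld's element $f:=(S\otimes S)(\Delta^{op}(\bar X^i))\,\gamma\,\Delta(\bar Y^i\beta S(\bar Z^i))$ is invertible. Put $h:=(S^{-1}\otimes S^{-1})(f^{21})$, $U:=f^{-1}(S\otimes S)(q_R^{21})$, $V:=(S^{-1}\otimes S^{-1})(p_R^{21})h$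 and $\bar\Delta(a):=V\Delta(a)U$ for $a\in H$. Left cointegrals. Let $\{b_i\}$ be a basis of $H$ with dual basis $\{b^i\}\subset\hat H$. The dual $H^*:=\hat H$ is a (right) quasi-Hopf $H$-bimodule with actions $(a\cdot\psi\cdot b)(x)=\psi(S^{-1}(a)xS(b))$ and coaction $\rho(\psi)=\sum_i b^i*\psi\otimes b_i$, where $(\varphi*\psi)(a):=(\varphi\otimes\psi)(\bar\Delta(a))$. Writing $\rho(\psi)=\psi_{(0)}\otimes\psi_{(1)}$, put $E(\psi):=q_R^1\cdot\psi_{(0)}\cdot\beta S(q_R^2\psi_{(1)})$, i.e. $E(\psi)(a)=\sum_i(b^i\otimes\psi)\big(\bar\Delta(S^{-1}(q_R^1)\,a\,S^2(q_R^2b_i)S(\beta))\big)$; $E$ is a projection. The space of left cointegrals is the space of coinvariants $\mathcal L:=E(\hat H)=\{\lambda\in\hat H\mid E(\lambda)=\lambda\}$. *)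

theory Defs
  imports Complex_Main "HOL-Library.Function_Algebras"
begin

section \<open>Tensor powers of a vector space\<close>

text \<open>
  An element of $H^{\otimes n}$ (for $n = 2, 3, 4$) is represented by a finite list of $n$-tuples,
  the list $[t_1, \ldots, t_m]$ standing for the sum of the pure tensors of its entries; every
  tensor has such a representative because scalars can be absorbed into a factor.  Two lists
  represent the same tensor iff they agree in the free vector space on $n$-tuples modulo the
  multilinearity relations (\<open>tensor_eq2\<close>, \<open>tensor_eq3\<close>, \<open>tensor_eq4\<close> below).  All equations between
  tensors are stated with these relations, never as equality of lists.
\<close>

definition fscale :: "'k::field \<Rightarrow> ('t \<Rightarrow> 'k) \<Rightarrow> 't \<Rightarrow> 'k" where
  "fscale c g = (\<lambda>x. c * g x)"

definition point :: "'t \<Rightarrow> 't \<Rightarrow> 'k::field" where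
  "point t = (\<lambda>u. if u = t then 1 else 0)"

definition formal_sum :: "'t list \<Rightarrow> 't \<Rightarrow> 'k::field" where
  "formal_sum ts = (\<Sum>t\<leftarrow>ts. point t)"

text \<open>
  The argument \<open>P\<close> is the set of all maps that put a vector into one slot of a tuple, the other
  slots being held fixed.
\<close>

definition tensor_relations ::
  "('k::field \<Rightarrow> 'a::ab_group_add \<Rightarrow> 'a) \<Rightarrow> ('a \<Rightarrow> 't) set \<Rightarrow> ('t \<Rightarrow> 'k) set" where
  "tensor_relations s P =
     {point (p (a + b)) - point (p a) - point (p b) | p a b. p \<in> P} \<union>
     {point (p (s c a)) - fscale c (point (p a)) | p c a. p \<in> P}"

definition tensor_eq ::
  "('k::field \<Rightarrow> 'a::ab_group_add \<Rightarrow> 'a) \<Rightarrow> ('a \<Rightarrow> 't) set \<Rightarrow> 't list \<Rightarrow> 't list \<Rightarrow> bool" where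
  "tensor_eq s P x y \<longleftrightarrow>
     formal_sum x - formal_sum y \<in> module.span fscale (tensor_relations s P)"

definition slots2 :: "('a \<Rightarrow> 'a \<times> 'a) set" where
  "slots2 = {\<lambda>a. (a, b) | b. True} \<union> {\<lambda>b. (a, b) | a. True}"

definition slots3 :: "('a \<Rightarrow> 'a \<times> 'a \<times> 'a) set" where
  "slots3 = {\<lambda>a. (a, b, c) | b c. True} \<union> {\<lambda>b. (a, b, c) | a c. True} \<union>
            {\<lambda>c. (a, b, c) | a b. True}"

definition slots4 :: "('a \<Rightarrow> 'a \<times> 'a \<times> 'a \<times> 'a) set" where
  "slots4 = {\<lambda>a. (a, b, c, d) | b c d. True} \<union> {\<lambda>b. (a, b, c, d) | a c d. True} \<union>
            {\<lambda>c. (a, b, c, d) | a b d. True} \<union> {\<lambda>d. (a, b, c, d) | a b c. True}"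

definition tmul2 :: "('a::times \<times> 'a) list \<Rightarrow> ('a \<times> 'a) list \<Rightarrow> ('a \<times> 'a) list" where
  "tmul2 x y = [(a * a', b * b'). (a, b) \<leftarrow> x, (a', b') \<leftarrow> y]"

definition tmul3 ::
  "('a::times \<times> 'a \<times> 'a) list \<Rightarrow> ('a \<times> 'a \<times> 'a) list \<Rightarrow> ('a \<times> 'a \<times> 'a) list" where
  "tmul3 x y = [(a * a', b * b', c * c'). (a, b, c) \<leftarrow> x, (a', b', c') \<leftarrow> y]"

definition tmul4 ::
  "('a::times \<times> 'a \<times> 'a \<times> 'a) list \<Rightarrow> ('a \<times> 'a \<times> 'a \<times> 'a) list \<Rightarrow>
   ('a \<times> 'a \<times> 'a \<times> 'a) list" where
  "tmul4 x y =
     [(a * a', b * b', c * c', d * d'). (a, b, c, d) \<leftarrow> x, (a', b', c', d') \<leftarrow> y]"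


section \<open>Quasi-Hopf algebras\<close>

text \<open>
  The carrier is the whole type \<open>'a\<close>.  The class \<open>ring_1\<close> only excludes the zero ring, which has no
  unital morphism to a field.  \<open>comult H a\<close> and \<open>reassoc H\<close> are representatives of tensors.
\<close>

record ('k, 'a) quasi_bialgebra_data =
  scal :: "'k \<Rightarrow> 'a \<Rightarrow> 'a"
  comult :: "'a \<Rightarrow> ('a \<times> 'a) list"
  counit :: "'a \<Rightarrow> 'k"
  reassoc :: "('a \<times> 'a \<times> 'a) list"

record ('k, 'a) quasi_hopf_data = "('k, 'a) quasi_bialgebra_data" +
  antipode :: "'a \<Rightarrow> 'a"
  alpha_elt :: 'a
  beta_elt :: 'a

definition tensor_eq2 ::
  "('k::field, 'a::ring_1, 'm) quasi_bialgebra_data_scheme \<Rightarrow>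
   ('a \<times> 'a) list \<Rightarrow> ('a \<times> 'a) list \<Rightarrow> bool" where
  "tensor_eq2 H = tensor_eq (scal H) slots2"

definition tensor_eq3 ::
  "('k::field, 'a::ring_1, 'm) quasi_bialgebra_data_scheme \<Rightarrow>
   ('a \<times> 'a \<times> 'a) list \<Rightarrow> ('a \<times> 'a \<times> 'a) list \<Rightarrow> bool" where
  "tensor_eq3 H = tensor_eq (scal H) slots3"

definition tensor_eq4 ::
  "('k::field, 'a::ring_1, 'm) quasi_bialgebra_data_scheme \<Rightarrow>
   ('a \<times> 'a \<times> 'a \<times> 'a) list \<Rightarrow> ('a \<times> 'a \<times> 'a \<times> 'a) list \<Rightarrow> bool" where
  "tensor_eq4 H = tensor_eq (scal H) slots4"

definition is_inverse2 ::
  "('k::field, 'a::ring_1, 'm) quasi_bialgebra_data_scheme \<Rightarrow>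
   ('a \<times> 'a) list \<Rightarrow> ('a \<times> 'a) list \<Rightarrow> bool" where
  "is_inverse2 H x y \<longleftrightarrow>
     tensor_eq2 H (tmul2 x y) [(1, 1)] \<and> tensor_eq2 H (tmul2 y x) [(1, 1)]"

definition is_inverse3 ::
  "('k::field, 'a::ring_1, 'm) quasi_bialgebra_data_scheme \<Rightarrow>
   ('a \<times> 'a \<times> 'a) list \<Rightarrow> ('a \<times> 'a \<times> 'a) list \<Rightarrow> bool" where
  "is_inverse3 H x y \<longleftrightarrow>
     tensor_eq3 H (tmul3 x y) [(1, 1, 1)] \<and> tensor_eq3 H (tmul3 y x) [(1, 1, 1)]"

text \<open>
  Inverses are unique as tensors, so the choice only affects the representative.
\<close>

definition tinv2 ::
  "('k::field, 'a::ring_1, 'm) quasi_bialgebra_data_scheme \<Rightarrow> ('a \<times> 'a) list \<Rightarrow> ('a \<times> 'a) list"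
  where "tinv2 H x = (SOME y. is_inverse2 H x y)"

definition reassoc_inv ::
  "('k::field, 'a::ring_1, 'm) quasi_bialgebra_data_scheme \<Rightarrow> ('a \<times> 'a \<times> 'a) list" where
  "reassoc_inv H = (SOME y. is_inverse3 H (reassoc H) y)"

locale k_algebra = vector_space s
  for s :: "'k::field \<Rightarrow> 'a::ring_1 \<Rightarrow> 'a" +
  assumes scale_mult_left: "s c (a * b) = s c a * b"
    and scale_mult_right: "s c (a * b) = a * s c b"

locale quasi_bialgebra = k_algebra "scal H"
  for H :: "('k::field, 'a::ring_1, 'm) quasi_bialgebra_data_scheme" +
  assumes comult_add: "tensor_eq2 H (comult H (a + b)) (comult H a @ comult H b)"
    and comult_scale:
      "tensor_eq2 H (comult H (scal H c a)) [(scal H c x, y). (x, y) \<leftarrow> comult H a]"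
    and comult_mult: "tensor_eq2 H (comult H (a * b)) (tmul2 (comult H a) (comult H b))"
    and comult_one: "tensor_eq2 H (comult H 1) [(1, 1)]"
    and counit_linear: "Vector_Spaces.linear (scal H) (*) (counit H)"
    and counit_mult: "counit H (a * b) = counit H a * counit H b"
    and counit_one: "counit H 1 = 1"
    and reassoc_invertible: "\<exists>y. is_inverse3 H (reassoc H) y"
    and quasi_coassoc:
      "tensor_eq3 H
         (tmul3 [(x, y1, y2). (x, y) \<leftarrow> comult H a, (y1, y2) \<leftarrow> comult H y] (reassoc H))
         (tmul3 (reassoc H) [(x1, x2, y). (x, y) \<leftarrow> comult H a, (x1, x2) \<leftarrow> comult H x])"
    and pentagon:
      "tensor_eq4 H
         (tmul4 [(x, y, z1, z2). (x, y, z) \<leftarrow> reassoc H, (z1, z2) \<leftarrow> comult H z]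
                [(x1, x2, y, z). (x, y, z) \<leftarrow> reassoc H, (x1, x2) \<leftarrow> comult H x])
         (tmul4 (tmul4 [(1, x, y, z). (x, y, z) \<leftarrow> reassoc H]
                       [(x, y1, y2, z). (x, y, z) \<leftarrow> reassoc H, (y1, y2) \<leftarrow> comult H y])
                [(x, y, z, 1). (x, y, z) \<leftarrow> reassoc H])"
    and counit_left: "(\<Sum>(x, y)\<leftarrow>comult H a. scal H (counit H x) y) = a"
    and counit_right: "(\<Sum>(x, y)\<leftarrow>comult H a. scal H (counit H y) x) = a"
    and counit_reassoc:
      "tensor_eq2 H [(scal H (counit H y) x, z). (x, y, z) \<leftarrow> reassoc H] [(1, 1)]"

locale quasi_hopf_algebra = quasi_bialgebra H
  for H :: "('k::field, 'a::ring_1) quasi_hopf_data" +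
  assumes antipode_linear: "Vector_Spaces.linear (scal H) (scal H) (antipode H)"
    and antipode_mult: "antipode H (a * b) = antipode H b * antipode H a"
    and antipode_one: "antipode H 1 = 1"
    and antipode_left:
      "(\<Sum>(x, y)\<leftarrow>comult H a. antipode H x * alpha_elt H * y) = scal H (counit H a) (alpha_elt H)"
    and antipode_right:
      "(\<Sum>(x, y)\<leftarrow>comult H a. x * beta_elt H * antipode H y) = scal H (counit H a) (beta_elt H)"
    and antipode_reassoc:
      "(\<Sum>(x, y, z)\<leftarrow>reassoc H. x * beta_elt H * antipode H y * alpha_elt H * z) = 1"
    and antipode_reassoc_inv:
      "(\<Sum>(x, y, z)\<leftarrow>reassoc_inv H.
          antipode H x * alpha_elt H * y * beta_elt H * antipode H z) = 1"
    and antipode_bij: "bij (antipode H)"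
    and counit_alpha: "counit H (alpha_elt H) = 1"
    and counit_beta: "counit H (beta_elt H) = 1"


section \<open>Special elements\<close>

definition antipode_inv :: "('k::field, 'a::ring_1) quasi_hopf_data \<Rightarrow> 'a \<Rightarrow> 'a" where
  "antipode_inv H = inv (antipode H)"

definition q_R :: "('k::field, 'a::ring_1) quasi_hopf_data \<Rightarrow> ('a \<times> 'a) list" where
  "q_R H = [(x, antipode_inv H (alpha_elt H * z) * y). (x, y, z) \<leftarrow> reassoc H]"

definition p_R :: "('k::field, 'a::ring_1) quasi_hopf_data \<Rightarrow> ('a \<times> 'a) list" where
  "p_R H = [(x, y * beta_elt H * antipode H z). (x, y, z) \<leftarrow> reassoc_inv H]"

definition TUVW :: "('k::field, 'a::ring_1) quasi_hopf_data \<Rightarrow> ('a \<times> 'a \<times> 'a \<times> 'a) list" where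
  "TUVW H = tmul4 [(1, x, y, z). (x, y, z) \<leftarrow> reassoc_inv H]
                  [(x, y, z1, z2). (x, y, z) \<leftarrow> reassoc H, (z1, z2) \<leftarrow> comult H z]"

definition gamma_elt :: "('k::field, 'a::ring_1) quasi_hopf_data \<Rightarrow> ('a \<times> 'a) list" where
  "gamma_elt H = [(antipode H u * alpha_elt H * v, antipode H t * alpha_elt H * w).
                    (t, u, v, w) \<leftarrow> TUVW H]"

definition drinfeld_f :: "('k::field, 'a::ring_1) quasi_hopf_data \<Rightarrow> ('a \<times> 'a) list" where
  "drinfeld_f H = concat [tmul2 (tmul2 [(antipode H x2, antipode H x1). (x1, x2) \<leftarrow> comult H x]
                                       (gamma_elt H))
                                (comult H (y * beta_elt H * antipode H z)).
                            (x, y, z) \<leftarrow> reassoc_inv H]"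

definition h_elt :: "('k::field, 'a::ring_1) quasi_hopf_data \<Rightarrow> ('a \<times> 'a) list" where
  "h_elt H = [(antipode_inv H y, antipode_inv H x). (x, y) \<leftarrow> drinfeld_f H]"

definition U_elt :: "('k::field, 'a::ring_1) quasi_hopf_data \<Rightarrow> ('a \<times> 'a) list" where
  "U_elt H = tmul2 (tinv2 H (drinfeld_f H)) [(antipode H y, antipode H x). (x, y) \<leftarrow> q_R H]"

definition V_elt :: "('k::field, 'a::ring_1) quasi_hopf_data \<Rightarrow> ('a \<times> 'a) list" where
  "V_elt H = tmul2 [(antipode_inv H y, antipode_inv H x). (x, y) \<leftarrow> p_R H] (h_elt H)"

definition comult_bar :: "('k::field, 'a::ring_1) quasi_hopf_data \<Rightarrow> 'a \<Rightarrow> ('a \<times> 'a) list" where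
  "comult_bar H a = tmul2 (tmul2 (V_elt H) (comult H a)) (U_elt H)"


section \<open>Cointegrals and integrals\<close>

definition dual_space :: "('k::field, 'a::ring_1) quasi_hopf_data \<Rightarrow> ('a \<Rightarrow> 'k) set" where
  "dual_space H = {\<psi>. Vector_Spaces.linear (scal H) (*) \<psi>}"

definition dual_basis ::
  "('k::field, 'a::ring_1) quasi_hopf_data \<Rightarrow> 'a set \<Rightarrow> 'a \<Rightarrow> 'a \<Rightarrow> 'k" where
  "dual_basis H B b = (\<lambda>a. module.representation (scal H) B a b)"

definition dual_act ::
  "('k::field, 'a::ring_1) quasi_hopf_data \<Rightarrow> 'a \<Rightarrow> ('a \<Rightarrow> 'k) \<Rightarrow> 'a \<Rightarrow> 'a \<Rightarrow> 'k" where
  "dual_act H a \<psi> b = (\<lambda>x. \<psi> (antipode_inv H a * x * antipode H b))"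

definition conv ::
  "('k::field, 'a::ring_1) quasi_hopf_data \<Rightarrow> ('a \<Rightarrow> 'k) \<Rightarrow> ('a \<Rightarrow> 'k) \<Rightarrow> 'a \<Rightarrow> 'k" where
  "conv H \<phi> \<psi> = (\<lambda>a. \<Sum>(x, y)\<leftarrow>comult_bar H a. \<phi> x * \<psi> y)"

text \<open>
  $E(\psi) = q_R^1 \cdot \psi_{(0)} \cdot \beta S(q_R^2 \psi_{(1)})$ for the coaction
  $\rho(\psi) = \sum_{b \in B} b^* * \psi \otimes b$, where \<open>B\<close> is a basis of \<open>H\<close>.
\<close>

definition coinv_proj ::
  "('k::field, 'a::ring_1) quasi_hopf_data \<Rightarrow> 'a set \<Rightarrow> ('a \<Rightarrow> 'k) \<Rightarrow> 'a \<Rightarrow> 'k" where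
  "coinv_proj H B \<psi> =
     (\<Sum>(q1, q2)\<leftarrow>q_R H. \<Sum>b\<in>B.
        dual_act H q1 (conv H (dual_basis H B b) \<psi>) (beta_elt H * antipode H (q2 * b)))"

definition left_cointegrals ::
  "('k::field, 'a::ring_1) quasi_hopf_data \<Rightarrow> 'a set \<Rightarrow> ('a \<Rightarrow> 'k) set" where
  "left_cointegrals H B = coinv_proj H B ` dual_space H"

definition left_integrals :: "('k::field, 'a::ring_1) quasi_hopf_data \<Rightarrow> 'a set" where
  "left_integrals H = {l. \<forall>a. a * l = scal H (counit H a) l}"

definition right_integrals :: "('k::field, 'a::ring_1) quasi_hopf_data \<Rightarrow> 'a set" where
  "right_integrals H = {r. \<forall>a. r * a = scal H (counit H a) r}"

definition nondegenerate :: "('a::ring_1 \<Rightarrow> 'k::field) \<Rightarrow> bool" where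
  "nondegenerate l \<longleftrightarrow>
     (\<forall>a. (\<forall>b. l (a * b) = 0) \<longrightarrow> a = 0) \<and> (\<forall>b. (\<forall>a. l (a * b) = 0) \<longrightarrow> b = 0)"

definition frobenius_algebra :: "('k::field \<Rightarrow> 'a::ring_1 \<Rightarrow> 'a) \<Rightarrow> bool" where
  "frobenius_algebra s \<longleftrightarrow>
     k_algebra s \<and> (\<exists>B. finite_dimensional_vector_space s B) \<and>
     (\<exists>l. Vector_Spaces.linear s (*) l \<and> nondegenerate l)"


lemma vector_space_fscale: "vector_space fscale"
  by unfold_locales (auto simp: fscale_def fun_eq_iff algebra_simps)

lemma subspace_left_cointegrals:
  fixes H :: "('k::field, 'a::ring_1) quasi_hopf_data"
  assumes "vector_space (scal H)"
  shows "module.subspace fscale (left_cointegrals H B)"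
proof -
  interpret F: vector_space "fscale :: 'k \<Rightarrow> ('a \<Rightarrow> 'k) \<Rightarrow> 'a \<Rightarrow> 'k"
    by (rule vector_space_fscale)
  interpret K: vector_space "(*) :: 'k \<Rightarrow> 'k \<Rightarrow> 'k"
    by unfold_locales (auto simp: algebra_simps)
  interpret S: vector_space "scal H" by fact
  interpret SK: vector_space_pair "scal H" "(*) :: 'k \<Rightarrow> 'k \<Rightarrow> 'k" ..
  interpret FF: vector_space_pair
    "fscale :: 'k \<Rightarrow> ('a \<Rightarrow> 'k) \<Rightarrow> 'a \<Rightarrow> 'k" "fscale :: 'k \<Rightarrow> ('a \<Rightarrow> 'k) \<Rightarrow> 'a \<Rightarrow> 'k" ..
  have sub: "F.subspace (dual_space H)"
    using S.vector_space_axioms K.vector_space_axioms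
    by (simp add: F.subspace_def dual_space_def Vector_Spaces.linear_iff fscale_def
        distrib_left mult.left_commute)
  have conv_add: "conv H \<chi> (\<psi> + \<psi>') = conv H \<chi> \<psi> + conv H \<chi> \<psi>'" for \<chi> \<psi> \<psi>'
    by (simp add: conv_def fun_eq_iff distrib_left case_prod_unfold sum_list_addf)
  have conv_scale: "conv H \<chi> (fscale c \<psi>) = fscale c (conv H \<chi> \<psi>)" for \<chi> \<psi> c
    unfolding conv_def fscale_def case_prod_unfold mult.left_commute[of _ c]
      sum_list_const_mult ..
  have act_add: "dual_act H a (\<psi> + \<psi>') b = dual_act H a \<psi> b + dual_act H a \<psi>' b" for a b \<psi> \<psi>'
    by (auto simp: dual_act_def fun_eq_iff)
  have act_scale: "dual_act H a (fscale c \<psi>) b = fscale c (dual_act H a \<psi> b)" for a b \<psi> c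
    by (auto simp: dual_act_def fscale_def fun_eq_iff)
  have list_scale: "(\<Sum>t\<leftarrow>ts. fscale c (g t)) = fscale c (\<Sum>t\<leftarrow>ts. g t)"
    for c and g :: "'a \<times> 'a \<Rightarrow> 'a \<Rightarrow> 'k" and ts
    by (induction ts) (auto simp: fscale_def fun_eq_iff distrib_left)
  have "coinv_proj H B (\<psi> + \<psi>') = coinv_proj H B \<psi> + coinv_proj H B \<psi>'" for \<psi> \<psi>'
    unfolding coinv_proj_def conv_add act_add sum.distrib case_prod_unfold sum_list_addf ..
  moreover have "coinv_proj H B (fscale c \<psi>) = fscale c (coinv_proj H B \<psi>)" for c \<psi>
    unfolding coinv_proj_def conv_scale act_scale F.scale_sum_right[symmetric] case_prod_unfold
      list_scale ..
  ultimately have "Vector_Spaces.linear fscale fscale (coinv_proj H B)"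
    unfolding Vector_Spaces.linear_iff using F.vector_space_axioms by blast
  then show ?thesis
    unfolding left_cointegrals_def by (rule FF.linear_subspace_image[OF _ sub])
qed

end

theory Submission
  imports Defs
begin

text \<open>
  The dual of \<open>H\<close> is a quasi-Hopf bimodule, so \<open>\<psi> = E(\<psi>\<^sub>0) \<cdot> \<psi>\<^sub>1\<close> for all \<open>\<psi>\<close>, and a left cointegral
  \<open>\<lambda>\<close> satisfies \<open>E(\<lambda>\<^sub>0) \<otimes> \<lambda>\<^sub>1 = \<lambda> \<otimes> 1\<close>.  The first equation gives a nonzero \<open>\<lambda>\<close>.  By the second, the
  map \<open>a \<mapsto> \<lambda> \<cdot> a = \<lambda>(_ S(a))\<close> is injective, hence bijective, so \<open>\<lambda>\<close> is nondegenerate; and if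
  \<open>\<mu> = \<lambda> \<cdot> c\<close> is another cointegral, computing \<open>E(\<mu>\<^sub>0) \<otimes> \<mu>\<^sub>1\<close> in two ways gives \<open>\<mu> \<otimes> 1 = \<lambda> \<otimes> c\<close>,
  so \<open>\<mu>\<close> is a multiple of \<open>\<lambda>\<close>.

  The bimodule axioms for the coaction rest on identities for \<open>U\<close> and \<open>V\<close>.  If \<open>\<phi>\<inverse> = x \<otimes> y \<otimes> z\<close>, then
  \<open>U = \<Delta>(S(x) \<alpha> y) p\<^sub>R (1 \<otimes> S(z))\<close>, from which the identities for \<open>U\<close> follow by the pentagon; those
  for \<open>V\<close> are the same identities in the opposite algebra.
\<close>

text \<open>Tensors exist here only as lists modulo relations, so calculating with f, U and V in H
  \<otimes> H would drag representatives through every step. Each identity is instead proved for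
  arbitrary commuting algebra maps into an arbitrary algebra, where a tensor becomes an element that
  can be inverted and cancelled; it returns to lists through four commuting operators whose products
  determine the values of every multilinear form.

  The formula for U is found by solving f U = (S \<otimes> S)(q_R^21): f moves past \<Delta>(S(x)),
  and f \<Delta>(\<alpha>) = \<gamma>. An explicit formula gives only a right inverse of f; finite
  dimension makes it two-sided.

  The injectivity rests on E(\<psi> \<cdot> c) = \<epsilon>(c) E(\<psi>): it turns the coinvariance
  of \<lambda> into E((\<lambda> \<cdot> c)_0) \<otimes> (\<lambda> \<cdot> c)_1 = \<lambda>
  \<otimes> c, so \<lambda> \<cdot> c = 0 forces c = 0. The dual bases inside E form a trace, and
  its cyclicity yields this invariance.\<close>

section \<open>Sums over lists of tuples\<close>

definition sum2 :: "('a \<times> 'b) list \<Rightarrow> ('a \<Rightarrow> 'b \<Rightarrow> 'v::comm_monoid_add) \<Rightarrow> 'v" where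
  "sum2 ts F = (\<Sum>(x, y)\<leftarrow>ts. F x y)"

definition sum3 :: "('a \<times> 'b \<times> 'c) list \<Rightarrow> ('a \<Rightarrow> 'b \<Rightarrow> 'c \<Rightarrow> 'v::comm_monoid_add) \<Rightarrow> 'v" where
  "sum3 ts F = (\<Sum>(x, y, z)\<leftarrow>ts. F x y z)"

lemma sum2_add: "sum2 ts (\<lambda>x y. F x y + G x y) = sum2 ts F + sum2 ts G"
  unfolding sum2_def by (induction ts) (auto simp: ac_simps)

lemma sum3_add: "sum3 ts (\<lambda>x y z. F x y z + G x y z) = sum3 ts F + sum3 ts G"
  unfolding sum3_def by (induction ts) (auto simp: ac_simps)

lemma sum2_zero [simp]: "sum2 ts (\<lambda>x y. 0) = 0"
  unfolding sum2_def by (induction ts) auto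

lemma sum3_zero [simp]: "sum3 ts (\<lambda>x y z. 0) = 0"
  unfolding sum3_def by (induction ts) auto

lemma sum2_hom:
  assumes "\<And>x y. L (x + y) = L x + L y" and "L 0 = 0"
  shows "L (sum2 ts F) = sum2 ts (\<lambda>x y. L (F x y))"
  unfolding sum2_def by (induction ts) (auto simp: assms)

lemma sum3_hom:
  assumes "\<And>x y. L (x + y) = L x + L y" and "L 0 = 0"
  shows "L (sum3 ts F) = sum3 ts (\<lambda>x y z. L (F x y z))"
  unfolding sum3_def by (induction ts) (auto simp: assms)

lemma sum2_Nil [simp]: "sum2 [] F = 0"
  and sum2_Cons [simp]: "sum2 ((x, y) # ts) F = F x y + sum2 ts F"
  by (simp_all add: sum2_def)

lemma sum3_Nil [simp]: "sum3 [] F = 0"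
  and sum3_Cons [simp]: "sum3 ((x, y, z) # ts) F = F x y z + sum3 ts F"
  by (simp_all add: sum3_def)

lemma sum2_append: "sum2 (ts @ us) F = sum2 ts F + sum2 us F"
  by (simp add: sum2_def)

lemma sum2_sum2: "sum2 ts (\<lambda>x y. sum2 us (\<lambda>z w. F x y z w)) =
  sum2 us (\<lambda>z w. sum2 ts (\<lambda>x y. F x y z w))"
  by (induction ts) (auto simp: sum2_add)

lemma sum2_sum3: "sum2 ts (\<lambda>x y. sum3 us (\<lambda>u v w. F x y u v w)) =
  sum3 us (\<lambda>u v w. sum2 ts (\<lambda>x y. F x y u v w))"
  by (induction ts) (auto simp: sum3_add)

lemma sum3_sum3: "sum3 ts (\<lambda>x y z. sum3 us (\<lambda>u v w. F x y z u v w)) =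
    sum3 us (\<lambda>u v w. sum3 ts (\<lambda>x y z. F x y z u v w))"
  by (induction ts) (auto simp: sum3_add)

lemma sum_sum2: "(\<Sum>i\<in>I. sum2 ts (F i)) = sum2 ts (\<lambda>x y. \<Sum>i\<in>I. F i x y)"
  by (induction ts) (auto simp: sum.distrib)

lemma sum_sum3: "(\<Sum>i\<in>I. sum3 ts (F i)) = sum3 ts (\<lambda>x y z. \<Sum>i\<in>I. F i x y z)"
  by (induction ts) (auto simp: sum.distrib)

section \<open>Multilinear maps and algebras with explicit multiplication\<close>

text \<open>\<open>Vector_Spaces.linear\<close> carries the vector space axioms of both sides;
  keeping only the two equations lets the simplifier prove linearity of long expressions slot by
  slot.\<close>

definition klin ::
  "('k::field \<Rightarrow> 'a::ab_group_add \<Rightarrow> 'a) \<Rightarrow> ('k \<Rightarrow> 'b::ab_group_add \<Rightarrow> 'b) \<Rightarrow> ('a \<Rightarrow> 'b) \<Rightarrow> bool" where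
  "klin s t f \<longleftrightarrow> (\<forall>x y. f (x + y) = f x + f y) \<and> (\<forall>c x. f (s c x) = t c (f x))"

definition mlin2 where
  "mlin2 s t F \<longleftrightarrow> (\<forall>y. klin s t (\<lambda>x. F x y)) \<and> (\<forall>x. klin s t (\<lambda>y. F x y))"

definition mlin3 where
  "mlin3 s t F \<longleftrightarrow> (\<forall>y z. klin s t (\<lambda>x. F x y z)) \<and> (\<forall>x z. klin s t (\<lambda>y. F x y z)) \<and>
     (\<forall>x y. klin s t (\<lambda>z. F x y z))"

definition mlin4 where
  "mlin4 s t F \<longleftrightarrow> (\<forall>y z w. klin s t (\<lambda>x. F x y z w)) \<and> (\<forall>x z w. klin s t (\<lambda>y. F x y z w)) \<and>
     (\<forall>x y w. klin s t (\<lambda>z. F x y z w)) \<and> (\<forall>x y z. klin s t (\<lambda>w. F x y z w))"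

lemma klin_add: "klin s t f \<Longrightarrow> f (x + y) = f x + f y"
  and klin_scale: "klin s t f \<Longrightarrow> f (s c x) = t c (f x)"
  by (auto simp: klin_def)

lemma klin_zero: "klin s t f \<Longrightarrow> f 0 = 0"
  using klin_add[of s t f 0 0] by simp

lemma klin_sum2: "klin s t L \<Longrightarrow> L (sum2 ts F) = sum2 ts (\<lambda>x y. L (F x y))"
  by (rule sum2_hom[of L]) (auto simp: klin_add klin_zero)

lemma klin_sum3: "klin s t L \<Longrightarrow> L (sum3 ts F) = sum3 ts (\<lambda>x y z. L (F x y z))"
  by (rule sum3_hom[of L]) (auto simp: klin_add klin_zero)

lemma klin_sum: "klin s t L \<Longrightarrow> L (\<Sum>i\<in>I. F i) = (\<Sum>i\<in>I. L (F i))"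
  by (induction I rule: infinite_finite_induct) (auto simp: klin_add klin_zero)

lemma klin_comp: "klin s t f \<Longrightarrow> klin t u g \<Longrightarrow> klin s u (\<lambda>x. g (f x))"
  by (simp add: klin_def)

lemmas mlin_defs = mlin2_def mlin3_def mlin4_def klin_def

lemma mlin2_comp: "mlin2 s t F \<Longrightarrow> klin t u l \<Longrightarrow> mlin2 s u (\<lambda>x y. l (F x y))"
  and mlin3_comp: "mlin3 s t G \<Longrightarrow> klin t u l \<Longrightarrow> mlin3 s u (\<lambda>x y z. l (G x y z))"
  and mlin4_comp: "mlin4 s t H \<Longrightarrow> klin t u l \<Longrightarrow> mlin4 s u (\<lambda>x y z w. l (H x y z w))"
  by (simp_all add: mlin_defs)

lemma vector_space_mult: "vector_space ((*) :: 'k::field \<Rightarrow> 'k \<Rightarrow> 'k)"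
  by unfold_locales (auto simp: algebra_simps)

text \<open>A nonzero vector extends to a basis, so some functional takes the value 1 on it. This
  lifts axioms known for scalar-valued forms to multilinear maps with values in any space.\<close>

lemma (in vector_space) klin_separates:
  assumes "\<And>l. klin scale (*) l \<Longrightarrow> l x = l y"
  shows "x = y"
proof (rule ccontr)
  assume "x \<noteq> y"
  interpret K: vector_space "(*) :: 'a \<Rightarrow> 'a \<Rightarrow> 'a" by (rule vector_space_mult)
  interpret P: vector_space_pair scale "(*) :: 'a \<Rightarrow> 'a \<Rightarrow> 'a" ..
  have "independent {x - y}" using \<open>x \<noteq> y\<close> by simp
  from P.linear_independent_extend[OF this, of "\<lambda>_. 1"] obtain l
    where l: "Vector_Spaces.linear scale (*) l" "l (x - y) = 1" by auto
  from l(1) have "klin scale (*) l"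
    by (simp add: klin_def Vector_Spaces.linear_iff)
  from assms[OF this] have "l x = l y" .
  moreover have "l (x - y) = l x - l y" by (rule P.linear_diff[OF l(1)])
  ultimately show False using l(2) by simp
qed

text \<open>The functional is prescribed on a basis of the span enlarged by \<open>x\<close>. With
  the multilinearity relations as \<open>S\<close>, it detects that two lists represent different
  tensors.\<close>

lemma (in vector_space) klin_separates_span:
  assumes "x \<notin> span S"
  obtains l where "klin scale (*) l" "\<And>s. s \<in> S \<Longrightarrow> l s = 0" "l x = 1"
proof -
  interpret K: vector_space "(*) :: 'a \<Rightarrow> 'a \<Rightarrow> 'a" by (rule vector_space_mult)
  interpret P: vector_space_pair scale "(*) :: 'a \<Rightarrow> 'a \<Rightarrow> 'a" ..
  obtain B where B: "B \<subseteq> span S" "independent B" "span S \<subseteq> span B"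
    using basis_exists[of "span S"] by metis
  have sp: "span B = span S" using span_mono[OF B(1)] B(3) by (simp only: span_span)
  have "independent (insert x B)" using assms sp B(2) by (simp add: independent_insertI)
  moreover have "x \<notin> B" using assms B(1) by blast
  ultimately obtain l where l: "Vector_Spaces.linear scale (*) l"
    "\<forall>b\<in>insert x B. l b = (if b = x then 1 else 0)"
    using P.linear_independent_extend[of "insert x B" "\<lambda>b. if b = x then 1 else 0"] by blast
  have "l s = 0" if "s \<in> S" for s
  proof -
    have "s \<in> span B" unfolding sp using that by (rule span_base)
    moreover have "l b = 0" if "b \<in> B" for b using l(2) that \<open>x \<notin> B\<close> by auto
    ultimately show ?thesis by (rule P.linear_eq_0_on_span[OF l(1), rotated])
  qed
  moreover have "klin scale (*) l" using l(1) by (simp add: klin_def Vector_Spaces.linear_iff)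
  moreover have "l x = 1" using l(2) by simp
  ultimately show ?thesis using that[of l] by blast
qed

locale kalg = vector_space scl
  for scl :: "'k::field \<Rightarrow> 'r::ab_group_add \<Rightarrow> 'r" +
  fixes mul :: "'r \<Rightarrow> 'r \<Rightarrow> 'r" and one :: 'r
  assumes mul_assoc: "mul (mul a b) c = mul a (mul b c)"
    and mul_add_left: "mul (a + b) c = mul a c + mul b c"
    and mul_add_right: "mul a (b + c) = mul a b + mul a c"
    and mul_scl_left: "mul (scl k a) b = scl k (mul a b)"
    and mul_scl_right: "mul a (scl k b) = scl k (mul a b)"
    and mul_one_left [simp]: "mul one a = a"
    and mul_one_right [simp]: "mul a one = a"
begin

lemma mul_zero_left [simp]: "mul 0 a = 0" and mul_zero_right [simp]: "mul a 0 = 0"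
  using mul_add_left[of 0 0 a] mul_add_right[of a 0 0] by auto

lemma mul_sum2_left: "mul (sum2 ts F) b = sum2 ts (\<lambda>x y. mul (F x y) b)"
  by (rule sum2_hom[of "\<lambda>a. mul a b"]) (auto simp: mul_add_left)

lemma mul_sum2_right: "mul b (sum2 ts F) = sum2 ts (\<lambda>x y. mul b (F x y))"
  by (rule sum2_hom[of "mul b"]) (auto simp: mul_add_right)

lemma mul_sum3_left: "mul (sum3 ts F) b = sum3 ts (\<lambda>x y z. mul (F x y z) b)"
  by (rule sum3_hom[of "\<lambda>a. mul a b"]) (auto simp: mul_add_left)

lemma mul_sum3_right: "mul b (sum3 ts F) = sum3 ts (\<lambda>x y z. mul b (F x y z))"
  by (rule sum3_hom[of "mul b"]) (auto simp: mul_add_right)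

lemmas mul_sum_left = mul_sum2_left mul_sum3_left
lemmas mul_sum_right = mul_sum2_right mul_sum3_right
lemmas mul_sum = mul_sum2_left mul_sum2_right mul_sum3_left mul_sum3_right

lemma scl_sum2: "scl c (sum2 ts F) = sum2 ts (\<lambda>x y. scl c (F x y))"
  by (rule sum2_hom[of "scl c"]) (auto simp: scale_right_distrib)

lemma scl_sum3: "scl c (sum3 ts F) = sum3 ts (\<lambda>x y z. scl c (F x y z))"
  by (rule sum3_hom[of "scl c"]) (auto simp: scale_right_distrib)

lemmas scl_sum = scl_sum2 scl_sum3

lemmas lin_simps = mul_add_left mul_add_right mul_scl_left mul_scl_right scale_right_distrib
  sum2_add sum3_add scl_sum2 scl_sum3

lemma kalg_op: "kalg scl (\<lambda>a b. mul b a) one"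
  by unfold_locales (auto simp: mul_assoc mul_add_left mul_add_right mul_scl_left mul_scl_right)

end

section \<open>Evaluation of tensors on commuting algebra maps\<close>

text \<open>
  The multiplication is a parameter, so that the opposite algebra is an instance as well, with
  \<open>\<phi>\<close> and \<open>\<phi>\<inverse>\<close> (\<open>ph\<close> and \<open>pi\<close>), \<open>S\<close> and \<open>S\<inverse>\<close> (\<open>T\<close>) exchanged, \<open>\<alpha>\<close> replaced by \<open>S\<inverse>(\<beta>)\<close>
  and \<open>\<beta>\<close> by \<open>S\<inverse>(\<alpha>)\<close>; the redundant axioms make this symmetry visible.  Tensor equations are
  tested on multilinear forms.
\<close>

locale qh = kalg sc m e + finite_dimensional_vector_space sc B
  for sc :: "'k::field \<Rightarrow> 'a::ab_group_add \<Rightarrow> 'a" and m :: "'a \<Rightarrow> 'a \<Rightarrow> 'a" (infixl "\<cdot>" 70)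
    and e :: 'a and B :: "'a set" +
  fixes cm :: "'a \<Rightarrow> ('a \<times> 'a) list" and ep :: "'a \<Rightarrow> 'k"
    and ph :: "('a \<times> 'a \<times> 'a) list" and pi :: "('a \<times> 'a \<times> 'a) list"
    and S :: "'a \<Rightarrow> 'a" and T :: "'a \<Rightarrow> 'a" and al :: 'a and be :: 'a
  assumes e_in_B: "e \<in> B"
    and cm_klin0: "mlin2 sc (*) F2 \<Longrightarrow> klin sc (*) (\<lambda>a. sum2 (cm a) F2)"
    and cm_mult0: "mlin2 sc (*) F2 \<Longrightarrow> sum2 (cm (a \<cdot> b)) F2 =
          sum2 (cm a) (\<lambda>x y. sum2 (cm b) (\<lambda>x' y'. F2 (x \<cdot> x') (y \<cdot> y')))"
    and cm_one0: "mlin2 sc (*) F2 \<Longrightarrow> sum2 (cm e) F2 = F2 e e"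
    and ep_klin: "klin sc (*) ep"
    and ep_mult: "ep (a \<cdot> b) = ep a * ep b"
    and ep_one: "ep e = 1"
    and ph_pi0: "mlin3 sc (*) F3 \<Longrightarrow>
          sum3 ph (\<lambda>x y z. sum3 pi (\<lambda>x' y' z'. F3 (x \<cdot> x') (y \<cdot> y') (z \<cdot> z'))) = F3 e e e"
    and pi_ph0: "mlin3 sc (*) F3 \<Longrightarrow>
          sum3 pi (\<lambda>x y z. sum3 ph (\<lambda>x' y' z'. F3 (x \<cdot> x') (y \<cdot> y') (z \<cdot> z'))) = F3 e e e"
    and coassoc0: "mlin3 sc (*) F3 \<Longrightarrow>
          sum2 (cm a) (\<lambda>a1 a2. sum2 (cm a2)
            (\<lambda>a21 a22. sum3 ph (\<lambda>x y z. F3 (a1 \<cdot> x) (a21 \<cdot> y) (a22 \<cdot> z)))) =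
          sum2 (cm a) (\<lambda>a1 a2. sum2 (cm a1)
            (\<lambda>a11 a12. sum3 ph (\<lambda>x y z. F3 (x \<cdot> a11) (y \<cdot> a12) (z \<cdot> a2))))"
    and coassoc_inv0: "mlin3 sc (*) F3 \<Longrightarrow>
          sum2 (cm a) (\<lambda>a1 a2. sum2 (cm a2)
            (\<lambda>a21 a22. sum3 pi (\<lambda>x y z. F3 (x \<cdot> a1) (y \<cdot> a21) (z \<cdot> a22)))) =
          sum2 (cm a) (\<lambda>a1 a2. sum2 (cm a1)
            (\<lambda>a11 a12. sum3 pi (\<lambda>x y z. F3 (a11 \<cdot> x) (a12 \<cdot> y) (a2 \<cdot> z))))"
    and pent0: "mlin4 sc (*) F4 \<Longrightarrow>
          sum3 ph (\<lambda>x y z. sum2 (cm z) (\<lambda>z1 z2. sum3 ph (\<lambda>x' y' z'. sum2 (cm x') (\<lambda>x1 x2.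
            F4 (x \<cdot> x1) (y \<cdot> x2) (z1 \<cdot> y') (z2 \<cdot> z'))))) =
          sum3 ph (\<lambda>x y z. sum3 ph (\<lambda>x' y' z'. sum2 (cm y') (\<lambda>y1 y2. sum3 ph (\<lambda>u v w.
            F4 (x' \<cdot> u) (x \<cdot> (y1 \<cdot> v)) (y \<cdot> (y2 \<cdot> w)) (z \<cdot> z')))))"
    and pent_inv0: "mlin4 sc (*) F4 \<Longrightarrow>
          sum3 pi (\<lambda>x y z. sum2 (cm z) (\<lambda>z1 z2. sum3 pi (\<lambda>x' y' z'. sum2 (cm x') (\<lambda>x1 x2.
            F4 (x1 \<cdot> x) (x2 \<cdot> y) (y' \<cdot> z1) (z' \<cdot> z2))))) =
          sum3 pi (\<lambda>x y z. sum3 pi (\<lambda>x' y' z'. sum2 (cm y') (\<lambda>y1 y2. sum3 pi (\<lambda>u v w.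
            F4 (u \<cdot> x') (v \<cdot> (y1 \<cdot> x)) (w \<cdot> (y2 \<cdot> y)) (z' \<cdot> z)))))"
    and counit_l: "sum2 (cm a) (\<lambda>x y. sc (ep x) y) = a"
    and counit_r: "sum2 (cm a) (\<lambda>x y. sc (ep y) x) = a"
    and ep_ph0: "mlin2 sc (*) F2 \<Longrightarrow> sum3 ph (\<lambda>x y z. ep y * F2 x z) = F2 e e"
    and ep_pi0: "mlin2 sc (*) F2 \<Longrightarrow> sum3 pi (\<lambda>x y z. ep y * F2 x z) = F2 e e"
    and S_klin: "klin sc sc S" and S_mult: "S (a \<cdot> b) = S b \<cdot> S a" and S_one: "S e = e"
    and T_klin: "klin sc sc T" and T_mult: "T (a \<cdot> b) = T b \<cdot> T a" and T_one: "T e = e"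
    and S_T [simp]: "S (T a) = a" and T_S [simp]: "T (S a) = a"
    and S_al: "sum2 (cm a) (\<lambda>x y. S x \<cdot> al \<cdot> y) = sc (ep a) al"
    and S_be: "sum2 (cm a) (\<lambda>x y. x \<cdot> be \<cdot> S y) = sc (ep a) be"
    and S_ph: "sum3 ph (\<lambda>x y z. x \<cdot> be \<cdot> S y \<cdot> al \<cdot> z) = e"
    and S_pi: "sum3 pi (\<lambda>x y z. S x \<cdot> al \<cdot> y \<cdot> be \<cdot> S z) = e"
    and ep_al: "ep al = 1" and ep_be: "ep be = 1"
begin

text \<open>The antipode axioms of the opposite algebra are the images of the given ones under
  \<open>T\<close>. The normalisation of \<open>T be\<close> and \<open>T al\<close> rests on
  \<epsilon> \<circ> S = \<epsilon>.\<close>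

lemma qh_op: "qh sc (\<lambda>a b. b \<cdot> a) e B cm ep pi ph T S (T be) (T al)"
proof -
  interpret O: kalg sc "\<lambda>a b. b \<cdot> a" e by (rule kalg_op)
  have T_ST: "S x \<cdot> al \<cdot> y \<cdot> be \<cdot> S z = S (z \<cdot> (T be \<cdot> (T y \<cdot> (T al \<cdot> x))))"
    and T_SS: "x \<cdot> be \<cdot> S y \<cdot> al \<cdot> z = S (T z \<cdot> (T al \<cdot> (y \<cdot> (T be \<cdot> T x))))" for x y z
    by (simp_all add: S_mult mul_assoc)
  have ST: "sum2 (cm a) (\<lambda>x y. y \<cdot> (T be \<cdot> T x)) = sc (ep a) (T be)" for a
  proof -
    have "sum2 (cm a) (\<lambda>x y. y \<cdot> (T be \<cdot> T x)) = T (sum2 (cm a) (\<lambda>x y. x \<cdot> be \<cdot> S y))"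
      by (simp add: klin_sum2[OF T_klin] T_mult mul_assoc)
    then show ?thesis by (simp add: S_be klin_scale[OF T_klin])
  qed
  have ST': "sum2 (cm a) (\<lambda>x y. T y \<cdot> (T al \<cdot> x)) = sc (ep a) (T al)" for a
  proof -
    have "sum2 (cm a) (\<lambda>x y. T y \<cdot> (T al \<cdot> x)) = T (sum2 (cm a) (\<lambda>x y. S x \<cdot> al \<cdot> y))"
      by (simp add: klin_sum2[OF T_klin] T_mult mul_assoc)
    then show ?thesis by (simp add: S_al klin_scale[OF T_klin])
  qed
  have SP: "sum3 pi (\<lambda>x y z. z \<cdot> (T be \<cdot> (T y \<cdot> (T al \<cdot> x)))) = e"
  proof -
    have "sum3 pi (\<lambda>x y z. z \<cdot> (T be \<cdot> (T y \<cdot> (T al \<cdot> x)))) =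
        T (sum3 pi (\<lambda>x y z. S x \<cdot> al \<cdot> y \<cdot> be \<cdot> S z))"
      by (simp add: klin_sum3[OF T_klin] T_ST)
    then show ?thesis by (simp add: S_pi T_one)
  qed
  have SP': "sum3 ph (\<lambda>x y z. T z \<cdot> (T al \<cdot> (y \<cdot> (T be \<cdot> T x)))) = e"
  proof -
    have "sum3 ph (\<lambda>x y z. T z \<cdot> (T al \<cdot> (y \<cdot> (T be \<cdot> T x)))) =
        T (sum3 ph (\<lambda>x y z. x \<cdot> be \<cdot> S y \<cdot> al \<cdot> z))"
      by (simp add: klin_sum3[OF T_klin] T_SS)
    then show ?thesis by (simp add: S_ph T_one)
  qed
  \<comment> \<open>The counit of the antipode identity for \<open>al\<close>: as
    \<open>ep al = 1\<close>, it reads \<epsilon>(S(a_(1))) \<epsilon>(a_(2)) = \<epsilon>(a), and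
    the counit law contracts the left side.\<close>
  have epS: "ep (S a) = ep a" for a
  proof -
    have "sum2 (cm a) (\<lambda>x y. ep (S x) * ep y) = ep (sum2 (cm a) (\<lambda>x y. S x \<cdot> al \<cdot> y))"
      by (simp add: klin_sum2[OF ep_klin] ep_mult ep_al)
    also have "\<dots> = ep a" by (simp add: S_al klin_scale[OF ep_klin] ep_al)
    finally have "ep a = ep (S (sum2 (cm a) (\<lambda>x y. sc (ep y) x)))"
      by (simp add: klin_sum2[OF S_klin] klin_sum2[OF ep_klin] klin_scale[OF ep_klin]
          klin_scale[OF S_klin] mult.commute)
    then show ?thesis by (simp add: counit_r)
  qed
  have epT: "ep (T a) = ep a" for a using epS[of "T a"] by simp
  show ?thesis
    apply unfold_locales
    apply (simp_all add: e_in_B cm_klin0 ep_klin ep_one S_klin T_klin S_one T_one ep_ph0 ep_pi0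
        counit_l counit_r epT ep_al ep_be)
    subgoal for F a b
      by (subst cm_mult0, assumption) (rule sum2_sum2)
    subgoal by (rule cm_one0)
    subgoal by (simp add: ep_mult)
    subgoal by (subst sum3_sum3) (rule ph_pi0)
    subgoal by (subst sum3_sum3) (rule pi_ph0)
    subgoal by (rule coassoc_inv0)
    subgoal by (rule coassoc0)
    subgoal using pent_inv0 by (simp add: mul_assoc)
    subgoal using pent0 by (simp add: mul_assoc)
    apply (simp_all add: S_mult T_mult ST ST' SP SP' mul_assoc)
    done
qed

end

locale qh_rep = qh sc m e B cm ep ph pi S T al be + R: kalg sr mr o1
  for sc :: "'k::field \<Rightarrow> 'a::ab_group_add \<Rightarrow> 'a" and m :: "'a \<Rightarrow> 'a \<Rightarrow> 'a" (infixl "\<cdot>" 70)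
    and e :: 'a and B :: "'a set"
    and cm :: "'a \<Rightarrow> ('a \<times> 'a) list" and ep :: "'a \<Rightarrow> 'k"
    and ph :: "('a \<times> 'a \<times> 'a) list" and pi :: "('a \<times> 'a \<times> 'a) list"
    and S :: "'a \<Rightarrow> 'a" and T :: "'a \<Rightarrow> 'a" and al :: 'a and be :: 'a
    and sr :: "'k \<Rightarrow> 'r::ab_group_add \<Rightarrow> 'r" and mr :: "'r \<Rightarrow> 'r \<Rightarrow> 'r" (infixl "\<star>" 70)
    and o1 :: 'r
begin

section \<open>The axioms for multilinear maps with values in an algebra\<close>

lemma cm_klin:
  assumes F: "mlin2 sc sr F" shows "klin sc sr (\<lambda>a. sum2 (cm a) F)"
  unfolding klin_def
proof safe
  fix a b c
  show "sum2 (cm (a + b)) F = sum2 (cm a) F + sum2 (cm b) F"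
  proof (rule R.klin_separates)
    fix l assume l: "klin sr (*) l"
    show "l (sum2 (cm (a + b)) F) = l (sum2 (cm a) F + sum2 (cm b) F)"
      using klin_add[OF cm_klin0[OF mlin2_comp[OF F l]]]
      by (simp add: klin_sum2[OF l] klin_add[OF l])
  qed
  show "sum2 (cm (sc c a)) F = sr c (sum2 (cm a) F)"
  proof (rule R.klin_separates)
    fix l assume l: "klin sr (*) l"
    show "l (sum2 (cm (sc c a)) F) = l (sr c (sum2 (cm a) F))"
      using klin_scale[OF cm_klin0[OF mlin2_comp[OF F l]]]
      by (simp add: klin_sum2[OF l] klin_scale[OF l])
  qed
qed

lemma cm_mult:
  assumes F: "mlin2 sc sr F"
  shows "sum2 (cm (a \<cdot> b)) F = sum2 (cm a) (\<lambda>x y. sum2 (cm b) (\<lambda>x' y'. F (x \<cdot> x') (y \<cdot> y')))"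
proof (rule R.klin_separates)
  fix l assume l: "klin sr (*) l"
  show "l (sum2 (cm (a \<cdot> b)) F) =
      l (sum2 (cm a) (\<lambda>x y. sum2 (cm b) (\<lambda>x' y'. F (x \<cdot> x') (y \<cdot> y'))))"
    by (simp add: klin_sum2[OF l] cm_mult0[OF mlin2_comp[OF F l]])
qed

lemma cm_one:
  assumes F: "mlin2 sc sr F"
  shows "sum2 (cm e) F = F e e"
proof (rule R.klin_separates)
  fix l assume l: "klin sr (*) l"
  show "l (sum2 (cm e) F) = l (F e e)"
    by (simp add: klin_sum2[OF l] cm_one0[OF mlin2_comp[OF F l]])
qed

lemma ph_pi:
  assumes F: "mlin3 sc sr F"
  shows "sum3 ph (\<lambda>x y z. sum3 pi (\<lambda>x' y' z'. F (x \<cdot> x') (y \<cdot> y') (z \<cdot> z'))) = F e e e"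
proof (rule R.klin_separates)
  fix l assume l: "klin sr (*) l"
  show "l (sum3 ph (\<lambda>x y z. sum3 pi (\<lambda>x' y' z'. F (x \<cdot> x') (y \<cdot> y') (z \<cdot> z')))) = l (F e e e)"
    by (simp add: klin_sum3[OF l] ph_pi0[OF mlin3_comp[OF F l]])
qed

lemma pi_ph:
  assumes F: "mlin3 sc sr F"
  shows "sum3 pi (\<lambda>x y z. sum3 ph (\<lambda>x' y' z'. F (x \<cdot> x') (y \<cdot> y') (z \<cdot> z'))) = F e e e"
proof (rule R.klin_separates)
  fix l assume l: "klin sr (*) l"
  show "l (sum3 pi (\<lambda>x y z. sum3 ph (\<lambda>x' y' z'. F (x \<cdot> x') (y \<cdot> y') (z \<cdot> z')))) = l (F e e e)"
    by (simp add: klin_sum3[OF l] pi_ph0[OF mlin3_comp[OF F l]])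
qed

lemma coassoc:
  assumes F: "mlin3 sc sr F"
  shows "sum2 (cm a) (\<lambda>a1 a2. sum2 (cm a2)
    (\<lambda>a21 a22. sum3 ph (\<lambda>x y z. F (a1 \<cdot> x) (a21 \<cdot> y) (a22 \<cdot> z)))) =
    sum2 (cm a) (\<lambda>a1 a2. sum2 (cm a1) (\<lambda>a11 a12. sum3 ph (\<lambda>x y z. F (x \<cdot> a11) (y \<cdot> a12) (z \<cdot> a2))))"
  (is "?A = ?B")
proof (rule R.klin_separates)
  fix l assume l: "klin sr (*) l"
  show "l ?A = l ?B"
    by (simp add: klin_sum3[OF l] klin_sum2[OF l] coassoc0[OF mlin3_comp[OF F l]])
qed

lemma coassoc_inv:
  assumes F: "mlin3 sc sr F"
  shows "sum2 (cm a) (\<lambda>a1 a2. sum2 (cm a2)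
    (\<lambda>a21 a22. sum3 pi (\<lambda>x y z. F (x \<cdot> a1) (y \<cdot> a21) (z \<cdot> a22)))) =
    sum2 (cm a) (\<lambda>a1 a2. sum2 (cm a1) (\<lambda>a11 a12. sum3 pi (\<lambda>x y z. F (a11 \<cdot> x) (a12 \<cdot> y) (a2 \<cdot> z))))"
  (is "?A = ?B")
proof (rule R.klin_separates)
  fix l assume l: "klin sr (*) l"
  show "l ?A = l ?B"
    by (simp add: klin_sum3[OF l] klin_sum2[OF l] coassoc_inv0[OF mlin3_comp[OF F l]])
qed

lemma pent:
  assumes F: "mlin4 sc sr F"
  shows "sum3 ph (\<lambda>x y z. sum2 (cm z) (\<lambda>z1 z2. sum3 ph (\<lambda>x' y' z'. sum2 (cm x') (\<lambda>x1 x2.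
            F (x \<cdot> x1) (y \<cdot> x2) (z1 \<cdot> y') (z2 \<cdot> z'))))) =
          sum3 ph (\<lambda>x y z. sum3 ph (\<lambda>x' y' z'. sum2 (cm y') (\<lambda>y1 y2. sum3 ph (\<lambda>u v w.
            F (x' \<cdot> u) (x \<cdot> (y1 \<cdot> v)) (y \<cdot> (y2 \<cdot> w)) (z \<cdot> z')))))"
  (is "?A = ?B")
proof (rule R.klin_separates)
  fix l assume l: "klin sr (*) l"
  show "l ?A = l ?B"
    by (simp add: klin_sum3[OF l] klin_sum2[OF l] pent0[OF mlin4_comp[OF F l]])
qed

lemma ep_ph:
  assumes F: "mlin2 sc sr F" shows "sum3 ph (\<lambda>x y z. sr (ep y) (F x z)) = F e e"
proof (rule R.klin_separates)
  fix l assume l: "klin sr (*) l"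
  show "l (sum3 ph (\<lambda>x y z. sr (ep y) (F x z))) = l (F e e)"
    by (simp add: klin_sum3[OF l] klin_scale[OF l] ep_ph0[OF mlin2_comp[OF F l]])
qed

lemma counit_l':
  assumes "klin sc sr F" shows "sum2 (cm a) (\<lambda>x y. sr (ep x) (F y)) = F a"
proof -
  have "F a = F (sum2 (cm a) (\<lambda>x y. sc (ep x) y))" by (simp only: counit_l)
  then show ?thesis by (simp add: klin_sum2[OF assms] klin_scale[OF assms])
qed

lemma counit_r':
  assumes "klin sc sr F" shows "sum2 (cm a) (\<lambda>x y. sr (ep y) (F x)) = F a"
proof -
  have "F a = F (sum2 (cm a) (\<lambda>x y. sc (ep y) x))" by (simp only: counit_r)
  then show ?thesis by (simp add: klin_sum2[OF assms] klin_scale[OF assms])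
qed

text \<open>
  An $n$-fold tensor is evaluated on $n$ commuting algebra maps (legs) \<open>H \<rightarrow> R\<close>.  As \<open>cop f g\<close>, that
  is \<open>(f \<otimes> g) \<circ> \<Delta>\<close>, is again such a map, iterated coproducts are compound legs, and coassociativity
  and the pentagon are equations in \<open>R\<close>.
\<close>

definition ahom :: "('a \<Rightarrow> 'r) \<Rightarrow> bool" where
  "ahom f \<longleftrightarrow> klin sc sr f \<and> (\<forall>a b. f (a \<cdot> b) = f a \<star> f b) \<and> f e = o1"

definition cms :: "('a \<Rightarrow> 'r) \<Rightarrow> ('a \<Rightarrow> 'r) \<Rightarrow> bool" where
  "cms f g \<longleftrightarrow> (\<forall>a b. f a \<star> g b = g b \<star> f a)"

definition cop :: "('a \<Rightarrow> 'r) \<Rightarrow> ('a \<Rightarrow> 'r) \<Rightarrow> 'a \<Rightarrow> 'r" where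
  "cop f g a = sum2 (cm a) (\<lambda>x y. f x \<star> g y)"

definition Ph :: "('a \<Rightarrow> 'r) \<Rightarrow> ('a \<Rightarrow> 'r) \<Rightarrow> ('a \<Rightarrow> 'r) \<Rightarrow> 'r" where
  "Ph f g h = sum3 ph (\<lambda>x y z. f x \<star> g y \<star> h z)"

definition Pi :: "('a \<Rightarrow> 'r) \<Rightarrow> ('a \<Rightarrow> 'r) \<Rightarrow> ('a \<Rightarrow> 'r) \<Rightarrow> 'r" where
  "Pi f g h = sum3 pi (\<lambda>x y z. f x \<star> g y \<star> h z)"

definition el :: "'a \<Rightarrow> 'r" where
  "el a = sr (ep a) o1"

lemma ahomD:
  assumes "ahom f"
  shows ahom_klin: "klin sc sr f" and ahom_mult: "f (a \<cdot> b) = f a \<star> f b" and ahom_one: "f e = o1"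
    and ahom_add: "f (a + b) = f a + f b" and ahom_scale: "f (sc c a) = sr c (f a)"
    and ahom_mult': "f a \<star> (f b \<star> r) = f (a \<cdot> b) \<star> r"
  using assms by (auto simp: ahom_def klin_def R.mul_assoc)

lemma cmsD:
  assumes "cms f g"
  shows cms1: "g b \<star> f a = f a \<star> g b" and cms2: "g b \<star> (f a \<star> r) = f a \<star> (g b \<star> r)"
    and cms3: "f a \<star> g b = g b \<star> f a" and cms4: "f a \<star> (g b \<star> r) = g b \<star> (f a \<star> r)"
  using assms unfolding cms_def by (metis R.mul_assoc)+

lemma cms_sym: "cms f g \<Longrightarrow> cms g f"
  by (simp add: cms_def)

lemma el_ahom: "ahom el"
  by (simp add: ahom_def el_def klin_def klin_add[OF ep_klin] klin_scale[OF ep_klin] ep_mult ep_one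
      R.scale_left_distrib R.mul_scl_left R.mul_scl_right mult.commute)

lemma el_mul [simp]: "el a \<star> r = sr (ep a) r" "r \<star> el a = sr (ep a) r"
  by (simp_all add: el_def R.mul_scl_left R.mul_scl_right)

lemma el_cms: "cms f el" "cms el f"
  by (simp_all add: cms_def)

lemma mlin2_legs:
  assumes "ahom f" "ahom g" shows "mlin2 sc sr (\<lambda>x y. f x \<star> g y)"
  using assms[THEN ahom_add] assms[THEN ahom_scale]
  by (simp add: mlin2_def klin_def R.lin_simps)

lemma mlin3_legs:
  assumes "ahom f" "ahom g" "ahom h" shows "mlin3 sc sr (\<lambda>x y z. f x \<star> g y \<star> h z)"
  using assms[THEN ahom_add] assms[THEN ahom_scale]
  by (simp add: mlin3_def klin_def R.lin_simps)

text \<open>Multiplicativity is where the legs have to commute: the second factor of \<Delta>(a)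
  must pass the first factor of \<Delta>(b).\<close>

lemma cop_ahom:
  assumes f: "ahom f" and g: "ahom g" and c: "cms f g"
  shows "ahom (cop f g)"
proof -
  note ml = mlin2_legs[OF f g]
  have "cop f g (a \<cdot> b) = cop f g a \<star> cop f g b" for a b
    unfolding cop_def cm_mult[OF ml]
    by (simp add: R.mul_sum2_left R.mul_sum2_right ahom_mult[OF f] ahom_mult[OF g] R.mul_assoc
      cms2[OF c])
      (rule sum2_sum2)
  moreover have "cop f g e = o1"
    unfolding cop_def cm_one[OF ml] by (simp add: ahom_one[OF f] ahom_one[OF g])
  ultimately show ?thesis
    unfolding ahom_def using cm_klin[OF ml] by (auto simp: cop_def[abs_def])
qed

lemma cop_cms:
  assumes "cms f g" "cms f h" shows "cms f (cop g h)"
  unfolding cms_def cop_def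
  by (simp add: R.mul_sum R.mul_assoc cms1[OF assms(1)] cms2[OF assms(1)] cms1[OF assms(2)])

lemma cop_cms':
  assumes "cms g f" "cms h f" shows "cms (cop g h) f"
  using assms by (metis cms_sym cop_cms)

lemmas leg_intros = cop_ahom cop_cms cop_cms' el_ahom el_cms

lemma cop_el_left: "ahom f \<Longrightarrow> cop el f = f"
  by (rule ext) (simp add: cop_def counit_l' ahom_klin)

lemma cop_el_right: "ahom f \<Longrightarrow> cop f el = f"
  by (rule ext) (simp add: cop_def counit_r' ahom_klin)

text \<open>
  The counit, as the leg \<open>el\<close>, deletes a tensor factor.
\<close>

definition legs2 where "legs2 f g \<longleftrightarrow> ahom f \<and> ahom g \<and> cms f g"
definition legs3 where "legs3 f g h \<longleftrightarrow> legs2 f g \<and> legs2 f h \<and> legs2 g h"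
definition legs4 where "legs4 f g h k \<longleftrightarrow> legs3 f g h \<and> legs2 f k \<and> legs2 g k \<and> legs2 h k"

lemma legs2D:
  assumes "legs2 f g"
  shows "ahom f" "ahom g" "cms f g" "ahom (cop f g)"
  using assms cop_ahom by (auto simp: legs2_def)

lemma legs3D:
  assumes "legs3 f g h"
  shows "legs2 f g" "legs2 f h" "legs2 g h" "legs2 f (cop g h)" "legs2 (cop f g) h"
    "legs2 g f" "legs2 h f" "legs2 h g"
    "ahom f" "ahom g" "ahom h" "cms f g" "cms f h" "cms g h"
  using assms by (auto simp: legs3_def legs2_def intro: leg_intros cms_sym)

lemma legs4D:
  assumes "legs4 f g h k"
  shows "legs3 f g h" "legs3 f g k" "legs3 f h k" "legs3 g h k" "legs3 (cop f g) h k"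
    "legs3 f (cop g h) k" "legs3 f g (cop h k)" "legs2 f g" "legs2 f h" "legs2 f k" "legs2 g h"
      "legs2 g k" "legs2 h k"
  using assms by (auto simp: legs4_def legs3_def legs2_def intro: leg_intros cms_sym)

lemma Ph_Pi:
  assumes "legs3 f g h"
  shows "Ph f g h \<star> Pi f g h = o1" "Pi f g h \<star> Ph f g h = o1"
proof -
  note l = legs3D[OF assms]
  note ml = mlin3_legs[OF l(9-11)]
  note s = R.mul_sum3_left R.mul_sum3_right l(9-11)[THEN ahom_mult] l(9-11)[THEN ahom_one]
    R.mul_assoc l(12-14)[THEN cms2]
  show "Ph f g h \<star> Pi f g h = o1"
    using ph_pi[OF ml] by (simp add: s Ph_def Pi_def sum3_sum3[of ph pi])
  show "Pi f g h \<star> Ph f g h = o1"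
    using pi_ph[OF ml] by (simp add: s Ph_def Pi_def sum3_sum3[of ph pi])
qed

lemma Ph_Pi':
  assumes "legs3 f g h"
  shows "Ph f g h \<star> (Pi f g h \<star> r) = r" "Pi f g h \<star> (Ph f g h \<star> r) = r"
  using Ph_Pi[OF assms] by (metis R.mul_assoc R.mul_one_left)+

lemma Ph_coassoc:
  assumes "legs3 f g h"
  shows "cop f (cop g h) a \<star> Ph f g h = Ph f g h \<star> cop (cop f g) h a"
proof -
  note l = legs3D[OF assms]
  note ml = mlin3_legs[OF l(9-11)]
  show ?thesis
    using coassoc[OF ml, of a]
    by (simp add: R.mul_sum l(9-11)[THEN ahom_mult] R.mul_assoc l(12-14)[THEN cms2]
      l(12-14)[THEN cms1]
        Ph_def cop_def sum2_sum3)
qed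

lemma Ph_pent:
  assumes "legs4 f g h k"
  shows "Ph f g (cop h k) \<star> Ph (cop f g) h k = Ph g h k \<star> (Ph f (cop g h) k \<star> Ph f g h)"
proof -
  note l = legs4D[OF assms]
  note a = legs3D(9-11)[OF l(1)] legs3D(11)[OF l(2)]
  note c = legs3D(12-14)[OF l(1)] legs3D(13-14)[OF l(2)] legs3D(14)[OF l(4)]
  have ml: "mlin4 sc sr (\<lambda>x y z w. f x \<star> g y \<star> h z \<star> k w)"
    using a[THEN ahom_add] a[THEN ahom_scale]
    by (simp add: mlin4_def klin_def R.lin_simps)
  show ?thesis
    unfolding Ph_def cop_def R.mul_assoc R.mul_sum_left
    unfolding R.mul_sum_right
    using pent[OF ml]
    by (simp add: a[THEN ahom_mult] R.mul_assoc c[THEN cms2] c[THEN cms1])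
qed

lemma Ph_mid: "legs2 f g \<Longrightarrow> Ph f el g = o1"
  using ep_ph[OF mlin2_legs[of f g]] by (simp add: legs2_def Ph_def R.mul_scl_left ahom_one)

end

context kalg
begin

text \<open>Primes denote two-sided inverses, given as cancellation rules on right-nested products
  so that they can rewrite. The eight equations are the forms of the pentagon that p_R, U and f will
  call for.\<close>

lemma pentagon_variants:
  assumes p: "mul A B = mul C (mul D E)"
    and i: "\<And>r. mul A (mul A' r) = r" "\<And>r. mul B (mul B' r) = r" "\<And>r. mul C (mul C' r) = r"
       "\<And>r. mul D (mul D' r) = r" "\<And>r. mul E (mul E' r) = r"
       "\<And>r. mul A' (mul A r) = r" "\<And>r. mul B' (mul B r) = r" "\<And>r. mul C' (mul C r) = r"
       "\<And>r. mul D' (mul D r) = r" "\<And>r. mul E' (mul E r) = r"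
  shows "mul B E' = mul A' (mul C D)"
    and "mul C' A = mul D (mul E B')"
    and "mul E' (mul D' C') = mul B' A'"
    and "mul D' (mul C' A) = mul E B'"
    and "mul D' C' = mul E (mul B' A')"
    and "mul A' C = mul B (mul E' D')"
    and "mul C' (mul A B) = mul D E"
    and "E' = mul B' (mul A' (mul C D))"
proof -
  have p': "mul A (mul B r) = mul C (mul D (mul E r))" for r
    using p by (metis mul_assoc)
  have e: "mul E E' = one" "mul E' E = one" "mul D D' = one" "mul C C' = one" "mul A A' = one"
    "mul B B' = one"
    using i(5)[of one] i(10)[of one] i(4)[of one] i(3)[of one] i(1)[of one] i(2)[of one] by simp_all
  have 1: "mul B r = mul A' (mul C (mul D (mul E r)))" for r
    using p'[of r] i(6)[of "mul B r"] by simp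
  show "mul B E' = mul A' (mul C D)" using 1[of E'] by (simp add: e)
  show a: "mul C' A = mul D (mul E B')"
    using p'[of B'] i(8)[of "mul D (mul E B')"] by (simp add: e)
  show "mul D' (mul C' A) = mul E B'" by (simp add: a i)
  show b: "mul D' C' = mul E (mul B' A')"
  proof -
    have o: "one = mul C (mul D (mul E (mul B' A')))" using p'[of "mul B' A'"] by (simp add: e i)
    have "mul D' C' = mul D' (mul C' one)" by simp
    then show ?thesis by (simp only: o i)
  qed
  show "mul E' (mul D' C') = mul B' A'" by (simp add: b i)
  show "mul A' C = mul B (mul E' D')" by (simp add: 1 i e)
  show "mul C' (mul A B) = mul D E" by (simp add: p i)
  show "E' = mul B' (mul A' (mul C D))" using i(7)[of E'] 1[of E'] by (simp add: e)
qed

end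

context qh_rep
begin

lemma Ph_cancel:
  assumes "legs3 f g h" "a \<star> Ph f g h = b \<star> Ph f g h" shows "a = b"
proof -
  have "a \<star> Ph f g h \<star> Pi f g h = b \<star> Ph f g h \<star> Pi f g h" using assms(2) by simp
  then show ?thesis by (simp add: R.mul_assoc Ph_Pi[OF assms(1)])
qed

lemma legs3_el:
  assumes "legs2 f g" shows "legs3 el f g" "legs3 f el g" "legs3 f g el"
  using assms by (auto simp: legs3_def legs2_def intro: leg_intros)

text \<open>With two counit legs in front, the pentagon says that this invertible element is
  idempotent. Only the normalisation in the middle factor is an axiom.\<close>

lemma Ph_el_left:
  assumes "legs2 f g" shows "Ph el f g = o1"
proof -
  have l: "legs4 el el f g" using assms by
    (auto simp: legs4_def legs3_def legs2_def intro: leg_intros)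
  have a: "legs2 el (cop f g)" "legs2 el g" "ahom f" "ahom g"
    using assms by (auto simp: legs2_def intro: leg_intros)
  have "Ph el f g = Ph el f g \<star> Ph el f g \<star> Ph el el f"
    using Ph_pent[OF l] by (simp add: cop_el_left cop_el_right el_ahom a Ph_mid R.mul_assoc)
  then have "o1 \<star> Ph el f g = Ph el f g \<star> Ph el f g"
    using Ph_mid[of el f] a by (simp add: legs2_def el_ahom el_cms R.mul_assoc)
  then show ?thesis using Ph_cancel[OF legs3_el(1)[OF assms]] by metis
qed

lemma Ph_el_right:
  assumes "legs2 f g" shows "Ph f g el = o1"
proof -
  have l: "legs4 f g el el" using assms by
    (auto simp: legs4_def legs3_def legs2_def intro: leg_intros)
  have a: "legs2 (cop f g) el" "legs2 g el" "ahom f" "ahom g"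
    using assms by (auto simp: legs2_def intro: leg_intros)
  have "Ph f g el = Ph f g el \<star> Ph f g el"
    using Ph_pent[OF l] by (simp add: cop_el_left cop_el_right el_ahom a Ph_mid R.mul_assoc)
  then have "o1 \<star> Ph f g el = Ph f g el \<star> Ph f g el" by simp
  then show ?thesis using Ph_cancel[OF legs3_el(3)[OF assms]] by metis
qed

lemma Pi_el:
  assumes "legs2 f g" shows "Pi el f g = o1" "Pi f el g = o1" "Pi f g el = o1"
  using Ph_Pi(1)[OF legs3_el(1)[OF assms]] Ph_Pi(1)[OF legs3_el(2)[OF assms]]
    Ph_Pi(1)[OF legs3_el(3)[OF assms]]
  by (simp_all add: assms Ph_el_left Ph_el_right Ph_mid)

lemma Pi_coassoc:
  assumes "legs3 f g h"
  shows "Pi f g h \<star> cop f (cop g h) a = cop (cop f g) h a \<star> Pi f g h"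
proof (rule Ph_cancel[OF assms])
  show "Pi f g h \<star> cop f (cop g h) a \<star> Ph f g h = cop (cop f g) h a \<star> Pi f g h \<star> Ph f g h"
    by (simp add: R.mul_assoc Ph_coassoc[OF assms] Ph_Pi[OF assms] Ph_Pi'[OF assms])
qed

lemma pent_variants:
  assumes l: "legs4 f g h k"
  shows "Ph (cop f g) h k \<star> Pi f g h = Pi f g (cop h k) \<star> (Ph g h k \<star> Ph f (cop g h) k)"
    and "Pi g h k \<star> Ph f g (cop h k) = Ph f (cop g h) k \<star> (Ph f g h \<star> Pi (cop f g) h k)"
    and "Pi f g h \<star> (Pi f (cop g h) k \<star> Pi g h k) = Pi (cop f g) h k \<star> Pi f g (cop h k)"
    and "Pi f (cop g h) k \<star> (Pi g h k \<star> Ph f g (cop h k)) = Ph f g h \<star> Pi (cop f g) h k"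
    and "Pi f (cop g h) k \<star> Pi g h k = Ph f g h \<star> (Pi (cop f g) h k \<star> Pi f g (cop h k))"
    and "Pi f g (cop h k) \<star> Ph g h k = Ph (cop f g) h k \<star> (Pi f g h \<star> Pi f (cop g h) k)"
    and "Pi g h k \<star> (Ph f g (cop h k) \<star> Ph (cop f g) h k) = Ph f (cop g h) k \<star> Ph f g h"
    and "Pi f g h = Pi (cop f g) h k \<star> (Pi f g (cop h k) \<star> (Ph g h k \<star> Ph f (cop g h) k))"
proof -
  note l' = legs4D[OF l]
  show "Ph (cop f g) h k \<star> Pi f g h = Pi f g (cop h k) \<star> (Ph g h k \<star> Ph f (cop g h) k)"
    and "Pi g h k \<star> Ph f g (cop h k) = Ph f (cop g h) k \<star> (Ph f g h \<star> Pi (cop f g) h k)"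
    and "Pi f g h \<star> (Pi f (cop g h) k \<star> Pi g h k) = Pi (cop f g) h k \<star> Pi f g (cop h k)"
    and "Pi f (cop g h) k \<star> (Pi g h k \<star> Ph f g (cop h k)) = Ph f g h \<star> Pi (cop f g) h k"
    and "Pi f (cop g h) k \<star> Pi g h k = Ph f g h \<star> (Pi (cop f g) h k \<star> Pi f g (cop h k))"
    and "Pi f g (cop h k) \<star> Ph g h k = Ph (cop f g) h k \<star> (Pi f g h \<star> Pi f (cop g h) k)"
    and "Pi g h k \<star> (Ph f g (cop h k) \<star> Ph (cop f g) h k) = Ph f (cop g h) k \<star> Ph f g h"
    and "Pi f g h = Pi (cop f g) h k \<star> (Pi f g (cop h k) \<star> (Ph g h k \<star> Ph f (cop g h) k))"
    by (fact R.pentagon_variants[OF Ph_pent[OF l]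
      Ph_Pi'(1)[OF l'(7)] Ph_Pi'(1)[OF l'(5)] Ph_Pi'(1)[OF l'(4)] Ph_Pi'(1)[OF l'(6)]
        Ph_Pi'(1)[OF l'(1)]
      Ph_Pi'(2)[OF l'(7)] Ph_Pi'(2)[OF l'(5)] Ph_Pi'(2)[OF l'(4)] Ph_Pi'(2)[OF l'(6)]
        Ph_Pi'(2)[OF l'(1)]])+
qed

end

section \<open>A faithful evaluation\<close>

text \<open>Linear operators on functions of tuples form an algebra with room for any number of
  commuting copies of H, one per coordinate. It plays the role of a tensor power of H without a
  quotient construction.\<close>

typedef (overloaded) ('i, 'k) lop = "{A :: ('i \<Rightarrow> 'k::field) \<Rightarrow> ('i \<Rightarrow> 'k). klin fscale fscale A}"
  morphisms app Lop
  by (rule exI[of _ id]) (simp add: klin_def)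

lemma app_add: "app A (F + G) = app A F + app A G" and
  app_scale: "app A (fscale c F) = fscale c (app A F)"
  using app[of A] by (auto simp: klin_def)

lemma app_Lop: "klin fscale fscale A \<Longrightarrow> app (Lop A) = A"
  by (simp add: Lop_inverse)

lemma lop_eqI: "(\<And>F v. app A F v = app A' F v) \<Longrightarrow> A = A'"
  by (metis app_inject ext)

instantiation lop :: (type, field) ab_group_add
begin

definition "0 = (Lop (\<lambda>F. 0) :: ('a, 'b) lop)"
definition "A + A' = Lop (\<lambda>F. app A F + app A' F)" for A A' :: "('a, 'b) lop"
definition "- A = Lop (\<lambda>F. - app A F)" for A :: "('a, 'b) lop"
definition "A - A' = Lop (\<lambda>F. app A F - app A' F)" for A A' :: "('a, 'b) lop"

lemma app_lop:
  "app (0 :: ('a, 'b) lop) F v = 0"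
  "app (A + A') F v = app A F v + app A' F v"
  "app (- A) F v = - app A F v"
  "app (A - A') F v = app A F v - app A' F v"
  for A A' :: "('a, 'b) lop"
  unfolding zero_lop_def plus_lop_def uminus_lop_def minus_lop_def
  by (subst app_Lop;
      simp add: klin_def fscale_def app_add app_scale[unfolded fscale_def] fun_eq_iff
        algebra_simps)+

instance
  by standard (auto intro!: lop_eqI simp: app_lop)

end

definition lop_scale :: "'k::field \<Rightarrow> ('i, 'k) lop \<Rightarrow> ('i, 'k) lop" where
  "lop_scale c A = Lop (\<lambda>F. fscale c (app A F))"

definition lop_mul :: "('i, 'k::field) lop \<Rightarrow> ('i, 'k) lop \<Rightarrow> ('i, 'k) lop" where
  "lop_mul A A' = Lop (\<lambda>F. app A (app A' F))"

definition lop_one :: "('i, 'k::field) lop" where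
  "lop_one = Lop (\<lambda>F. F)"

lemma app_lop_more:
  "app (lop_scale c A) F v = c * app A F v"
  "app (lop_mul A A') F = app A (app A' F)"
  "app lop_one F = F"
  unfolding lop_scale_def lop_mul_def lop_one_def
  by (subst app_Lop; simp add: klin_def fscale_def app_add app_scale[unfolded fscale_def]
    fun_eq_iff algebra_simps)+

lemma kalg_lop: "kalg lop_scale lop_mul (lop_one :: ('i, 'k::field) lop)"
proof
  fix A A' A'' :: "('i, 'k) lop" and c d :: 'k
  show "lop_mul A (A' + A'') = lop_mul A A' + lop_mul A A''"
  proof (rule lop_eqI)
    fix F v
    have "app (A' + A'') F = app A' F + app A'' F" by (simp add: fun_eq_iff app_lop)
    then show "app (lop_mul A (A' + A'')) F v = app (lop_mul A A' + lop_mul A A'') F v"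
      by (simp add: app_lop app_lop_more app_add)
  qed
  show "lop_mul A (lop_scale c A') = lop_scale c (lop_mul A A')"
  proof (rule lop_eqI)
    fix F v
    have "app (lop_scale c A') F = fscale c (app A' F)"
      by (simp add: fun_eq_iff app_lop_more fscale_def)
    then show "app (lop_mul A (lop_scale c A')) F v = app (lop_scale c (lop_mul A A')) F v"
      by (simp add: app_lop_more app_scale) (simp add: fscale_def)
  qed
qed (auto intro!: lop_eqI simp: app_lop app_lop_more algebra_simps)

context qh
begin

text \<open>
  The $n$-th leg is right multiplication in the $n$-th argument, in coordinates with respect to \<open>B\<close>.
  Off the basis it acts by the counit, only to keep it a unital algebra map on all functions.
\<close>

definition leg :: "nat \<Rightarrow> 'a \<Rightarrow> (nat \<Rightarrow> 'a, 'k) lop" where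
  "leg n a = Lop (\<lambda>F v. if v n \<in> B then \<Sum>b\<in>B. representation B (v n \<cdot> a) b * F (v(n := b))
     else ep a * F v)"

lemma app_leg: "app (leg n a) F v =
    (if v n \<in> B then \<Sum>b\<in>B. representation B (v n \<cdot> a) b * F (v(n := b)) else ep a * F v)"
  unfolding leg_def
  by (subst app_Lop)
    (auto simp: klin_def fscale_def fun_eq_iff algebra_simps sum.distrib sum_distrib_left)

lemma rep_add: "representation B (x + y) b = representation B x b + representation B y b"
  by (simp add: representation_add independent_Basis span_Basis)

lemma rep_scale: "representation B (sc c x) b = c * representation B x b"
  by (simp add: representation_scale independent_Basis span_Basis)

lemma rep_klin: "klin sc (*) (\<lambda>x. representation B x b)"
  by (simp add: klin_def rep_add rep_scale)

lemma rep_sum: "(\<Sum>b\<in>B. sc (representation B x b) b) = x"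
  by (rule sum_representation_eq) (use independent_Basis span_Basis finite_Basis in auto)

lemma klin_rep:
  assumes "klin sc s F" shows "F x = (\<Sum>b\<in>B. s (representation B x b) (F b))"
proof -
  have "F x = F (\<Sum>b\<in>B. sc (representation B x b) b)" by (simp only: rep_sum)
  also have "\<dots> = (\<Sum>b\<in>B. s (representation B x b) (F b))"
    by (simp add: klin_sum[OF assms] klin_scale[OF assms])
  finally show ?thesis .
qed

lemma rep_basis: "b \<in> B \<Longrightarrow> representation B b c = (if c = b then 1 else 0)"
  using representation_basis[OF independent_Basis, of b] by auto

lemma leg_klin: "klin sc lop_scale (leg n)"
  unfolding klin_def
  by (auto intro!: lop_eqI simp: app_lop app_lop_more app_leg mul_add_right mul_scl_right rep_add
    rep_scale
      klin_add[OF ep_klin] klin_scale[OF ep_klin] algebra_simps sum.distrib sum_distrib_left)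

text \<open>In a composition the right operator is applied to the function first, but the left one
  changes the argument first. Hence right multiplication gives a homomorphism rather than an
  anti-homomorphism.\<close>

lemma leg_mult: "leg n (a \<cdot> b) = lop_mul (leg n a) (leg n b)"
proof (rule lop_eqI)
  fix F v
  show "app (leg n (a \<cdot> b)) F v = app (lop_mul (leg n a) (leg n b)) F v"
  proof (cases "v n \<in> B")
    case True
    have k: "klin sc (*) (\<lambda>x. representation B (x \<cdot> b) c)" for c
      by (simp add: klin_def mul_add_left mul_scl_left rep_add rep_scale)
    have "app (lop_mul (leg n a) (leg n b)) F v = (\<Sum>b'\<in>B. representation B (v n \<cdot> a) b' *
          (\<Sum>c\<in>B. representation B (b' \<cdot> b) c * F (v(n := c))))"
      using True by (simp add: app_lop_more app_leg)
    also have "\<dots> = (\<Sum>c\<in>B. (\<Sum>b'\<in>B. representation B (v n \<cdot> a) b' * representation B (b' \<cdot> b) c) * F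
      (v(n := c)))"
      by (simp add: sum_distrib_left sum_distrib_right mult.assoc) (rule sum.swap)
    also have "\<dots> = (\<Sum>c\<in>B. representation B (v n \<cdot> a \<cdot> b) c * F (v(n := c)))"
      by (simp only: klin_rep[OF k, of "v n \<cdot> a"])
    also have "\<dots> = app (leg n (a \<cdot> b)) F v" using True by (simp add: app_leg mul_assoc)
    finally show ?thesis by simp
  qed (simp add: app_lop_more app_leg ep_mult)
qed

lemma leg_one: "leg n e = lop_one"
proof (rule lop_eqI)
  fix F :: "(nat \<Rightarrow> 'a) \<Rightarrow> 'k" and v
  have "(\<Sum>b\<in>B. (if b = v n then 1 else 0) * F (v(n := b))) = F v" if "v n \<in> B"
  proof -
    have "(\<Sum>b\<in>B. (if b = v n then 1 else 0) * F (v(n := b))) = (\<Sum>b\<in>B. if b = v n then F v else 0)"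
      by (intro sum.cong) auto
    then show ?thesis using that by (simp add: finite_Basis)
  qed
  then show "app (leg n e) F v = app lop_one F v"
    by (auto simp: app_lop_more app_leg ep_one rep_basis)
qed

lemma leg_commute: "n \<noteq> k \<Longrightarrow> lop_mul (leg n a) (leg k b) = lop_mul (leg k b) (leg n a)"
proof (rule lop_eqI)
  fix F :: "(nat \<Rightarrow> 'a) \<Rightarrow> 'k" and v :: "nat \<Rightarrow> 'a" assume n: "n \<noteq> k"
  let ?r = "\<lambda>n a b. representation B (v n \<cdot> a) b"
  have "(\<Sum>x\<in>B. \<Sum>y\<in>B. ?r n a x * (?r k b y * F (v(n := x, k := y)))) =
      (\<Sum>y\<in>B. \<Sum>x\<in>B. ?r k b y * (?r n a x * F (v(k := y, n := x))))"
    using n by (subst sum.swap) (simp add: fun_upd_twist mult.left_commute)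
  then show "app (lop_mul (leg n a) (leg k b)) F v = app (lop_mul (leg k b) (leg n a)) F v"
    using n by (simp add: app_lop_more app_leg sum_distrib_left mult.left_commute)
qed

text \<open>The form is read as a function of the first four coordinates and evaluated where all of
  them equal \<open>e\<close>. Because \<open>e\<close> lies in \<open>B\<close>, every leg acts
  there by right multiplication and turns \<open>e\<close> into its own argument.\<close>

definition tst :: "('a \<Rightarrow> 'a \<Rightarrow> 'a \<Rightarrow> 'a \<Rightarrow> 'k) \<Rightarrow> (nat \<Rightarrow> 'a, 'k) lop \<Rightarrow> 'k" where
  "tst F A = app A (\<lambda>v. F (v 0) (v 1) (v 2) (v 3)) (\<lambda>_. e)"

lemma tst_klin: "klin lop_scale (*) (tst F)"
  by (simp add: tst_def klin_def app_lop app_lop_more)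

lemma tst_legs:
  assumes F: "mlin4 sc (*) F"
  shows "tst F (lop_mul (leg 0 a) (lop_mul (leg 1 b) (lop_mul (leg 2 c) (leg 3 d)))) = F a b c d"
proof -
  have k: "klin sc (*) (\<lambda>x. F x y z w)" "klin sc (*) (\<lambda>x. F y x z w)" "klin sc (*) (\<lambda>x. F y z x w)"
    "klin sc (*) (\<lambda>x. F y z w x)" for y z w
    using F by (auto simp: mlin4_def)
  have s: "(\<Sum>x\<in>B. representation B u x * G x) = G u" if "klin sc (*) G" for u G
    using klin_rep[OF that, of u] by simp
  show ?thesis
    unfolding tst_def
    by (simp add: app_lop_more app_leg e_in_B s[OF k(1)] s[OF k(2)] s[OF k(3)] s[OF k(4)])
qed

end

text \<open>The rules are unsaturated because the simplifier eta-contracts the summands.\<close>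

lemma mlin2D:
  assumes "mlin2 s t F"
  shows "F (a + b) = (\<lambda>y. F a y + F b y)" "F y (a + b) = F y a + F y b"
    "F (s c a) = (\<lambda>y. t c (F a y))" "F y (s c a) = t c (F y a)"
  using assms by (auto simp: mlin2_def klin_def fun_eq_iff)

lemma mlin3D:
  assumes "mlin3 s t F"
  shows "F (a + b) = (\<lambda>y z. F a y z + F b y z)" "F y (a + b) = (\<lambda>z. F y a z + F y b z)"
    "F y z (a + b) = F y z a + F y z b"
    "F (s c a) = (\<lambda>y z. t c (F a y z))" "F y (s c a) = (\<lambda>z. t c (F y a z))"
      "F y z (s c a) = t c (F y z a)"
  using assms by (auto simp: mlin3_def klin_def fun_eq_iff)

lemma mlin4D:
  assumes "mlin4 s t F"
  shows "F (a + b) = (\<lambda>y z w. F a y z w + F b y z w)" "F y (a + b) = (\<lambda>z w. F y a z w + F y b z w)"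
    "F y z (a + b) = (\<lambda>w. F y z a w + F y z b w)" "F y z w (a + b) = F y z w a + F y z w b"
    "F (s c a) = (\<lambda>y z w. t c (F a y z w))" "F y (s c a) = (\<lambda>z w. t c (F y a z w))"
    "F y z (s c a) = (\<lambda>w. t c (F y z a w))" "F y z w (s c a) = t c (F y z w a)"
  using assms by (auto simp: mlin4_def klin_def fun_eq_iff)

context qh
begin

lemma qh_rep_lop: "qh_rep sc (\<cdot>) e B cm ep ph pi S T al be lop_scale
    (lop_mul :: (nat \<Rightarrow> 'a, 'k) lop \<Rightarrow> _) lop_one"
  using qh_axioms kalg_lop by (simp add: qh_rep_def)

interpretation U: qh_rep sc "(\<cdot>)" e B cm ep ph pi S T al be lop_scale
    "lop_mul :: (nat \<Rightarrow> 'a, 'k) lop \<Rightarrow> _" lop_one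
  by (rule qh_rep_lop)

lemma leg_ahom: "U.ahom (leg n)"
  by (simp add: U.ahom_def leg_klin leg_mult leg_one)

lemma leg_cms: "n \<noteq> k \<Longrightarrow> U.cms (leg n) (leg k)"
  by (simp add: U.cms_def leg_commute)

lemma legs4_leg: "U.legs4 (leg 0) (leg 1) (leg 2) (leg 3)"
  by (simp add: U.legs4_def U.legs3_def U.legs2_def leg_ahom leg_cms)

lemmas leg_comm =
  U.cms1[OF leg_cms[of 0 1]] U.cms1[OF leg_cms[of 0 2]] U.cms1[OF leg_cms[of 0 3]]
  U.cms1[OF leg_cms[of 1 2]] U.cms1[OF leg_cms[of 1 3]] U.cms1[OF leg_cms[of 2 3]]
  U.cms2[OF leg_cms[of 0 1]] U.cms2[OF leg_cms[of 0 2]] U.cms2[OF leg_cms[of 0 3]]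
  U.cms2[OF leg_cms[of 1 2]] U.cms2[OF leg_cms[of 1 3]] U.cms2[OF leg_cms[of 2 3]]

lemma leg_merge: "lop_mul (leg n a) (leg n b) = leg n (a \<cdot> b)"
    "lop_mul (leg n a) (lop_mul (leg n b) A) = lop_mul (leg n (a \<cdot> b)) A"
  by (simp_all add: leg_mult U.R.mul_assoc)

lemmas tst_push = klin_sum2[OF tst_klin] klin_sum3[OF tst_klin]

lemmas leg_expand_left = U.Ph_def U.Pi_def U.cop_def U.R.mul_assoc U.R.mul_sum_left
lemmas leg_expand_right = U.R.mul_sum_right sum2_sum3 tst_push
lemmas leg_expand = U.R.mul_assoc leg_comm leg_merge mul_assoc

end

context qh_rep
begin

interpretation U: qh_rep sc "(\<cdot>)" e B cm ep ph pi S T al be lop_scale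
    "lop_mul :: (nat \<Rightarrow> 'a, 'k) lop \<Rightarrow> _" lop_one
  by (rule qh_rep_lop)

text \<open>Equation number $n$ of \<open>pent_variants\<close>, transported to multilinear maps.\<close>

lemma pentagon1:
  assumes F: "mlin4 sc sr F"
  shows "sum3 ph (\<lambda>x y z. sum3 pi (\<lambda>u v w. sum2 (cm x) (\<lambda>x1 x2. F (x1 \<cdot> u) (x2 \<cdot> v) (y \<cdot> w) z))) =
    sum3 pi (\<lambda>x y z. sum3 ph (\<lambda>u v w. sum3 ph
      (\<lambda>X Y Z. sum2 (cm z) (\<lambda>z1 z2. sum2 (cm Y)
      (\<lambda>Y1 Y2. F (x \<cdot> X) (y \<cdot> (u \<cdot> Y1)) (z1 \<cdot> (v \<cdot> Y2)) (z2 \<cdot> (w \<cdot> Z)))))))"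
    (is "?A = ?B")
proof (rule R.klin_separates)
  fix l assume l: "klin sr (*) l"
  note t = tst_legs[OF mlin4_comp[OF F l]]
  note q = U.pent_variants(1)[OF legs4_leg, THEN
    arg_cong[where f = "tst (\<lambda>x y z w. l (F x y z w))"]]
  note q = q[unfolded leg_expand_left, unfolded leg_expand_right]
  show "l ?A = l ?B"
    using q by (simp del: One_nat_def add: t klin_sum3[OF l] klin_sum2[OF l] leg_expand)
qed

lemma pentagon2:
  assumes F: "mlin4 sc sr F"
  shows "sum3 pi (\<lambda>x y z. sum3 ph (\<lambda>u v w. sum2 (cm w) (\<lambda>w1 w2. F u (x \<cdot> v) (y \<cdot> w1) (z \<cdot> w2)))) =
    sum3 ph (\<lambda>x y z. sum3 ph (\<lambda>u v w. sum3 pi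
      (\<lambda>X Y Z. sum2 (cm y) (\<lambda>y1 y2. sum2 (cm X)
      (\<lambda>X1 X2. F (x \<cdot> (u \<cdot> X1)) (y1 \<cdot> (v \<cdot> X2)) (y2 \<cdot> (w \<cdot> Y)) (z \<cdot> Z))))))"
    (is "?A = ?B")
proof (rule R.klin_separates)
  fix l assume l: "klin sr (*) l"
  note t = tst_legs[OF mlin4_comp[OF F l]]
  note q = U.pent_variants(2)[OF legs4_leg, THEN
    arg_cong[where f = "tst (\<lambda>x y z w. l (F x y z w))"]]
  note q = q[unfolded leg_expand_left, unfolded leg_expand_right]
  show "l ?A = l ?B"
    using q by (simp del: One_nat_def add: t klin_sum3[OF l] klin_sum2[OF l] leg_expand)
qed

lemma pentagon3:
  assumes F: "mlin4 sc sr F"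
  shows "sum3 pi (\<lambda>x y z. sum3 pi (\<lambda>u v w. sum3 pi
    (\<lambda>X Y Z. sum2 (cm v) (\<lambda>v1 v2. F (x \<cdot> u) (y \<cdot> (v1 \<cdot> X)) (z \<cdot> (v2 \<cdot> Y)) (w \<cdot> Z))))) =
    sum3 pi (\<lambda>x y z. sum3 pi (\<lambda>u v w. sum2 (cm x)
      (\<lambda>x1 x2. sum2 (cm w) (\<lambda>w1 w2. F (x1 \<cdot> u) (x2 \<cdot> v) (y \<cdot> w1) (z \<cdot> w2)))))"
    (is "?A = ?B")
proof (rule R.klin_separates)
  fix l assume l: "klin sr (*) l"
  note t = tst_legs[OF mlin4_comp[OF F l]]
  note q = U.pent_variants(3)[OF legs4_leg, THEN
    arg_cong[where f = "tst (\<lambda>x y z w. l (F x y z w))"]]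
  note q = q[unfolded leg_expand_left, unfolded leg_expand_right]
  show "l ?A = l ?B"
    using q by (simp del: One_nat_def add: t klin_sum3[OF l] klin_sum2[OF l] leg_expand)
qed

lemma pentagon4:
  assumes F: "mlin4 sc sr F"
  shows "sum3 pi (\<lambda>x y z. sum3 pi (\<lambda>u v w. sum3 ph
    (\<lambda>X Y Z. sum2 (cm y) (\<lambda>y1 y2. sum2 (cm Z)
    (\<lambda>Z1 Z2. F (x \<cdot> X) (y1 \<cdot> (u \<cdot> Y)) (y2 \<cdot> (v \<cdot> Z1)) (z \<cdot> (w \<cdot> Z2))))))) =
    sum3 ph (\<lambda>x y z. sum3 pi (\<lambda>u v w. sum2 (cm u) (\<lambda>u1 u2. F (x \<cdot> u1) (y \<cdot> u2) (z \<cdot> v) w)))"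
    (is "?A = ?B")
proof (rule R.klin_separates)
  fix l assume l: "klin sr (*) l"
  note t = tst_legs[OF mlin4_comp[OF F l]]
  note q = U.pent_variants(4)[OF legs4_leg, THEN
    arg_cong[where f = "tst (\<lambda>x y z w. l (F x y z w))"]]
  note q = q[unfolded leg_expand_left, unfolded leg_expand_right]
  show "l ?A = l ?B"
    using q by (simp del: One_nat_def add: t klin_sum3[OF l] klin_sum2[OF l] leg_expand)
qed

lemma pentagon5:
  assumes F: "mlin4 sc sr F"
  shows "sum3 pi (\<lambda>x y z. sum3 pi (\<lambda>u v w. sum2 (cm y) (\<lambda>y1 y2. F x (y1 \<cdot> u) (y2 \<cdot> v) (z \<cdot> w)))) =
    sum3 ph (\<lambda>x y z. sum3 pi (\<lambda>u v w. sum3 pi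
      (\<lambda>X Y Z. sum2 (cm u) (\<lambda>u1 u2. sum2 (cm Z)
      (\<lambda>Z1 Z2. F (x \<cdot> (u1 \<cdot> X)) (y \<cdot> (u2 \<cdot> Y)) (z \<cdot> (v \<cdot> Z1)) (w \<cdot> Z2))))))"
    (is "?A = ?B")
proof (rule R.klin_separates)
  fix l assume l: "klin sr (*) l"
  note t = tst_legs[OF mlin4_comp[OF F l]]
  note q = U.pent_variants(5)[OF legs4_leg, THEN
    arg_cong[where f = "tst (\<lambda>x y z w. l (F x y z w))"]]
  note q = q[unfolded leg_expand_left, unfolded leg_expand_right]
  show "l ?A = l ?B"
    using q by (simp del: One_nat_def add: t klin_sum3[OF l] klin_sum2[OF l] leg_expand)
qed

lemma pentagon6:
  assumes F: "mlin4 sc sr F"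
  shows "sum3 pi (\<lambda>x y z. sum3 ph (\<lambda>u v w. sum2 (cm z) (\<lambda>z1 z2. F x (y \<cdot> u) (z1 \<cdot> v) (z2 \<cdot> w)))) =
    sum3 ph (\<lambda>x y z. sum3 pi (\<lambda>u v w. sum3 pi
      (\<lambda>X Y Z. sum2 (cm x) (\<lambda>x1 x2. sum2 (cm Y)
      (\<lambda>Y1 Y2. F (x1 \<cdot> (u \<cdot> X)) (x2 \<cdot> (v \<cdot> Y1)) (y \<cdot> (w \<cdot> Y2)) (z \<cdot> Z))))))"
    (is "?A = ?B")
proof (rule R.klin_separates)
  fix l assume l: "klin sr (*) l"
  note t = tst_legs[OF mlin4_comp[OF F l]]
  note q = U.pent_variants(6)[OF legs4_leg, THEN
    arg_cong[where f = "tst (\<lambda>x y z w. l (F x y z w))"]]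
  note q = q[unfolded leg_expand_left, unfolded leg_expand_right]
  show "l ?A = l ?B"
    using q by (simp del: One_nat_def add: t klin_sum3[OF l] klin_sum2[OF l] leg_expand)
qed

lemma pentagon7:
  assumes F: "mlin4 sc sr F"
  shows "sum3 pi (\<lambda>x y z. sum3 ph (\<lambda>u v w. sum3 ph
    (\<lambda>X Y Z. sum2 (cm w) (\<lambda>w1 w2. sum2 (cm X)
    (\<lambda>X1 X2. F (u \<cdot> X1) (x \<cdot> (v \<cdot> X2)) (y \<cdot> (w1 \<cdot> Y)) (z \<cdot> (w2 \<cdot> Z))))))) =
    sum3 ph (\<lambda>x y z. sum3 ph (\<lambda>u v w. sum2 (cm y) (\<lambda>y1 y2. F (x \<cdot> u) (y1 \<cdot> v) (y2 \<cdot> w) z)))"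
    (is "?A = ?B")
proof (rule R.klin_separates)
  fix l assume l: "klin sr (*) l"
  note t = tst_legs[OF mlin4_comp[OF F l]]
  note q = U.pent_variants(7)[OF legs4_leg, THEN
    arg_cong[where f = "tst (\<lambda>x y z w. l (F x y z w))"]]
  note q = q[unfolded leg_expand_left, unfolded leg_expand_right]
  show "l ?A = l ?B"
    using q by (simp del: One_nat_def add: t klin_sum3[OF l] klin_sum2[OF l] leg_expand)
qed

lemma pentagon8:
  assumes F: "mlin4 sc sr F"
  shows "sum3 pi (\<lambda>x y z. F x y z e) =
    sum3 pi (\<lambda>x y z. sum3 pi (\<lambda>u v w. sum3 ph
      (\<lambda>X Y Z. sum3 ph (\<lambda>P Q R. sum2 (cm x)
      (\<lambda>x1 x2. sum2 (cm w) (\<lambda>w1 w2. sum2 (cm Q)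
      (\<lambda>Q1 Q2. F (x1 \<cdot> (u \<cdot> P)) (x2 \<cdot> (v \<cdot> (X \<cdot> Q1))) (y \<cdot> (w1 \<cdot> (Y \<cdot> Q2)))
      (z \<cdot> (w2 \<cdot> (Z \<cdot> R))))))))))"
    (is "?A = ?B")
proof (rule R.klin_separates)
  fix l assume l: "klin sr (*) l"
  note t = tst_legs[OF mlin4_comp[OF F l]]
  note q = U.pent_variants(8)[OF legs4_leg, THEN
    arg_cong[where f = "tst (\<lambda>x y z w. l (F x y z w))"]]
  note q = q[unfolded leg_expand_left, unfolded leg_expand_right]
  show "l ?A = l ?B"
    using q t[of _ _ _ e, unfolded leg_one U.R.mul_one_right]
      by (simp del: One_nat_def add: t klin_sum3[OF l] klin_sum2[OF l] leg_expand)
qed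

end

context qh
begin

interpretation U: qh_rep sc "(\<cdot>)" e B cm ep ph pi S T al be lop_scale
    "lop_mul :: (nat \<Rightarrow> 'a, 'k) lop \<Rightarrow> _" lop_one
  by (rule qh_rep_lop)

text \<open>The missing fourth slot of the test form is filled with the counit, which is 1 at
  \<open>e\<close>. The functional carries an operator identity back to the form
  \<open>F\<close>.\<close>

lemma legs_separate3:
  assumes F: "mlin3 sc (*) F"
  obtains L where "klin lop_scale (*) L"
    and "\<And>a b c. L (lop_mul (leg 0 a) (lop_mul (leg 1 b) (leg 2 c))) = F a b c"
proof -
  have F4: "mlin4 sc (*) (\<lambda>a b c d. F a b c * ep d)"
    by (simp add: mlin4_def klin_def mlin3D[OF F] klin_add[OF ep_klin] klin_scale[OF ep_klin]
      algebra_simps)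
  show ?thesis
    by (rule that[OF tst_klin])
      (use tst_legs[OF F4, of _ _ _ e, unfolded leg_one U.R.mul_one_right] in \<open>simp add: ep_one\<close>)
qed

lemma legs_separate2:
  assumes F: "mlin2 sc (*) F"
  obtains L where "klin lop_scale (*) L"
    and "\<And>a b. L (lop_mul (leg 0 a) (leg 1 b)) = F a b"
proof -
  have F3: "mlin3 sc (*) (\<lambda>a b c. F a b * ep c)"
    by (simp add: mlin3_def klin_def mlin2D[OF F] klin_add[OF ep_klin] klin_scale[OF ep_klin]
      algebra_simps)
  obtain L where L: "klin lop_scale (*) L"
    "\<And>a b c. L (lop_mul (leg 0 a) (lop_mul (leg 1 b) (leg 2 c))) = F a b * ep c"
    using legs_separate3[OF F3] by blast
  have "L (lop_mul (leg 0 a) (leg 1 b)) = F a b" for a b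
    using L(2)[of a b e] by (simp add: leg_one ep_one)
  then show ?thesis using that L(1) by blast
qed

text \<open>The normalisations in the outer factors, derived from the pentagon for legs, come back
  here as statements about forms.\<close>

lemma ep_sides0:
  assumes F: "mlin2 sc (*) F"
  shows "sum3 ph (\<lambda>x y z. ep x * F y z) = F e e" "sum3 ph (\<lambda>x y z. ep z * F x y) = F e e"
    "sum3 pi (\<lambda>x y z. ep x * F y z) = F e e" "sum3 pi (\<lambda>x y z. ep z * F x y) = F e e"
proof -
  obtain L where L: "klin lop_scale (*) L" "\<And>a b. L (lop_mul (leg 0 a) (leg 1 b)) = F a b"
    using legs_separate2[OF F] by blast
  have l: "U.legs2 (leg 0) (leg 1)" by (simp add: U.legs2_def leg_ahom leg_cms)
  have one: "L lop_one = F e e" using L(2)[of e e] by (simp add: leg_one)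
  note s = arg_cong[where f = L, OF U.Ph_el_left[OF l]]
    arg_cong[where f = L, OF U.Ph_el_right[OF l]]
    arg_cong[where f = L, OF U.Pi_el(1)[OF l]] arg_cong[where f = L, OF U.Pi_el(3)[OF l]]
  show "sum3 ph (\<lambda>x y z. ep x * F y z) = F e e" "sum3 ph (\<lambda>x y z. ep z * F x y) = F e e"
    "sum3 pi (\<lambda>x y z. ep x * F y z) = F e e" "sum3 pi (\<lambda>x y z. ep z * F x y) = F e e"
    using s by (simp_all del: One_nat_def add: U.Ph_def U.Pi_def klin_sum3[OF L(1)]
      klin_scale[OF L(1)]
        U.R.mul_scl_left L(2) one)
qed

end

context qh_rep
begin

lemma ep_ph_pi:
  assumes F: "mlin2 sc sr F"
  shows "sum3 ph (\<lambda>x y z. sr (ep x) (F y z)) = F e e" "sum3 ph (\<lambda>x y z. sr (ep y) (F x z)) = F e e"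
    "sum3 ph (\<lambda>x y z. sr (ep z) (F x y)) = F e e"
    "sum3 pi (\<lambda>x y z. sr (ep x) (F y z)) = F e e" "sum3 pi (\<lambda>x y z. sr (ep y) (F x z)) = F e e"
    "sum3 pi (\<lambda>x y z. sr (ep z) (F x y)) = F e e"
proof -
  note ml = mlin2_comp[OF F]
  show "sum3 ph (\<lambda>x y z. sr (ep x) (F y z)) = F e e" "sum3 ph (\<lambda>x y z. sr (ep y) (F x z)) = F e e"
    "sum3 ph (\<lambda>x y z. sr (ep z) (F x y)) = F e e"
    "sum3 pi (\<lambda>x y z. sr (ep x) (F y z)) = F e e" "sum3 pi (\<lambda>x y z. sr (ep y) (F x z)) = F e e"
    "sum3 pi (\<lambda>x y z. sr (ep z) (F x y)) = F e e"
    by (rule R.klin_separates,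
      simp add: klin_sum3 klin_scale ep_sides0[OF ml] ep_ph0[OF ml] ep_pi0[OF ml])+
qed

lemmas H_lin = mul_add_left mul_add_right mul_scl_left mul_scl_right
  klin_add[OF S_klin] klin_scale[OF S_klin] klin_add[OF T_klin] klin_scale[OF T_klin]

lemmas lin_all = R.mul_add_left R.mul_add_right R.mul_scl_left R.mul_scl_right R.scale_right_distrib
  sum2_add sum3_add R.scl_sum[symmetric] H_lin klin_add[OF cm_klin] klin_scale[OF cm_klin]
  R.scale_left_commute mlin_defs

section \<open>Absorption forms of the pentagon\<close>

text \<open>
  A multilinear map built with the antipode absorbs a coproduct in two neighbouring arguments
  (\<open>L\<close>: multiplied from the left, \<open>R\<close>: from the right).  A factor \<open>\<phi>\<close> of the pentagon with a compound leg
  there then disappears.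
\<close>

definition "absL12 F \<longleftrightarrow> (\<forall>c a b u v. sum2 (cm c) (\<lambda>c1 c2. F (c1 \<cdot> a) (c2 \<cdot> b) u v) =
  sr (ep c) (F a b u v))"
definition "absL23 F \<longleftrightarrow> (\<forall>c a b u v. sum2 (cm c) (\<lambda>c1 c2. F u (c1 \<cdot> a) (c2 \<cdot> b) v) =
  sr (ep c) (F u a b v))"
definition "absL34 F \<longleftrightarrow> (\<forall>c a b u v. sum2 (cm c) (\<lambda>c1 c2. F u v (c1 \<cdot> a) (c2 \<cdot> b)) =
  sr (ep c) (F u v a b))"
definition "absR12 F \<longleftrightarrow> (\<forall>c a b u v. sum2 (cm c) (\<lambda>c1 c2. F (a \<cdot> c1) (b \<cdot> c2) u v) =
  sr (ep c) (F a b u v))"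
definition "absR23 F \<longleftrightarrow> (\<forall>c a b u v. sum2 (cm c) (\<lambda>c1 c2. F u (a \<cdot> c1) (b \<cdot> c2) v) =
  sr (ep c) (F u a b v))"
definition "absR34 F \<longleftrightarrow> (\<forall>c a b u v. sum2 (cm c) (\<lambda>c1 c2. F u v (a \<cdot> c1) (b \<cdot> c2)) =
  sr (ep c) (F u v a b))"

lemma absD:
  shows "absL12 F \<Longrightarrow> sum2 (cm c) (\<lambda>c1 c2. F (c1 \<cdot> a) (c2 \<cdot> b) u v) = sr (ep c) (F a b u v)"
    and "absL23 F \<Longrightarrow> sum2 (cm c) (\<lambda>c1 c2. F u (c1 \<cdot> a) (c2 \<cdot> b) v) = sr (ep c) (F u a b v)"
    and "absL34 F \<Longrightarrow> sum2 (cm c) (\<lambda>c1 c2. F u v (c1 \<cdot> a) (c2 \<cdot> b)) = sr (ep c) (F u v a b)"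
    and "absR12 F \<Longrightarrow> sum2 (cm c) (\<lambda>c1 c2. F (a \<cdot> c1) (b \<cdot> c2) u v) = sr (ep c) (F a b u v)"
    and "absR23 F \<Longrightarrow> sum2 (cm c) (\<lambda>c1 c2. F u (a \<cdot> c1) (b \<cdot> c2) v) = sr (ep c) (F u a b v)"
    and "absR34 F \<Longrightarrow> sum2 (cm c) (\<lambda>c1 c2. F u v (a \<cdot> c1) (b \<cdot> c2)) = sr (ep c) (F u v a b)"
  by (simp_all add: absL12_def absL23_def absL34_def absR12_def absR23_def absR34_def)

lemma pentagon1_abs:
  assumes F: "mlin4 sc sr F" and a: "absL34 F" "absR23 F"
  shows "sum3 ph (\<lambda>x y z. sum3 pi (\<lambda>u v w. sum2 (cm x) (\<lambda>x1 x2. F (x1 \<cdot> u) (x2 \<cdot> v) (y \<cdot> w) z))) =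
    sum3 ph (\<lambda>u v w. F e u v w)"
  unfolding pentagon1[OF F]
  apply (simp only: mul_assoc[symmetric] absD(4-6)[where F = F] a)
  by (simp del: R.scale_scale add: absD(1-3)[where F = F] a ep_ph_pi mlin4D[OF F] lin_all mul_assoc)

lemma pentagon2_abs:
  assumes F: "mlin4 sc sr F" and a: "absL23 F" "absR12 F"
  shows "sum3 pi (\<lambda>x y z. sum3 ph (\<lambda>u v w. sum2 (cm w) (\<lambda>w1 w2. F u (x \<cdot> v) (y \<cdot> w1) (z \<cdot> w2)))) =
    sum3 ph (\<lambda>u v w. F u v w e)"
  unfolding pentagon2[OF F]
  apply (simp only: mul_assoc[symmetric] absD(4-6)[where F = F] a)
  by (simp del: R.scale_scale add: absD(1-3)[where F = F] a ep_ph_pi mlin4D[OF F] lin_all mul_assoc)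

lemma pentagon3_abs:
  assumes F: "mlin4 sc sr F" and a: "absR34 F"
  shows "sum3 pi (\<lambda>x y z. sum3 pi (\<lambda>u v w. sum3 pi
    (\<lambda>X Y Z. sum2 (cm v) (\<lambda>v1 v2. F (x \<cdot> u) (y \<cdot> (v1 \<cdot> X)) (z \<cdot> (v2 \<cdot> Y)) (w \<cdot> Z))))) =
    sum3 pi (\<lambda>x y z. sum2 (cm x) (\<lambda>x1 x2. F x1 x2 y z))"
  unfolding pentagon3[OF F]
  apply (simp only: mul_assoc[symmetric] absD(4-6)[where F = F] a)
  by (simp del: R.scale_scale add: absD(1-3)[where F = F] a ep_ph_pi mlin4D[OF F] lin_all mul_assoc)

lemma pentagon5_abs:
  assumes F: "mlin4 sc sr F" and a: "absR34 F"
  shows "sum3 pi (\<lambda>x y z. sum3 pi (\<lambda>u v w. sum2 (cm y) (\<lambda>y1 y2. F x (y1 \<cdot> u) (y2 \<cdot> v) (z \<cdot> w)))) =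
    sum3 ph (\<lambda>x y z. sum3 pi (\<lambda>u v w. sum2 (cm u) (\<lambda>u1 u2. F (x \<cdot> u1) (y \<cdot> u2) (z \<cdot> v) w)))"
  unfolding pentagon5[OF F]
  apply (simp only: mul_assoc[symmetric] absD(4-6)[where F = F] a)
  by (simp del: R.scale_scale add: absD(1-3)[where F = F] a ep_ph_pi mlin4D[OF F] lin_all mul_assoc)

lemma pentagon6_abs:
  assumes F: "mlin4 sc sr F" and a: "absL12 F" "absR23 F"
  shows "sum3 pi (\<lambda>x y z. sum3 ph (\<lambda>u v w. sum2 (cm z) (\<lambda>z1 z2. F x (y \<cdot> u) (z1 \<cdot> v) (z2 \<cdot> w)))) =
    sum3 pi (\<lambda>u v w. F u v w e)"
  unfolding pentagon6[OF F]
  apply (simp only: mul_assoc[symmetric] absD(4-6)[where F = F] a)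
  by (simp del: R.scale_scale add: absD(1-3)[where F = F] a ep_ph_pi mlin4D[OF F] lin_all mul_assoc)

lemma pentagon8_abs:
  assumes F: "mlin4 sc sr F" and a: "absL12 F" "absL34 F" "absR23 F"
  shows "sum3 pi (\<lambda>x y z. F x y z e) =
    sum3 ph (\<lambda>u v w. F e u v w)"
  unfolding pentagon8[OF F]
  apply (simp only: mul_assoc[symmetric] absD(4-6)[where F = F] a)
  apply (subst sum2_sum2)
  by (simp del: R.scale_scale add: absD(1-3)[where F = F] a ep_ph_pi mlin4D[OF F] lin_all mul_assoc)

section \<open>The element U\<close>

lemma S_be_abs:
  assumes "klin sc sr G"
  shows "sum2 (cm c) (\<lambda>c1 c2. G (v \<cdot> (c1 \<cdot> (be \<cdot> (S c2 \<cdot> w))))) = sr (ep c) (G (v \<cdot> (be \<cdot> w)))"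
proof -
  have "sum2 (cm c) (\<lambda>c1 c2. G (v \<cdot> (c1 \<cdot> (be \<cdot> (S c2 \<cdot> w))))) =
      G (v \<cdot> (sum2 (cm c) (\<lambda>x y. x \<cdot> be \<cdot> S y) \<cdot> w))"
    by (simp add: mul_sum klin_sum2[OF assms] mul_assoc)
  then show ?thesis by (simp add: S_be klin_scale[OF assms] mul_scl_left mul_scl_right)
qed

lemma S_al_abs:
  assumes "klin sc sr G"
  shows "sum2 (cm c) (\<lambda>c1 c2. G (v \<cdot> (S c1 \<cdot> (al \<cdot> (c2 \<cdot> w))))) = sr (ep c) (G (v \<cdot> (al \<cdot> w)))"
proof -
  have "sum2 (cm c) (\<lambda>c1 c2. G (v \<cdot> (S c1 \<cdot> (al \<cdot> (c2 \<cdot> w))))) =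
      G (v \<cdot> (sum2 (cm c) (\<lambda>x y. S x \<cdot> al \<cdot> y) \<cdot> w))"
    by (simp add: mul_sum klin_sum2[OF assms] mul_assoc)
  then show ?thesis by (simp add: S_al klin_scale[OF assms] mul_scl_left mul_scl_right)
qed

text \<open>In quasi-coassociativity for \<open>pi\<close> the iterated coproduct on one side falls
  into the two absorbing slots; what remains of it is removed by the counit law.\<close>

lemma coassoc_absR:
  assumes F: "mlin3 sc sr F"
    and a: "\<And>c x y z. sum2 (cm c) (\<lambda>c1 c2. F x (y \<cdot> c1) (z \<cdot> c2)) = sr (ep c) (F x y z)"
  shows "sum3 pi (\<lambda>x y z. sum2 (cm a) (\<lambda>a1 a2. sum2 (cm a1)
    (\<lambda>a11 a12. F (a11 \<cdot> x) (a12 \<cdot> y) (a2 \<cdot> z)))) =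
    sum3 pi (\<lambda>x y z. F (x \<cdot> a) y z)"
proof -
  have k: "klin sc sr (\<lambda>t. F (x \<cdot> t) y z)" for x y z
    by (simp add: klin_def mlin3D[OF F] mul_add_right mul_scl_right)
  show ?thesis
    using coassoc_inv[OF F, of a] by (simp add: sum2_sum3 a counit_r'[OF k])
qed

lemma coassoc_absL:
  assumes F: "mlin3 sc sr F"
    and a: "\<And>c x y z. sum2 (cm c) (\<lambda>c1 c2. F (c1 \<cdot> x) (c2 \<cdot> y) z) = sr (ep c) (F x y z)"
  shows "sum3 pi (\<lambda>x y z. sum2 (cm a) (\<lambda>a1 a2. sum2 (cm a2)
    (\<lambda>a21 a22. F (x \<cdot> a1) (y \<cdot> a21) (z \<cdot> a22)))) =
    sum3 pi (\<lambda>x y z. F x y (a \<cdot> z))"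
proof -
  have k: "klin sc sr (\<lambda>t. F x y (t \<cdot> z))" for x y z
    by (simp add: klin_def mlin3D[OF F] mul_add_left mul_scl_left)
  show ?thesis
    using coassoc_inv[OF F, of a] by (simp add: sum2_sum3 a counit_l'[OF k])
qed

definition pR :: "('a \<Rightarrow> 'r) \<Rightarrow> ('a \<Rightarrow> 'r) \<Rightarrow> 'r" where
  "pR f g = sum3 pi (\<lambda>x y z. f x \<star> g (y \<cdot> (be \<cdot> S z)))"

text \<open>
  This formula for \<open>U\<close> avoids Drinfeld's element; the two are compared in \<open>Dr_Uel\<close>.
\<close>

definition Uel :: "('a \<Rightarrow> 'r) \<Rightarrow> ('a \<Rightarrow> 'r) \<Rightarrow> 'r" where
  "Uel f g = sum3 pi (\<lambda>x y z. cop f g (S x \<cdot> (al \<cdot> y)) \<star> (pR f g \<star> g (S z)))"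

text \<open>Quasi-coassociativity for \<open>pi\<close> with its last two factors closed up by
  \<open>be\<close> and \<open>S\<close>: the coproduct entering there is absorbed, and
  \<open>a\<close> survives in the first leg.\<close>

lemma pR_twine:
  assumes l: "legs2 f g"
  shows "sum2 (cm a) (\<lambda>a1 a2. cop f g a1 \<star> (pR f g \<star> g (S a2))) = pR f g \<star> f a"
proof -
  note d = legs2D[OF l]
  define F where "F = (\<lambda>u v w. f u \<star> g (v \<cdot> (be \<cdot> S w)))"
  have F: "mlin3 sc sr F"
    by (simp add: F_def lin_all d(1,2,4)[THEN ahom_add] d(1,2,4)[THEN ahom_scale])
  have k: "klin sc sr (\<lambda>t. f x \<star> g t)" for x
    by (simp add: lin_all d(1,2,4)[THEN ahom_add] d(1,2,4)[THEN ahom_scale])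
  have a: "sum2 (cm c) (\<lambda>c1 c2. F x (y \<cdot> c1) (z \<cdot> c2)) = sr (ep c) (F x y z)" for c x y z
    using S_be_abs[OF k[of x], of c y "S z"] by (simp add: F_def mul_assoc S_mult)
  show ?thesis
    using coassoc_absR[OF F a, of a]
    by (simp add: pR_def cop_def[of f g] R.mul_sum F_def ahom_mult[OF d(1)] ahom_mult[OF d(2)]
      R.mul_assoc
        cms1[OF d(3)] cms2[OF d(3)] S_mult sum2_sum3)
qed

lemma pR_twine':
  assumes l: "legs2 f g"
  shows "sum2 (cm a) (\<lambda>a1 a2. cop f g a1 \<star> (pR f g \<star> (g (S a2) \<star> r))) = pR f g \<star> (f a \<star> r)"
  using arg_cong[where f = "\<lambda>t. t \<star> r", OF pR_twine[OF l, of a]]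
  by (simp add: R.mul_sum R.mul_assoc)

text \<open>The pentagon for \<open>pi\<close> with the last two of four factors contracted by
  \<open>be\<close>. The contraction absorbs the coproduct in these slots, and
  \<open>Pi f g h\<close> is the factor that it leaves untouched.\<close>

lemma pR_cop:
  assumes l: "legs3 f g h"
  shows "pR (cop f g) h = Pi f g h \<star> sum3 pi (\<lambda>x y z. f x \<star> (cop g h y \<star> (pR g h \<star> h (S z))))"
proof -
  note d = legs3D(9-11)[OF l] and c = legs3D(12-14)[OF l]
  define F where "F = (\<lambda>a b c d. f a \<star> (g b \<star> h (c \<cdot> (be \<cdot> S d))))"
  have F: "mlin4 sc sr F"
    by (simp add: F_def lin_all d[THEN ahom_add] d[THEN ahom_scale])
  have k: "klin sc sr (\<lambda>t. f x \<star> (g y \<star> h t))" for x y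
    by (simp add: lin_all d[THEN ahom_add] d[THEN ahom_scale])
  have a: "absR34 F"
    using S_be_abs[OF k] by (simp add: absR34_def F_def mul_assoc S_mult)
  show ?thesis
    unfolding pR_def cop_def Pi_def R.mul_assoc R.mul_sum_left
    unfolding R.mul_sum_right sum2_sum3
    using pentagon3_abs[OF F a]
    by (simp add: F_def d[THEN ahom_mult] R.mul_assoc c[THEN cms1] c[THEN cms2] S_mult)
qed

text \<open>Here \<open>S y \<cdot> (al \<cdot> z)\<close> is S of the second factor of q_R, so p_R
  and q_R cancel in the twisted sense. The contractions by \<open>be\<close> and \<open>al\<close>
  absorb all of the pentagon except one \<open>ph\<close>, which \<open>S_ph\<close>
  evaluates.\<close>

lemma pR_collapse:
  assumes l: "legs2 f g"
  shows "sum3 ph (\<lambda>x y z. cop f g x \<star> (pR f g \<star> g (S y \<cdot> (al \<cdot> z)))) = o1"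
proof -
  note d = legs2D[OF l]
  define F where "F = (\<lambda>a b c d. f a \<star> g (b \<cdot> (be \<cdot> (S c \<cdot> (al \<cdot> d)))))"
  have F: "mlin4 sc sr F"
    by (simp add: F_def lin_all d(1,2,4)[THEN ahom_add] d(1,2,4)[THEN ahom_scale])
  have k: "klin sc sr (\<lambda>t. f x \<star> g t)" for x
    by (simp add: lin_all d(1,2,4)[THEN ahom_add] d(1,2,4)[THEN ahom_scale])
  have a: "absL34 F" "absR23 F"
    using S_be_abs[OF k] S_al_abs[OF k, where v = "_ \<cdot> (_ \<cdot> _)"]
    by (simp_all add: absR23_def absL34_def F_def mul_assoc S_mult)
  have "sum3 ph (\<lambda>u v w. F e u v w) = g (sum3 ph (\<lambda>x y z. x \<cdot> be \<cdot> S y \<cdot> al \<cdot> z))"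
    by (simp add: F_def ahom_one[OF d(1)] klin_sum3[OF ahom_klin[OF d(2)]] mul_assoc)
  then have "sum3 ph (\<lambda>u v w. F e u v w) = o1"
    by (simp add: S_ph ahom_one[OF d(2)])
  then show ?thesis
    using pentagon1_abs[OF F a]
    by (simp add: pR_def cop_def R.mul_sum F_def d(1,2)[THEN ahom_mult] R.mul_assoc
        cms1[OF d(3)] cms2[OF d(3)] sum2_sum3 S_mult)
qed

text \<open>Quasi-coassociativity contracted by \<open>al\<close> moves \<open>a\<close> to the last
  factor, while \<open>pR_twine\<close> accounts for the coproduct left there. For the dual of H
  this becomes compatibility of the coaction with the right action.\<close>

lemma Uel_twine:
  assumes l: "legs2 f g"
  shows "sum2 (cm a) (\<lambda>a1 a2. cop f g (S a1) \<star> (Uel f g \<star> f a2)) = Uel f g \<star> g (S a)"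
proof -
  note d = legs2D[OF l]
  define F where "F = (\<lambda>u v w. cop f g (S u \<cdot> (al \<cdot> v)) \<star> (pR f g \<star> g (S w)))"
  have F: "mlin3 sc sr F"
    by (simp add: F_def lin_all d(1,2,4)[THEN ahom_add] d(1,2,4)[THEN ahom_scale])
  have k: "klin sc sr (\<lambda>t. cop f g t \<star> (pR f g \<star> g (S w)))" for w
    by (simp add: lin_all d(1,2,4)[THEN ahom_add] d(1,2,4)[THEN ahom_scale])
  have a: "sum2 (cm c) (\<lambda>c1 c2. F (c1 \<cdot> x) (c2 \<cdot> y) z) = sr (ep c) (F x y z)" for c x y z
    using S_al_abs[OF k[of z], of c "S x" y] by (simp add: F_def mul_assoc S_mult)
  have "sum2 (cm b) (\<lambda>b1 b2. F (x \<cdot> a1) (y \<cdot> b1) (z \<cdot> b2)) =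
      cop f g (S a1) \<star> (cop f g (S x \<cdot> (al \<cdot> y)) \<star> (pR f g \<star> (g (S z) \<star> f b)))" for x y z a1 b
    using arg_cong[where f = "\<lambda>t. cop f g (S a1) \<star> (cop f g (S x \<cdot> (al \<cdot> y)) \<star> t)",
        OF pR_twine'[OF l, of b "g (S z)"]]
    by (simp add: F_def S_mult d(2,4)[THEN ahom_mult] R.mul_sum R.mul_assoc cms1[OF d(3)])
  with coassoc_absL[OF F a, of a] show ?thesis
    by (simp add: Uel_def F_def S_mult d(2)[THEN ahom_mult] R.mul_sum R.mul_assoc sum2_sum3)
qed

text \<open>A partial inverse to the construction of U: the contractions by \<open>be\<close> and
  \<open>al\<close> absorb the other factors of the pentagon, and the remaining \<open>ph\<close> is
  evaluated by \<open>S_ph\<close>. It allows p_R to be replaced by U under a balanced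
  expression.\<close>

lemma Uel_to_pR:
  assumes l: "legs2 f g"
  shows "sum3 ph (\<lambda>x y z. cop f g (x \<cdot> (be \<cdot> S y)) \<star> (Uel f g \<star> f z)) = pR f g"
proof -
  note d = legs2D[OF l]
  define F where "F = (\<lambda>a b c d. cop f g (a \<cdot> (be \<cdot> (S b \<cdot> (al \<cdot> c)))) \<star> (pR f g \<star> g (S d)))"
  have F: "mlin4 sc sr F"
    by (simp add: F_def lin_all d(1,2,4)[THEN ahom_add] d(1,2,4)[THEN ahom_scale])
  have k: "klin sc sr (\<lambda>t. cop f g t \<star> (pR f g \<star> g (S w)))" for w
    by (simp add: lin_all d(1,2,4)[THEN ahom_add] d(1,2,4)[THEN ahom_scale])
  have a: "absL23 F" "absR12 F"
    using S_be_abs[OF k] S_al_abs[OF k, where v = "_ \<cdot> (_ \<cdot> _)"]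
    by (simp_all add: absR12_def absL23_def F_def mul_assoc S_mult)
  have "sum3 ph (\<lambda>u v w. F u v w e) = cop f g (sum3 ph (\<lambda>x y z. x \<cdot> be \<cdot> S y \<cdot> al \<cdot> z)) \<star> pR f g"
    by (simp add: F_def ahom_one[OF d(2)] S_one klin_sum3[OF ahom_klin[OF d(4)]] R.mul_sum
      mul_assoc)
  then have *: "sum3 ph (\<lambda>u v w. F u v w e) = pR f g"
    by (simp add: S_ph ahom_one[OF d(4)])
  have "sum2 (cm w) (\<lambda>w1 w2. F u (x \<cdot> v) (y \<cdot> w1) (z \<cdot> w2)) =
      cop f g (u \<cdot> (be \<cdot> (S v \<cdot> (S x \<cdot> (al \<cdot> y))))) \<star> (pR f g \<star> (g (S z) \<star> f w))" for u v w x y z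
    using arg_cong[where f = "\<lambda>t. cop f g (u \<cdot> (be \<cdot> (S v \<cdot> (S x \<cdot> (al \<cdot> y))))) \<star> t",
        OF pR_twine'[OF l, of w "g (S z)"]]
    by (simp add: F_def S_mult d(2,4)[THEN ahom_mult] R.mul_sum R.mul_assoc cms1[OF d(3)])
  with pentagon2_abs[OF F a] * show ?thesis
    by (simp add: Uel_def R.mul_sum R.mul_assoc d(4)[THEN ahom_mult] sum3_sum3[of ph pi])
qed

text \<open>The counit leg reduces p_R to \<open>be\<close>, after which the sum is exactly
  \<open>S_pi\<close>.\<close>

lemma Uel_counit:
  assumes "ahom g" shows "Uel el g = o1"
proof -
  have k: "klin sc sr (\<lambda>t. g (t \<cdot> (be \<cdot> S z)))" for z
    by (simp add: lin_all assms[THEN ahom_add] assms[THEN ahom_scale])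
  have m: "mlin2 sc sr (\<lambda>y z. g (y \<cdot> (be \<cdot> S z)))"
    by (simp add: lin_all assms[THEN ahom_add] assms[THEN ahom_scale])
  have p: "pR el g = g be"
    by (simp add: pR_def ep_ph_pi[OF m] S_one)
  have "Uel el g = g (sum3 pi (\<lambda>x y z. S x \<cdot> al \<cdot> y \<cdot> be \<cdot> S z))"
    unfolding Uel_def p by (simp add: cop_el_left[OF assms] klin_sum3[OF ahom_klin[OF assms]]
        assms[THEN ahom_mult] R.mul_assoc)
  then show ?thesis by (simp add: S_pi ahom_one[OF assms])
qed

lemma Uel_twine':
  assumes l: "legs2 f g"
  shows "sum2 (cm a) (\<lambda>a1 a2. cop f g (S a1) \<star> (Uel f g \<star> (f a2 \<star> r))) = Uel f g \<star> (g (S a) \<star> r)"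
  using arg_cong[where f = "\<lambda>t. t \<star> r", OF Uel_twine[OF l, of a]]
  by (simp add: R.mul_sum R.mul_assoc)

lemma Pi_coassoc':
  assumes "legs3 f g h"
  shows "Pi f g h \<star> (cop f (cop g h) a \<star> r) = cop (cop f g) h a \<star> (Pi f g h \<star> r)"
  using arg_cong[where f = "\<lambda>t. t \<star> r", OF Pi_coassoc[OF assms, of a]] by (simp add: R.mul_assoc)

text \<open>
  Both sides of \<open>Uel_comult\<close> become sums of values of \<open>Nb\<close>, whose balancedness (\<open>Nb_balanced\<close>)
  allows to exchange \<open>p\<^sub>R\<close> for \<open>U\<close>.
\<close>

definition Nb where
  "Nb f g h a z = sum3 ph (\<lambda>X Y Z. sum2 (cm a) (\<lambda>a1 a2.
     cop (cop f g) h (S (X \<cdot> a1) \<cdot> al) \<star> (Pi f g h \<star> (f (Y \<cdot> a2) \<star> (cop g h Z \<star> z)))))"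

context
  fixes f g h
  assumes l: "legs3 f g h"
begin

lemmas aL = legs3D(9-11)[OF l]
lemmas cL = legs3D(12-14)[OF l]

lemma aL2: "ahom (cop g h)" "ahom (cop f g)" "ahom (cop f (cop g h))" "ahom (cop (cop f g) h)"
  "cms f (cop g h)" "cms (cop f g) h"
  using legs3D[OF l] by (auto simp: legs2_def intro: leg_intros)

lemmas aLl = aL[THEN ahom_add] aL[THEN ahom_scale] aL2(1-4)[THEN ahom_add] aL2(1-4)[THEN ahom_scale]

text \<open>Quasi-coassociativity carries the coproduct of \<open>c\<close> from the right of
  \<open>ph\<close> to its left, and \<open>Pi_coassoc\<close> then brings the outer half next to
  \<open>al\<close>, where the antipode absorbs it.\<close>

lemma Nb_balanced:
  "sum2 (cm c) (\<lambda>c1 c2. Nb f g h (c1 \<cdot> a) (cop g h c2 \<star> z)) = sr (ep c) (Nb f g h a z)"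
proof -
  let ?D = "cop (cop f g) h" and ?E = "cop g h"
  define F where "F = (\<lambda>x y w. sum2 (cm a) (\<lambda>a1 a2.
     ?D (S (x \<cdot> a1) \<cdot> al) \<star> (Pi f g h \<star> (f (y \<cdot> a2) \<star> (?E w \<star> z)))))"
  have F: "mlin3 sc sr F"
    by (simp add: F_def lin_all aLl)
  have ml: "mlin2 sc sr (\<lambda>a1 a2. ?D (S (X \<cdot> a1) \<cdot> al) \<star> (Pi f g h \<star> (f (Y \<cdot> a2) \<star> (?E Z \<star> z))))"
    for X Y Z z
    by (simp add: lin_all aLl)
  have "sum2 (cm c) (\<lambda>c1 c2. Nb f g h (c1 \<cdot> a) (?E c2 \<star> z)) =
      sum2 (cm c) (\<lambda>c1 c2. sum2 (cm c1) (\<lambda>c11 c12. sum3 ph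
        (\<lambda>X Y Z. F (X \<cdot> c11) (Y \<cdot> c12) (Z \<cdot> c2))))"
    by (simp add: Nb_def cm_mult[OF ml] F_def mul_assoc aL2(1)[THEN ahom_mult] R.mul_assoc
      sum2_sum3)
  also have "\<dots> = sum3 ph (\<lambda>X Y Z. sum2 (cm c)
    (\<lambda>c1 c2. sum2 (cm c2) (\<lambda>c21 c22. F (c1 \<cdot> X) (c21 \<cdot> Y) (c22 \<cdot> Z))))"
    using coassoc[OF F, of c] by (simp add: sum2_sum3)
  also have "\<dots> = sum3 ph (\<lambda>X Y Z. sr (ep c) (F X Y Z))"
  proof -
    have 1: "sum2 (cm c2) (\<lambda>c21 c22. F (c1 \<cdot> X) (c21 \<cdot> Y) (c22 \<cdot> Z)) =
        sum2 (cm a) (\<lambda>a1 a2. ?D (S (X \<cdot> a1) \<cdot> (S c1 \<cdot> (al \<cdot> c2))) \<star>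
          (Pi f g h \<star> (f (Y \<cdot> a2) \<star> (?E Z \<star> z))))"
      for c1 c2 X Y Z
    proof -
      have "sum2 (cm c2) (\<lambda>c21 c22. F (c1 \<cdot> X) (c21 \<cdot> Y) (c22 \<cdot> Z)) =
        sum2 (cm a) (\<lambda>a1 a2. ?D (S (X \<cdot> a1) \<cdot> (S c1 \<cdot> al)) \<star>
          (Pi f g h \<star> (cop f ?E c2 \<star> (f (Y \<cdot> a2) \<star> (?E Z \<star> z)))))"
        unfolding F_def
        by (subst sum2_sum2) (simp add: cop_def[of f ?E] R.mul_sum S_mult mul_assoc
          aL(1)[THEN ahom_mult]
          aL2(1)[THEN ahom_mult] R.mul_assoc cms2[OF aL2(5)])
      then show ?thesis
        by (simp add: Pi_coassoc'[OF l] aL2(4)[THEN ahom_mult] R.mul_assoc)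
    qed
    have k: "klin sc sr (\<lambda>t. ?D t \<star> r)" for r
      by (simp add: lin_all aLl)
    have "sum2 (cm c) (\<lambda>c1 c2. sum2 (cm c2) (\<lambda>c21 c22. F (c1 \<cdot> X) (c21 \<cdot> Y) (c22 \<cdot> Z))) =
        sr (ep c) (F X Y Z)" for X Y Z
      unfolding 1 using S_al_abs[OF k, where w = e]
      by (subst sum2_sum2) (simp add: F_def R.scl_sum2)
    then show ?thesis by simp
  qed
  finally show ?thesis by (simp add: Nb_def F_def R.scl_sum3)
qed

lemma Nb_klin: "klin sc sr (\<lambda>a. Nb f g h a z)" "Nb f g h a (z + z') = Nb f g h a z + Nb f g h a z'"
    "Nb f g h a (sr c z) = sr c (Nb f g h a z)"
  by (simp_all add: Nb_def lin_all aLl)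

lemma Nb_sum: "Nb f g h a (sum3 ts G) = sum3 ts (\<lambda>x y z. Nb f g h a (G x y z))"
   "Nb f g h a (sum2 us K) = sum2 us (\<lambda>x y. Nb f g h a (K x y))"
  by (rule klin_sum3[of sr sr] klin_sum2[of sr sr], simp add: klin_def Nb_klin)+

text \<open>p_R is expanded through U by \<open>Uel_to_pR\<close>, and \<open>Uel_twine\<close>
  turns the trailing antipode into a coproduct. In the resulting pentagon, balancedness absorbs
  slots one and two and \<open>be\<close> absorbs slots two and three.\<close>

lemma Nb_transfer:
  "sum3 pi (\<lambda>u v w. Nb f g h u (cop g h v \<star> (pR g h \<star> h (S w)))) =
   sum3 pi (\<lambda>u v w. Nb f g h u (cop g h (v \<cdot> (be \<cdot> S w)) \<star> Uel g h))"
proof -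
  let ?E = "cop g h" and ?U = "Uel g h"
  note lgh = legs3D(3)[OF l]
  define F where "F = (\<lambda>a b c d. Nb f g h a (?E (b \<cdot> (be \<cdot> S c)) \<star> (?U \<star> g d)))"
  have F: "mlin4 sc sr F"
    by (simp add: F_def lin_all aLl Nb_klin klin_add[OF Nb_klin(1)] klin_scale[OF Nb_klin(1)])
  have k: "klin sc sr (\<lambda>t. Nb f g h u (?E t \<star> (?U \<star> g d)))" for u d
    by (simp add: lin_all aLl Nb_klin)
  have a: "absL12 F" "absR23 F"
    using S_be_abs[OF k] Nb_balanced
    by (simp_all add: absR23_def absL12_def F_def mul_assoc S_mult aL2(1)[THEN ahom_mult]
      R.mul_assoc)
  have 1: "sum2 (cm w) (\<lambda>w1 w2. F u (v \<cdot> X) (w1 \<cdot> Y) (w2 \<cdot> Z)) =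
      Nb f g h u (?E (v \<cdot> (X \<cdot> (be \<cdot> S Y))) \<star> (?U \<star> (g Z \<star> h (S w))))" for u v w X Y Z
    using arg_cong[where f = "\<lambda>t. Nb f g h u (?E (v \<cdot> (X \<cdot> (be \<cdot> S Y))) \<star> t)",
        OF Uel_twine'[OF lgh, of w "g Z"]]
    by (simp add: F_def S_mult mul_assoc aL2(1)[THEN ahom_mult] aL(2)[THEN ahom_mult] R.mul_sum
      R.mul_assoc Nb_sum
        cms1[OF cL(3)])
  have 2: "Nb f g h u (?E v \<star> (pR g h \<star> h (S w))) =
      sum3 ph (\<lambda>X Y Z. Nb f g h u (?E (v \<cdot> (X \<cdot> (be \<cdot> S Y))) \<star> (?U \<star> (g Z \<star> h (S w)))))" for u v w
    using arg_cong[where f = "\<lambda>t. Nb f g h u (?E v \<star> (t \<star> h (S w)))", OF Uel_to_pR[OF lgh]]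
    by (simp add: R.mul_sum Nb_sum R.mul_assoc aL2(1)[THEN ahom_mult])
  show ?thesis
    using pentagon6_abs[OF F a]
    by (simp add: 1 2) (simp add: F_def S_one ahom_one[OF aL(2)])
qed

text \<open>This is the U-half of the coassociativity of the coaction. The pentagon brings the two
  sides to \<open>Nb\<close>-sums that differ only in carrying U or p_R.\<close>

lemma Uel_comult:
  "Pi f g h \<star> (Uel f (cop g h) \<star> Uel g h) =
   sum3 ph (\<lambda>X Y Z. cop (cop f g) h (S X) \<star> (Uel (cop f g) h \<star> (f Y \<star> g Z)))"
proof -
  let ?D = "cop (cop f g) h" and ?E = "cop g h" and ?U = "Uel g h" and ?D' = "cop f (cop g h)"
  \<comment> \<open>\<open>K\<close> is the summand containing U and \<open>K'\<close> its
    counterpart containing p_R, the two sides of \<open>Nb_transfer\<close> before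
    summation.\<close>
  define K where "K = (\<lambda>a b c d. ?D (S a \<cdot> al) \<star> (Pi f g h \<star> (f b \<star> (?E (c \<cdot> (be \<cdot> S d)) \<star> ?U))))"
  define K' where "K' = (\<lambda>a b c d. ?D (S a \<cdot> al) \<star>
    (Pi f g h \<star> (f b \<star> (?E c \<star> (pR g h \<star> h (S d))))))"
  have mK: "mlin4 sc sr K" and mK': "mlin4 sc sr K'"
    by (simp_all add: K_def K'_def lin_all aLl)
  have k: "klin sc sr (\<lambda>t. ?D (S a \<cdot> al) \<star> (Pi f g h \<star> (f b \<star> (?E t \<star> ?U))))" for a b
    by (simp add: lin_all aLl)
  have aK: "absR34 K"
    using S_be_abs[OF k] by (simp add: absR34_def K_def mul_assoc S_mult)
  have c: "cms f ?E" "cms f h" "cms g h" by (fact aL2 cL)+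
  have 1: "sum2 (cm y) (\<lambda>y1 y2. K x (y1 \<cdot> u) (y2 \<cdot> v) (z \<cdot> w)) =
      Pi f g h \<star> (?D' (S x \<cdot> (al \<cdot> y)) \<star>
        (f u \<star> (?E (v \<cdot> (be \<cdot> S w)) \<star> (?E (S z) \<star> ?U))))" for x y z u v w
  proof -
    have "sum2 (cm y) (\<lambda>y1 y2. K x (y1 \<cdot> u) (y2 \<cdot> v) (z \<cdot> w)) =
      ?D (S x \<cdot> al) \<star> (Pi f g h \<star> (?D' y \<star> (f u \<star> (?E (v \<cdot> (be \<cdot> S w)) \<star> (?E (S z) \<star> ?U)))))"
      by (simp add: K_def cop_def[of f ?E] R.mul_sum aL(1)[THEN ahom_mult] aL2(1)[THEN ahom_mult]
          R.mul_assoc S_mult mul_assoc cms2[OF c(1)])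
    then show ?thesis
      by (simp add: Pi_coassoc'[OF l] aL2(4)[THEN ahom_mult] mul_assoc R.mul_assoc)
  qed
  have L: "Pi f g h \<star> (Uel f ?E \<star> ?U) =
      sum3 pi (\<lambda>x y z. sum3 pi (\<lambda>u v w. sum2 (cm y) (\<lambda>y1 y2. K x (y1 \<cdot> u) (y2 \<cdot> v) (z \<cdot> w))))"
    unfolding 1 by (simp add: Uel_def[of f ?E] pR_def[of f ?E] R.mul_sum R.mul_assoc)
  have 2: "sum2 (cm y) (\<lambda>y1 y2. sum2 (cm Z)
    (\<lambda>Z1 Z2. K' (x \<cdot> X) (y1 \<cdot> (u \<cdot> Y)) (y2 \<cdot> (v \<cdot> Z1)) (z \<cdot> (w \<cdot> Z2)))) =
      ?D (S X) \<star> (?D (S x \<cdot> (al \<cdot> y)) \<star> (Pi f g h \<star>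
        (f u \<star> (?E v \<star> (pR g h \<star> (h (S w) \<star> (h (S z) \<star> (f Y \<star> g Z)))))))) "
    for x y z u v w X Y Z
  proof -
    have "cms f (\<lambda>_. pR g h)"
      by (simp add: cms_def pR_def R.mul_sum R.mul_assoc cms2[OF cL(1)] cms1[OF cL(1)]
        cms1[OF cL(2)] cms2[OF cL(2)])
    then have cp: "pR g h \<star> (f b \<star> r) = f b \<star> (pR g h \<star> r)" for b r
      by (rule cms2)
    have "?D (S X) \<star> (?D (S x \<cdot> (al \<cdot> y)) \<star>
      (Pi f g h \<star> (f u \<star> (?E v \<star> (pR g h \<star> (h (S w) \<star> (h (S z) \<star> (f Y \<star> g Z)))))))) =
       ?D (S (x \<cdot> X) \<cdot> al) \<star> (Pi f g h \<star>
         (?D' y \<star> (f u \<star> (?E v \<star> (pR g h \<star> (g Z \<star> (h (S (z \<cdot> w)) \<star> f Y)))))))"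
      by (simp add: Pi_coassoc'[OF l] S_mult aL(3)[THEN ahom_mult] aL2(4)[THEN ahom_mult]
        R.mul_assoc mul_assoc
          cms1[OF c(2)] cms2[OF c(2)] cms1[OF cL(1)] cms2[OF cL(1)] cms1[OF cL(3)] cms2[OF cL(3)])
    \<comment> \<open>Reading \<open>pR_twine\<close> backwards trades the factor \<open>g Z\<close>
      for a coproduct of \<open>Z\<close>, which is the shape demanded by the fourth
      pentagon.\<close>
    also have "\<dots> = sum2 (cm Z) (\<lambda>Z1 Z2. ?D (S (x \<cdot> X) \<cdot> al) \<star>
      (Pi f g h \<star> (?D' y \<star> (f u \<star> (?E v \<star>
      (?E Z1 \<star> (pR g h \<star> (h (S Z2) \<star> (h (S (z \<cdot> w)) \<star> f Y)))))))))"
      by (simp add: pR_twine'[OF legs3D(3)[OF l], symmetric] R.mul_sum)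
    also have "\<dots> = sum2 (cm Z) (\<lambda>Z1 Z2. sum2 (cm y)
      (\<lambda>y1 y2. K' (x \<cdot> X) (y1 \<cdot> (u \<cdot> Y)) (y2 \<cdot> (v \<cdot> Z1)) (z \<cdot> (w \<cdot> Z2))))"
      by (simp add: K'_def cop_def[of f ?E] R.mul_sum S_mult aL(1,3)[THEN ahom_mult]
        aL2(1)[THEN ahom_mult]
          R.mul_assoc mul_assoc cp cms1[OF c(2)] cms2[OF c(2)] cms1[OF c(1)] cms2[OF c(1)])
    finally show ?thesis by (subst sum2_sum2) simp
  qed
  have Rr: "sum3 ph (\<lambda>X Y Z. ?D (S X) \<star> (Uel (cop f g) h \<star> (f Y \<star> g Z))) =
      sum3 pi (\<lambda>x y z. sum3 pi (\<lambda>u v w. sum3 ph (\<lambda>X Y Z. sum2 (cm y) (\<lambda>y1 y2. sum2 (cm Z) (\<lambda>Z1 Z2.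
        K' (x \<cdot> X) (y1 \<cdot> (u \<cdot> Y)) (y2 \<cdot> (v \<cdot> Z1)) (z \<cdot> (w \<cdot> Z2)))))))"
    unfolding 2 by (simp add: Uel_def[of "cop f g" h] pR_cop[OF l] R.mul_sum R.mul_assoc
      sum3_sum3[of ph pi])
  have N1: "sum3 ph (\<lambda>x y z. sum3 pi (\<lambda>u v w. sum2 (cm u)
    (\<lambda>u1 u2. K (x \<cdot> u1) (y \<cdot> u2) (z \<cdot> v) w))) =
      sum3 pi (\<lambda>u v w. Nb f g h u (?E (v \<cdot> (be \<cdot> S w)) \<star> ?U))"
    by (simp add: Nb_def K_def sum3_sum3[of ph pi] aL2(1)[THEN ahom_mult] R.mul_assoc mul_assoc)
  have N2: "sum3 ph (\<lambda>x y z. sum3 pi (\<lambda>u v w. sum2 (cm u)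
    (\<lambda>u1 u2. K' (x \<cdot> u1) (y \<cdot> u2) (z \<cdot> v) w))) =
      sum3 pi (\<lambda>u v w. Nb f g h u (?E v \<star> (pR g h \<star> h (S w))))"
    by (simp add: Nb_def K'_def sum3_sum3[of ph pi] aL2(1)[THEN ahom_mult] R.mul_assoc mul_assoc)
  show ?thesis
    unfolding L Rr pentagon5_abs[OF mK aK] pentagon4[OF mK'] N1 N2 by (rule Nb_transfer[symmetric])
qed

end

lemma pentagon7_abs:
  assumes F: "mlin4 sc sr F" and a: "absL23 F"
  shows "sum3 pi (\<lambda>x y z. sum3 ph (\<lambda>u v w. sum3 ph
    (\<lambda>X Y Z. sum2 (cm w) (\<lambda>w1 w2. sum2 (cm X) (\<lambda>X1 X2.
      F (u \<cdot> X1) (x \<cdot> (v \<cdot> X2)) (y \<cdot> (w1 \<cdot> Y)) (z \<cdot> (w2 \<cdot> Z))))))) =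
    sum3 ph (\<lambda>u v w. F u v w e)"
  unfolding pentagon7[OF F]
  by (simp del: R.scale_scale add: absD(2)[where F = F] a ep_ph_pi mlin4D[OF F] lin_all mul_assoc)

section \<open>Drinfeld's element\<close>

text \<open>
  Evaluations of \<open>(S \<otimes> S) \<circ> \<Delta>\<^sup>o\<^sup>p\<close>, \<open>\<gamma>\<close>, $f$ and \<open>(S \<otimes> S)(q\<^sub>R\<^sup>2\<^sup>1)\<close>.
\<close>

definition sD :: "('a \<Rightarrow> 'r) \<Rightarrow> ('a \<Rightarrow> 'r) \<Rightarrow> 'a \<Rightarrow> 'r" where
  "sD f g a = sum2 (cm a) (\<lambda>x y. f (S y) \<star> g (S x))"

definition gam :: "('a \<Rightarrow> 'r) \<Rightarrow> ('a \<Rightarrow> 'r) \<Rightarrow> 'r" where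
  "gam f g = sum3 pi (\<lambda>x y z. sum3 ph (\<lambda>u v w. sum2 (cm w) (\<lambda>w1 w2.
     f (S (x \<cdot> v) \<cdot> (al \<cdot> (y \<cdot> w1))) \<star> g (S u \<cdot> (al \<cdot> (z \<cdot> w2))))))"

definition Dr :: "('a \<Rightarrow> 'r) \<Rightarrow> ('a \<Rightarrow> 'r) \<Rightarrow> 'r" where
  "Dr f g = sum3 pi (\<lambda>x y z. sD f g x \<star> (gam f g \<star> cop f g (y \<cdot> (be \<cdot> S z))))"

definition sq :: "('a \<Rightarrow> 'r) \<Rightarrow> ('a \<Rightarrow> 'r) \<Rightarrow> 'r" where
  "sq f g = sum3 ph (\<lambda>x y z. f (S y \<cdot> (al \<cdot> z)) \<star> g (S x))"

context
  fixes f g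
  assumes l: "legs2 f g"
begin

lemmas a2 = legs2D(1,2,4)[OF l]
lemmas c2 = legs2D(3)[OF l]
lemmas a2l = a2[THEN ahom_add] a2[THEN ahom_scale]

lemma sD_klin: "klin sc sr (sD f g)"
proof -
  have "mlin2 sc sr (\<lambda>x y. f (S y) \<star> g (S x))" by (simp add: lin_all a2l)
  from cm_klin[OF this] show ?thesis by (simp add: sD_def[abs_def])
qed

lemma sD_mult: "sD f g (a \<cdot> b) = sD f g b \<star> sD f g a"
proof -
  have ml: "mlin2 sc sr (\<lambda>x y. f (S y) \<star> g (S x))" by (simp add: lin_all a2l)
  show ?thesis
    unfolding sD_def cm_mult[OF ml]
    by (simp add: R.mul_sum S_mult a2(1,2)[THEN ahom_mult] R.mul_assoc cms1[OF c2] cms2[OF c2])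
qed

lemma sD_one: "sD f g e = o1"
proof -
  have ml: "mlin2 sc sr (\<lambda>x y. f (S y) \<star> g (S x))" by (simp add: lin_all a2l)
  show ?thesis unfolding sD_def cm_one[OF ml]
    by (simp add: S_one ahom_one[OF a2(1)] ahom_one[OF a2(2)])
qed

lemmas a2ls = a2l klin_add[OF sD_klin] klin_scale[OF sD_klin]

text \<open>Quasi-coassociativity is used for both reassociators in \<gamma>. Each time a coproduct
  ends up around an \<open>al\<close>: once in the first leg, once in the second.\<close>

lemma gam_balanced:
  "sum2 (cm c) (\<lambda>c1 c2. sD f g c1 \<star> (gam f g \<star> cop f g c2)) = sr (ep c) (gam f g)"
proof -
  define G where "G = (\<lambda>a b c d. f (S b \<cdot> (al \<cdot> c)) \<star> g (S a \<cdot> (al \<cdot> d)))"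
  have mG: "mlin4 sc sr G" by (simp add: G_def lin_all a2l)
  define F where "F = (\<lambda>u v w. sum3 pi (\<lambda>x y z. sum2 (cm w)
    (\<lambda>w1 w2. G u (x \<cdot> v) (y \<cdot> w1) (z \<cdot> w2))))"
  have ml: "mlin2 sc sr (\<lambda>w1 w2. G u (x \<cdot> v) (y \<cdot> w1) (z \<cdot> w2))" for u v x y z
    by (simp add: lin_all mlin4D[OF mG])
  have mF: "mlin3 sc sr F" by (simp add: F_def lin_all mlin4D[OF mG])
  have gam: "gam f g = sum3 ph F"
    by (simp add: gam_def F_def[abs_def] G_def) (rule sum3_sum3)
  have "sum2 (cm c) (\<lambda>c1 c2. sD f g c1 \<star> (gam f g \<star> cop f g c2)) =
      sum2 (cm c) (\<lambda>c1 c2. sum2 (cm c1) (\<lambda>c11 c12. sum3 ph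
        (\<lambda>u v w. F (u \<cdot> c11) (v \<cdot> c12) (w \<cdot> c2))))"
  proof -
    have "sD f g c1 \<star> (gam f g \<star> cop f g c2) =
      sum2 (cm c1) (\<lambda>c11 c12. sum3 ph (\<lambda>u v w. F (u \<cdot> c11) (v \<cdot> c12) (w \<cdot> c2)))" for c1 c2
      unfolding gam sD_def cop_def F_def cm_mult[OF ml] R.mul_sum_left
      unfolding R.mul_sum_right
      by (simp add: G_def S_mult a2(1,2)[THEN ahom_mult] R.mul_assoc cms1[OF c2] cms2[OF c2]
        mul_assoc)
    then show ?thesis by simp
  qed
  also have "\<dots> = sum3 ph (\<lambda>u v w. sum2 (cm c)
    (\<lambda>c1 c2. sum2 (cm c2) (\<lambda>c21 c22. F (c1 \<cdot> u) (c21 \<cdot> v) (c22 \<cdot> w))))"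
    using coassoc[OF mF, of c] by (simp add: sum2_sum3)
  also have "\<dots> = sum3 ph (\<lambda>u v w. sr (ep c) (F u v w))"
  proof -
    have kf: "klin sc sr (\<lambda>t. f t \<star> r)" and kg: "klin sc sr (\<lambda>t. r \<star> g t)" for r
      by (simp_all add: lin_all a2l)
    have ab: "sum2 (cm c) (\<lambda>c1 c2. G a (c1 \<cdot> x \<cdot> v) (c2 \<cdot> y \<cdot> w) d) =
      sr (ep c) (G a (x \<cdot> v) (y \<cdot> w) d)"
      for a c x v y w d
      using S_al_abs[OF kf, where v = "S v \<cdot> S x" and w = "y \<cdot> w"]
        by (simp add: G_def S_mult mul_assoc)
    have ab': "sum2 (cm c) (\<lambda>c1 c2. G (c1 \<cdot> a) x y (c2 \<cdot> b)) = sr (ep c) (G a x y b)" for a b c x y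
      using S_al_abs[OF kg] by (simp add: G_def S_mult mul_assoc)
    have 1: "sum2 (cm c2) (\<lambda>c21 c22. F a (c21 \<cdot> v) (c22 \<cdot> w)) =
        sum3 pi (\<lambda>x y z. sum2 (cm w) (\<lambda>w1 w2. G a (x \<cdot> v) (y \<cdot> w1) (c2 \<cdot> (z \<cdot> w2))))" for a c2 v w
    proof -
      have mH: "mlin3 sc sr (\<lambda>x y z. sum2 (cm w) (\<lambda>w1 w2. G a (x \<cdot> v) (y \<cdot> w1) (z \<cdot> w2)))"
        by (simp add: lin_all mlin4D[OF mG])
      have aH: "sum2 (cm c) (\<lambda>c1 c2. sum2 (cm w)
        (\<lambda>w1 w2. G a (c1 \<cdot> x \<cdot> v) (c2 \<cdot> y \<cdot> w1) (z \<cdot> w2))) =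
          sr (ep c) (sum2 (cm w) (\<lambda>w1 w2. G a (x \<cdot> v) (y \<cdot> w1) (z \<cdot> w2)))" for c x y z
        by (subst sum2_sum2) (simp add: ab R.scl_sum2)
      show ?thesis
        using coassoc_absL[OF mH aH, of c2]
        by (simp add: F_def cm_mult[OF ml] sum2_sum3 mul_assoc)
    qed
    have "sum2 (cm c) (\<lambda>c1 c2. sum2 (cm c2) (\<lambda>c21 c22. F (c1 \<cdot> u) (c21 \<cdot> v) (c22 \<cdot> w))) =
        sr (ep c) (F u v w)" for u v w
      unfolding 1 sum2_sum3
      by (subst sum2_sum2) (simp add: ab' F_def R.scl_sum2 R.scl_sum3)
    then show ?thesis by simp
  qed
  finally show ?thesis by (simp add: gam R.scl_sum3)
qed

lemma gam_balanced':
  "sum2 (cm c) (\<lambda>c1 c2. sD f g c1 \<star> (gam f g \<star> (cop f g c2 \<star> r))) = sr (ep c) (gam f g \<star> r)"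
  using arg_cong[where f = "\<lambda>t. t \<star> r", OF gam_balanced[of c]]
  by (simp add: R.mul_sum R.mul_assoc R.mul_scl_left)

text \<open>The summand of f absorbs coproducts on both sides, by the balancedness of \<gamma> on
  the left and by \<open>be\<close> on the right. Quasi-coassociativity then carries
  \<open>a\<close> from the last factor to the first.\<close>

lemma Dr_twine: "Dr f g \<star> cop f g (S a) = sD f g a \<star> Dr f g"
proof -
  define F where "F = (\<lambda>u v w. sD f g u \<star> (gam f g \<star> cop f g (v \<cdot> (be \<cdot> S w))))"
  have F: "mlin3 sc sr F" by (simp add: F_def lin_all a2ls)
  have k: "klin sc sr (\<lambda>t. sD f g x \<star> (gam f g \<star> cop f g t))" for x by (simp add: lin_all a2ls)
  have aL: "sum2 (cm c) (\<lambda>c1 c2. F (c1 \<cdot> x) (c2 \<cdot> y) z) = sr (ep c) (F x y z)" for c x y z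
    using arg_cong[where f = "\<lambda>t. sD f g x \<star> t", OF gam_balanced'[of c "cop f g (y \<cdot> (be \<cdot> S z))"]]
    by (simp add: F_def sD_mult a2(3)[THEN ahom_mult] R.mul_assoc R.mul_sum R.mul_scl_right)
  have aR: "sum2 (cm c) (\<lambda>c1 c2. F x (y \<cdot> c1) (z \<cdot> c2)) = sr (ep c) (F x y z)" for c x y z
    using S_be_abs[OF k[of x], of c y "S z"] by (simp add: F_def mul_assoc S_mult)
  have kk: "klin sc sr (\<lambda>t. F (x \<cdot> t) y z)" for x y z
    by (simp add: lin_all mlin3D[OF F])
  have "Dr f g \<star> cop f g (S a) = sum3 pi (\<lambda>x y z. F x y (a \<cdot> z))"
    by (simp add: Dr_def F_def R.mul_sum R.mul_assoc S_mult a2(3)[THEN ahom_mult])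
  also have "\<dots> = sum3 pi (\<lambda>x y z. F (x \<cdot> a) y z)"
    using coassoc_absL[OF F aL, of a] by (simp add: aR counit_r'[OF kk])
  also have "\<dots> = sD f g a \<star> Dr f g"
    by (simp add: Dr_def F_def R.mul_sum R.mul_assoc sD_mult)
  finally show ?thesis .
qed

lemma Dr_twine': "Dr f g \<star> (cop f g (S a) \<star> r) = sD f g a \<star> (Dr f g \<star> r)"
  using arg_cong[where f = "\<lambda>t. t \<star> r", OF Dr_twine[of a]] by (simp add: R.mul_assoc)

text \<open>Inserting \<open>al\<close> closes the last contraction, so that three factors of the
  pentagon are absorbed. It trades the \<open>pi\<close> in f for a single \<open>ph\<close>, which
  \<open>S_ph\<close> evaluates.\<close>

lemma Dr_alpha: "Dr f g \<star> cop f g al = gam f g"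
proof -
  define F where "F = (\<lambda>a b c d. sD f g a \<star> (gam f g \<star> cop f g (b \<cdot> (be \<cdot> (S c \<cdot> (al \<cdot> d))))))"
  have F: "mlin4 sc sr F" by (simp add: F_def lin_all a2ls)
  have k: "klin sc sr (\<lambda>t. sD f g x \<star> (gam f g \<star> cop f g t))" for x by (simp add: lin_all a2ls)
  have 1: "absL12 F"
    unfolding absL12_def
  proof safe
    fix c x y u v
    show "sum2 (cm c) (\<lambda>c1 c2. F (c1 \<cdot> x) (c2 \<cdot> y) u v) = sr (ep c) (F x y u v)"
      using arg_cong[where f = "\<lambda>t. sD f g x \<star> t", OF
        gam_balanced'[of c "cop f g (y \<cdot> (be \<cdot> (S u \<cdot> (al \<cdot> v))))"]]
      by (simp add: F_def sD_mult a2(3)[THEN ahom_mult] R.mul_assoc R.mul_sum R.mul_scl_right)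
  qed
  have 2: "absL34 F" "absR23 F"
    using S_be_abs[OF k] S_al_abs[OF k, where v = "_ \<cdot> (_ \<cdot> _)"]
    by (simp_all add: absR23_def absL34_def F_def mul_assoc S_mult)
  have "sum3 ph (\<lambda>u v w. F e u v w) = gam f g \<star> cop f g (sum3 ph (\<lambda>x y z. x \<cdot> be \<cdot> S y \<cdot> al \<cdot> z))"
    by (simp add: F_def sD_one klin_sum3[OF ahom_klin[OF a2(3)]] mul_assoc R.mul_sum)
  then have "sum3 ph (\<lambda>u v w. F e u v w) = gam f g"
    by (simp add: S_ph ahom_one[OF a2(3)])
  then show ?thesis
    using pentagon8_abs[OF F 1 2]
    by (simp add: Dr_def F_def R.mul_sum R.mul_assoc a2(3)[THEN ahom_mult] ahom_one[OF a2(3)])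
qed

text \<open>f is moved through the coproducts in U by \<open>Dr_twine\<close> and disappears into
  \<gamma> by \<open>Dr_alpha\<close>. The pentagon then removes \<gamma> as well, and what is left
  is the defining sum of q_R.\<close>

lemma Dr_Uel: "Dr f g \<star> Uel f g = sq f g"
proof -
  define F where "F = (\<lambda>a b c d. sD f g a \<star> (gam f g \<star> (f b \<star> g (c \<cdot> (be \<cdot> S d)))))"
  have F: "mlin4 sc sr F" by (simp add: F_def lin_all a2ls)
  have k: "klin sc sr (\<lambda>t. sD f g x \<star> (gam f g \<star> (f y \<star> g t)))" for x y by (simp add: lin_all a2ls)
  have aF: "absR34 F"
    using S_be_abs[OF k] by (simp add: absR34_def F_def mul_assoc S_mult)
  have "Dr f g \<star> Uel f g = sum3 pi (\<lambda>x y z. sD f g x \<star>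
    (gam f g \<star> (cop f g y \<star> (pR f g \<star> g (S z)))))"
    by (simp add: Uel_def R.mul_sum R.mul_assoc a2(3)[THEN ahom_mult] Dr_twine' Dr_alpha[symmetric])
  also have "\<dots> = sum3 pi (\<lambda>x y z. sum3 pi
    (\<lambda>u v w. sum2 (cm y) (\<lambda>y1 y2. F x (y1 \<cdot> u) (y2 \<cdot> v) (z \<cdot> w))))"
    unfolding pR_def cop_def[of f g] R.mul_assoc R.mul_sum_left
    unfolding R.mul_sum_right sum2_sum3
    by (simp add: F_def R.mul_assoc a2(1,2)[THEN ahom_mult] S_mult cms1[OF c2] cms2[OF c2])
  also have "\<dots> = sum3 pi (\<lambda>u v w. sum3 ph
    (\<lambda>x y z. sum2 (cm u) (\<lambda>u1 u2. F (x \<cdot> u1) (y \<cdot> u2) (z \<cdot> v) w)))"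
    unfolding pentagon5_abs[OF F aF] by (rule sum3_sum3)
  also have "\<dots> = sum3 pi (\<lambda>u v w. sum3 ph
    (\<lambda>x y z. f (S y \<cdot> (al \<cdot> z)) \<star> g (S x \<cdot> (S u \<cdot> (al \<cdot> (v \<cdot> (be \<cdot> S w)))))))"
  \<comment> \<open>For fixed factors of the remaining \<open>pi\<close>, the coproduct of
    \<open>u\<close> is removed: \<gamma> goes by the seventh pentagon, and then
    quasi-coassociativity leaves \<open>u\<close> in the second leg alone.\<close>
  proof -
    have "sum3 ph (\<lambda>x y z. sum2 (cm u) (\<lambda>u1 u2. F (x \<cdot> u1) (y \<cdot> u2) (z \<cdot> v) w)) =
       sum3 ph (\<lambda>x y z. f (S y \<cdot> (al \<cdot> z)) \<star> g (S x \<cdot> (S u \<cdot> (al \<cdot> (v \<cdot> (be \<cdot> S w))))))" for u v w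
    proof -
      define t where "t = v \<cdot> (be \<cdot> S w)"
      define M where "M = (\<lambda>a b c. f (S b \<cdot> (al \<cdot> c)) \<star> g (S a \<cdot> (al \<cdot> t)))"
      have kf: "klin sc sr (\<lambda>t. f t \<star> r)" for r by (simp add: lin_all a2l)
      have sDx: "sD f g (x \<cdot> a) = sum2 (cm a)
        (\<lambda>p q. sum2 (cm x) (\<lambda>x1 x2. f (S (x2 \<cdot> q)) \<star> g (S (x1 \<cdot> p))))"
        for x a
      proof -
        have ml: "mlin2 sc sr (\<lambda>x y. f (S y) \<star> g (S x))" by (simp add: lin_all a2l)
        show ?thesis unfolding sD_def cm_mult[OF ml] by (rule sum2_sum2)
      qed
      \<comment> \<open>Here \<gamma> is consumed: in \<open>K\<close> the \<open>al\<close> between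
        slots two and three absorbs the coproduct of the middle factor, which reduces the seventh
        pentagon to one \<open>ph\<close>.\<close>
      have 1: "sum3 ph (\<lambda>x y z. sum2 (cm x) (\<lambda>x1 x2. f (S (x2 \<cdot> q)) \<star> g (S (x1 \<cdot> p)) \<star>
          (gam f g \<star> (f (y \<cdot> r) \<star> g (z \<cdot> t))))) =
            sum3 ph (\<lambda>x y z. M (x \<cdot> p) (y \<cdot> q) (z \<cdot> r))" for p q r
      proof -
        define K where "K = (\<lambda>a b c d. f (S (b \<cdot> q) \<cdot> (al \<cdot> (c \<cdot> r))) \<star>
          g (S (a \<cdot> p) \<cdot> (al \<cdot> (d \<cdot> t))))"
        have K: "mlin4 sc sr K" by (simp add: K_def lin_all a2l)
        have aK: "absL23 K"
          unfolding absL23_def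
        proof safe
          fix c b d a x
          show "sum2 (cm c) (\<lambda>c1 c2. K a (c1 \<cdot> b) (c2 \<cdot> d) x) = sr (ep c) (K a b d x)"
            using S_al_abs[OF kf, where v = "S q \<cdot> S b" and w = "d \<cdot> r"]
              by (simp add: K_def S_mult mul_assoc)
        qed
        have "sum3 ph (\<lambda>x y z. sum2 (cm x) (\<lambda>x1 x2. f (S (x2 \<cdot> q)) \<star> g (S (x1 \<cdot> p)) \<star>
            (gam f g \<star> (f (y \<cdot> r) \<star> g (z \<cdot> t))))) =
          sum3 ph (\<lambda>X Y Z. sum3 pi (\<lambda>x y z. sum3 ph
            (\<lambda>u v w. sum2 (cm X) (\<lambda>X1 X2. sum2 (cm w) (\<lambda>w1 w2.
            K (u \<cdot> X1) (x \<cdot> (v \<cdot> X2)) (y \<cdot> (w1 \<cdot> Y)) (z \<cdot> (w2 \<cdot> Z)))))))"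
          unfolding gam_def R.mul_assoc R.mul_sum_left
          unfolding R.mul_sum_right sum2_sum3
          by (simp add: K_def S_mult a2(1,2)[THEN ahom_mult] R.mul_assoc cms1[OF c2] cms2[OF c2]
            mul_assoc)
        also have "\<dots> = sum3 pi (\<lambda>x y z. sum3 ph
          (\<lambda>u v w. sum3 ph (\<lambda>X Y Z. sum2 (cm w) (\<lambda>w1 w2. sum2 (cm X) (\<lambda>X1 X2.
            K (u \<cdot> X1) (x \<cdot> (v \<cdot> X2)) (y \<cdot> (w1 \<cdot> Y)) (z \<cdot> (w2 \<cdot> Z)))))))"
          by (subst sum2_sum2, subst sum3_sum3[of ph pi], subst sum3_sum3[of ph ph], rule refl)
        also have "\<dots> = sum3 ph (\<lambda>x y z. K x y z e)" by (rule pentagon7_abs[OF K aK])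
        finally show ?thesis by (simp add: K_def M_def)
      qed
      have M: "mlin3 sc sr M" by (simp add: M_def lin_all a2l)
      have aM: "sum2 (cm c) (\<lambda>c1 c2. M x (c1 \<cdot> y) (c2 \<cdot> z)) = sr (ep c) (M x y z)" for c x y z
        using S_al_abs[OF kf] by (simp add: M_def S_mult mul_assoc)
      have kM: "klin sc sr (\<lambda>t. M (t \<cdot> x) y z)" for x y z by (simp add: lin_all mlin3D[OF M])
      have "sum3 ph (\<lambda>x y z. sum2 (cm u) (\<lambda>u1 u2. F (x \<cdot> u1) (y \<cdot> u2) (z \<cdot> v) w)) =
        sum2 (cm u) (\<lambda>u1 u2. sum2 (cm u1) (\<lambda>p q. sum3 ph (\<lambda>x y z. sum2 (cm x) (\<lambda>x1 x2.
          f (S (x2 \<cdot> q)) \<star> g (S (x1 \<cdot> p)) \<star> (gam f g \<star> (f (y \<cdot> u2) \<star> g (z \<cdot> t)))))))"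
        by (simp add: F_def sDx R.mul_sum_left sum2_sum3 t_def mul_assoc)
      also have "\<dots> = sum3 ph (\<lambda>x y z. M (u \<cdot> x) y z)"
        unfolding 1 coassoc[OF M, symmetric] by (simp add: sum2_sum3 aM counit_r'[OF kM])
      finally show ?thesis by (simp add: M_def S_mult mul_assoc t_def)
    qed
    then show ?thesis by simp
  qed
  \<comment> \<open>The factors of \<open>pi\<close> now stand in the second leg in exactly the
    pattern of \<open>S_pi\<close>.\<close>
  also have "\<dots> = sq f g"
  proof -
    have kg: "klin sc sr (\<lambda>t. f r \<star> g (s \<cdot> t))" for r s by (simp add: lin_all a2l)
    have "sum3 pi (\<lambda>u v w. f r \<star> g (s \<cdot> (S u \<cdot> (al \<cdot> (v \<cdot> (be \<cdot> S w)))))) = f r \<star> g s" for r s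
      using klin_sum3[OF kg, of r s pi "\<lambda>x y z. S x \<cdot> al \<cdot> y \<cdot> be \<cdot> S z"]
        by (simp add: S_pi[unfolded mul_assoc] mul_assoc)
    then show ?thesis by (subst sum3_sum3) (simp add: sq_def)
  qed
  finally show ?thesis .
qed

end

section \<open>Passing to opposite algebras\<close>

text \<open>Reversing both multiplications keeps the legs and exchanges \<phi> with its inverse.
  Reversing only one of them makes anti-homomorphisms such as \<open>g\<close> after
  \<open>S\<close> into legs.\<close>

interpretation HO: qh_rep sc "\<lambda>a b. b \<cdot> a" e B cm ep pi ph T S "T be" "T al" sr mr o1
  using qh_op R.kalg_axioms by (simp add: qh_rep_def)

interpretation RO: qh_rep sc m e B cm ep ph pi S T al be sr "\<lambda>a b. b \<star> a" o1
  using qh_axioms R.kalg_op by (simp add: qh_rep_def)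

interpretation HRO: qh_rep sc "\<lambda>a b. b \<cdot> a" e B cm ep pi ph T S "T be" "T al" sr "\<lambda>a b. b \<star> a" o1
  using qh_op R.kalg_op by (simp add: qh_rep_def)

lemma HRO_ahom: "HRO.ahom f \<longleftrightarrow> ahom f"
  by (auto simp: HRO.ahom_def ahom_def)

lemma HRO_cms: "HRO.cms f g \<longleftrightarrow> cms f g"
  by (auto simp: HRO.cms_def cms_def)

lemma HRO_legs: "HRO.legs2 f g \<longleftrightarrow> legs2 f g" "HRO.legs3 f g h \<longleftrightarrow> legs3 f g h"
  by (simp_all add: HRO.legs2_def legs2_def HRO.legs3_def legs3_def HRO_ahom HRO_cms)

lemma HRO_cop: "cms f g \<Longrightarrow> HRO.cop f g = cop f g"
  by (simp add: HRO.cop_def cop_def cms_def fun_eq_iff)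

lemma HRO_Pi: "legs3 f g h \<Longrightarrow> HRO.Pi f g h = Ph f g h"
  using legs3D(12-14)[of f g h]
  by (simp add: HRO.Pi_def Ph_def R.mul_assoc cms1 cms2)

text \<open>U of the opposite algebra, evaluated in the opposite of R, so that \<open>f\<close> and
  \<open>g\<close> are still legs. \<open>Vel_eq\<close> identifies it with the prescribed
  V.\<close>

definition Vel :: "('a \<Rightarrow> 'r) \<Rightarrow> ('a \<Rightarrow> 'r) \<Rightarrow> 'r" where
  "Vel f g = HRO.Uel f g"

lemma Vel_twine:
  assumes l: "legs2 f g"
  shows "sum2 (cm a) (\<lambda>a1 a2. f a2 \<star> (Vel f g \<star> cop f g (T a1))) = g (T a) \<star> Vel f g"
  using HRO.Uel_twine[unfolded HRO_legs, OF l, of a]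
  by (simp add: HRO_cop[OF legs2D(3)[OF l]] Vel_def R.mul_assoc)

lemma Vel_counit: "ahom g \<Longrightarrow> Vel el g = o1"
  using HRO.Uel_counit[of g] by (simp add: Vel_def HRO_ahom)

text \<open>\<open>Uel_comult\<close> with both multiplications reversed, which turns
  \<open>Pi\<close> into \<open>Ph\<close> and reverses every product.\<close>

lemma Vel_comult:
  assumes l: "legs3 f g h"
  shows "Vel g h \<star> (Vel f (cop g h) \<star> Ph f g h) =
    sum3 pi (\<lambda>x y z. f y \<star> (g z \<star> (Vel (cop f g) h \<star> cop (cop f g) h (T x))))"
proof -
  have c: "cms (cop f g) h" "cms f (cop g h)" "cms f g" "cms g h"
    using legs3D[OF l] by (auto simp: legs2_def intro: leg_intros)
  have cc: "HRO.cop f g = cop f g" "HRO.cop g h = cop g h" "HRO.cop (cop f g) h = cop (cop f g) h"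
    by (fact c[THEN HRO_cop])+
  show ?thesis
    using HRO.Uel_comult[unfolded HRO_legs, OF l]
    unfolding cc HRO_Pi[OF l] Vel_def[symmetric]
    by (simp add: R.mul_assoc cms2[OF c(3)])
qed

lemma Vel_comult':
  assumes l: "legs3 f g h"
  shows "Vel g h \<star> Vel f (cop g h) =
    sum3 pi (\<lambda>x y z. f y \<star> (g z \<star> (Vel (cop f g) h \<star> (cop (cop f g) h (T x) \<star> Pi f g h))))"
  using arg_cong[where f = "\<lambda>t. t \<star> Pi f g h", OF Vel_comult[OF l]]
  by (simp add: R.mul_assoc R.mul_sum Ph_Pi[OF l])

text \<open>
  Here \<open>pR_collapse\<close> is applied to the opposite algebra with the legs \<open>g \<circ> S\<close> and \<open>f \<circ> S\<close>.
\<close>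

lemma Dr_right_inverse:
  assumes l: "legs2 f g"
  shows "Dr f g \<star> sum3 pi (\<lambda>x y z. cop f g (S x) \<star> (Uel f g \<star> f (y \<cdot> (be \<cdot> S z)))) = o1"
proof -
  note d = legs2D[OF l]
  let ?F = "\<lambda>a. g (S a)" and ?G = "\<lambda>a. f (S a)"
  have L: "HO.legs2 ?F ?G"
    using d(3) by (auto simp: HO.legs2_def HO.ahom_def HO.cms_def cms_def lin_all S_mult S_one
        d(1,2)[THEN ahom_add] d(1,2)[THEN ahom_scale] d(1,2)[THEN ahom_mult] d(1,2)[THEN ahom_one])
  have p: "HO.pR ?F ?G = sq f g"
    by (simp add: HO.pR_def sq_def S_mult mul_assoc cms1[OF d(3)])
  have c: "HO.cop ?F ?G = sD f g"
    by (simp add: HO.cop_def sD_def fun_eq_iff cms1[OF d(3)])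
  have "sum3 pi (\<lambda>x y z. sD f g x \<star> (sq f g \<star> f (y \<cdot> (be \<cdot> S z)))) = o1"
    using HO.pR_collapse[OF L] by (simp add: p c S_mult mul_assoc)
  \<comment> \<open>Each term has f pulled to the front, by twining past the coproduct and by f U =
    (S \<otimes> S)(q_R^21).\<close>
  then show ?thesis
    by (simp add: R.mul_sum Dr_twine'[OF l] Dr_Uel[OF l, symmetric] R.mul_assoc)
qed

text \<open>
  The right hand side evaluates the element \<open>V\<close>: as \<open>f \<circ> S\<inverse>\<close> and \<open>g \<circ> S\<inverse>\<close> are legs into the opposite of
  \<open>R\<close>, it is the product \<open>f p\<^sub>R\<close> evaluated there.
\<close>

lemma Vel_eq:
  assumes l: "legs2 f g"
  shows "Vel f g = RO.pR (\<lambda>a. g (T a)) (\<lambda>a. f (T a)) \<star> RO.Dr (\<lambda>a. g (T a)) (\<lambda>a. f (T a))"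
proof -
  note d = legs2D[OF l]
  let ?F = "\<lambda>a. g (T a)" and ?G = "\<lambda>a. f (T a)"
  have L: "RO.legs2 ?F ?G"
    using d(3) by (auto simp: RO.legs2_def RO.ahom_def RO.cms_def cms_def lin_all T_mult T_one
        d(1,2)[THEN ahom_add] d(1,2)[THEN ahom_scale] d(1,2)[THEN ahom_mult] d(1,2)[THEN ahom_one])
  have cp: "RO.sD ?F ?G = cop f g"
    by (simp add: RO.sD_def cop_def fun_eq_iff)
  have s: "x \<cdot> (be \<cdot> S y) = S (y \<cdot> (T be \<cdot> T x))" for x y
    by (simp add: S_mult mul_assoc)
  \<comment> \<open>p_R is expanded through U so that f stands next to a coproduct; twining past it
    brings f next to U, and their product is known from \<open>Dr_Uel\<close>.\<close>
  have "RO.pR ?F ?G \<star> RO.Dr ?F ?G =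
      sum3 ph (\<lambda>x y z. ?F z \<star> (RO.Uel ?F ?G \<star> (RO.cop ?F ?G (x \<cdot> (be \<cdot> S y)) \<star> RO.Dr ?F ?G)))"
    unfolding RO.Uel_to_pR[OF L, symmetric] by (simp add: R.mul_sum R.mul_assoc)
  also have "\<dots> = sum3 ph (\<lambda>x y z. ?F z \<star>
    (RO.Uel ?F ?G \<star> (RO.Dr ?F ?G \<star> cop f g (y \<cdot> (T be \<cdot> T x)))))"
    unfolding s RO.Dr_twine[OF L] cp ..
  also have "\<dots> = sum3 ph (\<lambda>x y z. ?F z \<star> (RO.sq ?F ?G \<star> cop f g (y \<cdot> (T be \<cdot> T x))))"
    unfolding RO.Dr_Uel[OF L, symmetric] by (simp add: R.mul_assoc)
  also have "\<dots> = Vel f g"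
  proof -
    have "RO.sq ?F ?G = HRO.pR f g"
      by (simp add: RO.sq_def HRO.pR_def T_mult mul_assoc cms1[OF d(3)])
    then show ?thesis
      by (simp add: Vel_def HRO.Uel_def HRO_cop[OF d(3)] R.mul_assoc mul_assoc)
  qed
  finally show ?thesis by simp
qed

end

section \<open>From tensor equations to evaluations\<close>

text \<open>The linear extension of \<open>G\<close> from tuples to formal sums. It is additive only
  on functions of finite support, so finiteness has to accompany every use.\<close>

definition fsum :: "('t \<Rightarrow> 'k::field) \<Rightarrow> ('t \<Rightarrow> 'k) \<Rightarrow> 'k" where
  "fsum G f = (\<Sum>t | f t \<noteq> 0. f t * G t)"

lemma fsum_superset: "finite A \<Longrightarrow> {t. f t \<noteq> 0} \<subseteq> A \<Longrightarrow> fsum G f = (\<Sum>t\<in>A. f t * G t)"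
  unfolding fsum_def by (rule sum.mono_neutral_left) auto

lemma fsum_lin:
  assumes "finite {t. f t \<noteq> 0}" "finite {t. g t \<noteq> 0}"
  shows "fsum G (f + g) = fsum G f + fsum G g" "fsum G (f - g) = fsum G f - fsum G g"
    "fsum G (fscale c f) = c * fsum G f"
proof -
  define A where "A = {t. f t \<noteq> 0} \<union> {t. g t \<noteq> 0}"
  have A: "finite A" using assms by (simp add: A_def)
  note s = fsum_superset[OF A]
  show "fsum G (f + g) = fsum G f + fsum G g"
    by (subst (1 2 3) s) (auto simp: A_def sum.distrib algebra_simps)
  show "fsum G (f - g) = fsum G f - fsum G g"
    by (subst (1 2 3) s) (auto simp: A_def sum_subtractf algebra_simps)
  show "fsum G (fscale c f) = c * fsum G f"
    by (subst (1 2) s) (auto simp: A_def fscale_def sum_distrib_left algebra_simps)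
qed

lemma finite_supp_point [simp]: "finite {u. point t u \<noteq> (0::'k::field)}"
  by (rule finite_subset[of _ "{t}"]) (auto simp: point_def)

lemma fsum_point [simp]: "fsum G (point t) = G t"
  using fsum_superset[of "{t}" "point t" G] by (auto simp: point_def)

lemma formal_sum_Cons: "formal_sum (t # ts) = point t + formal_sum ts"
  by (simp add: formal_sum_def)

lemma finite_supp_add:
  assumes "finite {t. f t \<noteq> (0::'k::field)}" "finite {t. g t \<noteq> 0}"
  shows "finite {t. (f + g) t \<noteq> 0}" "finite {t. (f - g) t \<noteq> 0}" "finite {t. fscale c f t \<noteq> 0}"
proof -
  have u: "finite ({t. f t \<noteq> 0} \<union> {t. g t \<noteq> 0})" using assms by simp
  show "finite {t. (f + g) t \<noteq> 0}" "finite {t. (f - g) t \<noteq> 0}" "finite {t. fscale c f t \<noteq> 0}"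
    by (rule finite_subset[OF _ u], auto simp: fscale_def)+
qed

lemma formal_sum_Nil: "formal_sum [] = 0"
  by (simp add: formal_sum_def)

lemma fsum_zero: "fsum G 0 = 0" "finite {t. 0 t \<noteq> (0::'k::field)}"
  by (simp_all add: fsum_def)

lemma fsum_formal_sum:
  "finite {u. formal_sum ts u \<noteq> (0::'k::field)} \<and> fsum G (formal_sum ts) = (\<Sum>t\<leftarrow>ts. G t :: 'k)"
proof (induction ts)
  case Nil
  show ?case unfolding formal_sum_Nil fsum_zero(1) using fsum_zero(2) by (simp del: zero_fun_apply)
next
  case (Cons t ts)
  then have s: "finite {u. formal_sum ts u \<noteq> (0::'k)}" by blast
  show ?case
    unfolding formal_sum_Cons fsum_lin(1)[OF finite_supp_point s]
      using Cons finite_supp_add(1)[OF finite_supp_point s]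
    by (simp del: plus_fun_apply)
qed

text \<open>The linear extension of a multilinear \<open>G\<close> kills the generating relations,
  hence their span. The induction over the span also records finite support, without which the
  extension is not linear.\<close>

lemma tensor_eqD:
  assumes "tensor_eq s P xs ys" and G: "\<And>p. p \<in> P \<Longrightarrow> klin s (*) (\<lambda>a. G (p a))"
  shows "(\<Sum>t\<leftarrow>xs. G t) = (\<Sum>t\<leftarrow>ys. G t :: 'k::field)"
proof -
  interpret F: vector_space "fscale :: 'k \<Rightarrow> ('b \<Rightarrow> 'k) \<Rightarrow> 'b \<Rightarrow> 'k" by (rule vector_space_fscale)
  have "finite {t. f t \<noteq> 0} \<and> fsum G f = 0" if "f \<in> F.span (tensor_relations s P)" for f
    using that
  proof (induction rule: F.span_induct_alt)
    case base
    show ?case using fsum_zero by blast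
  next
    case (step c r f)
    note pt = finite_supp_point[where ?'k = 'k]
    have r: "finite {t. r t \<noteq> 0} \<and> fsum G r = 0"
      using step(1) unfolding tensor_relations_def
    proof (elim UnE CollectE exE conjE)
      fix p a b assume r: "r = point (p (a + b)) - point (p a) - point (p b)" and p: "p \<in> P"
      note f1 = finite_supp_add(2)[OF pt[of "p (a + b)"] pt[of "p a"]]
      show ?thesis
        unfolding r fsum_lin(2)[OF f1 pt] fsum_lin(2)[OF pt pt] fsum_point
        using klin_add[OF G[OF p]] finite_supp_add(2)[OF f1 pt] by simp
    next
      fix p c a assume r: "r = point (p (s c a)) - fscale c (point (p a))" and p: "p \<in> P"
      note f1 = finite_supp_add(3)[OF pt[of "p a"] pt[of "p a"], of c]
      show ?thesis
        unfolding r fsum_lin(2)[OF pt f1] fsum_lin(3)[OF pt pt] fsum_point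
        using klin_scale[OF G[OF p]] finite_supp_add(2)[OF pt f1] by simp
    qed
    then have r1: "finite {t. r t \<noteq> 0}" and f1: "finite {t. f t \<noteq> 0}" using step(2) by blast+
    note c1 = finite_supp_add(3)[OF r1 r1, of c]
    show ?case
      using r step(2) finite_supp_add(1)[OF c1 f1]
      unfolding fsum_lin(1)[OF c1 f1] fsum_lin(3)[OF r1 r1] by simp
  qed
  from this[OF assms(1)[unfolded tensor_eq_def]] show ?thesis
    using fsum_formal_sum[of xs G] fsum_formal_sum[of ys G] by (simp add: fsum_lin(2))
qed

text \<open>If the difference were outside the span, a functional killing all relations would be 1
  on it. Restricted to point functions, this functional is multilinear and contradicts the
  assumption.\<close>

lemma tensor_eqI:
  fixes xs :: "'t list" and s :: "'k::field \<Rightarrow> 'a::ab_group_add \<Rightarrow> 'a"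
  assumes "\<And>G. (\<And>p. p \<in> P \<Longrightarrow> klin s (*) (\<lambda>a. G (p a))) \<Longrightarrow> (\<Sum>t\<leftarrow>xs. G t) = (\<Sum>t\<leftarrow>ys. G t)"
  shows "tensor_eq s P xs ys"
proof (rule ccontr)
  interpret F: vector_space "fscale :: 'k \<Rightarrow> ('t \<Rightarrow> 'k) \<Rightarrow> 't \<Rightarrow> 'k" by (rule vector_space_fscale)
  assume "\<not> tensor_eq s P xs ys"
  then have ns: "formal_sum xs - formal_sum ys \<notin> F.span (tensor_relations s P)"
    by (simp add: tensor_eq_def)
  obtain l where l: "klin fscale (*) l" "\<And>r. r \<in> tensor_relations s P \<Longrightarrow> l r = 0"
      "l (formal_sum xs - formal_sum ys) = 1"
    using F.klin_separates_span[OF ns] by metis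
  have d: "l (f - g) = l f - l g" for f g
    using klin_add[OF l(1), of "f - g" g] by simp
  have fs: "l (formal_sum ts) = (\<Sum>t\<leftarrow>ts. l (point t))" for ts
    by (induction ts)
      (simp_all only: formal_sum_Cons formal_sum_Nil klin_add[OF l(1)] klin_zero[OF l(1)] list.map
        sum_list.Nil sum_list.Cons)
  have "klin s (*) (\<lambda>a. l (point (p a)))" if p: "p \<in> P" for p
    unfolding klin_def
  proof safe
    fix a b c
    have "l (point (p (a + b)) - point (p a) - point (p b)) = 0"
      by (rule l(2)) (use p in \<open>unfold tensor_relations_def, blast\<close>)
    then show "l (point (p (a + b))) = l (point (p a)) + l (point (p b))" unfolding d
      by (simp add: algebra_simps)
    have "l (point (p (s c a)) - fscale c (point (p a))) = 0"
      by (rule l(2)) (use p in \<open>unfold tensor_relations_def, blast\<close>)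
    then show "l (point (p (s c a))) = c * l (point (p a))" unfolding d
      by (simp add: klin_scale[OF l(1)])
  qed
  from assms[OF this] l(3) show False unfolding d fs by simp
qed

lemma tensor_eq2_iff:
  "tensor_eq2 H xs ys \<longleftrightarrow> (\<forall>F. mlin2 (scal H) (*) F \<longrightarrow> sum2 xs F = sum2 ys F)"
proof
  assume t: "tensor_eq2 H xs ys"
  show "\<forall>F. mlin2 (scal H) (*) F \<longrightarrow> sum2 xs F = sum2 ys F"
  proof safe
    fix F :: "'b \<Rightarrow> 'b \<Rightarrow> 'a" assume F: "mlin2 (scal H) (*) F"
    show "sum2 xs F = sum2 ys F"
      unfolding sum2_def
      by (rule tensor_eqD[OF t[unfolded tensor_eq2_def]])
        (use F in \<open>auto simp: slots2_def mlin2_def\<close>)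
  qed
next
  assume t: "\<forall>F. mlin2 (scal H) (*) F \<longrightarrow> sum2 xs F = sum2 ys F"
  show "tensor_eq2 H xs ys"
    unfolding tensor_eq2_def
  proof (rule tensor_eqI)
    fix G :: "'b \<times> 'b \<Rightarrow> 'a" assume G: "\<And>p. p \<in> slots2 \<Longrightarrow> klin (scal H) (*) (\<lambda>a. G (p a))"
    have "klin (scal H) (*) (\<lambda>a. G (a, b))" "klin (scal H) (*) (\<lambda>a. G (b, a))" for b
      using G[of "\<lambda>a. (a, b)"] G[of "\<lambda>a. (b, a)"] by (auto simp: slots2_def)
    then have "mlin2 (scal H) (*) (\<lambda>a b. G (a, b))" by (simp add: mlin2_def)
    with t show "(\<Sum>t\<leftarrow>xs. G t) = (\<Sum>t\<leftarrow>ys. G t)" by (auto simp: sum2_def)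
  qed
qed

lemma tensor_eq3D:
  assumes t: "tensor_eq3 H xs ys" and F: "mlin3 (scal H) (*) F"
  shows "sum3 xs F = sum3 ys F"
  unfolding sum3_def
  by (rule tensor_eqD[OF t[unfolded tensor_eq3_def]]) (use F in \<open>auto simp: slots3_def mlin3_def\<close>)

definition sum4 :: "('a \<times> 'b \<times> 'c \<times> 'd) list \<Rightarrow> ('a \<Rightarrow> 'b \<Rightarrow> 'c \<Rightarrow> 'd \<Rightarrow> 'v::comm_monoid_add) \<Rightarrow> 'v" where
  "sum4 ts F = (\<Sum>(x, y, z, w)\<leftarrow>ts. F x y z w)"

lemma tensor_eq4D:
  assumes t: "tensor_eq4 H xs ys" and F: "mlin4 (scal H) (*) F"
  shows "sum4 xs F = sum4 ys F"
  unfolding sum4_def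
  by (rule tensor_eqD[OF t[unfolded tensor_eq4_def]]) (use F in \<open>auto simp: slots4_def mlin4_def\<close>)

lemma sum3_append: "sum3 (ts @ us) F = sum3 ts F + sum3 us F"
  and sum4_append: "sum4 (vs @ ws) G = sum4 vs G + sum4 ws G"
  by (simp_all add: sum3_def sum4_def)

lemma sum4_Nil [simp]: "sum4 [] F = 0"
  and sum4_Cons [simp]: "sum4 ((x, y, z, w) # ts) F = F x y z w + sum4 ts F"
  by (simp_all add: sum4_def)

lemma sum2_comprehension:
  fixes ts :: "('a::ring_1 \<times> 'a) list" and us :: "('a \<times> 'a \<times> 'a) list" and vs
    :: "('a \<times> 'a \<times> 'a \<times> 'a) list"
  shows
  "sum2 (concat (map (\<lambda>(x, y). L2 x y) ts)) F = sum2 ts (\<lambda>x y. sum2 (L2 x y) F)"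
  "sum2 (concat (map (\<lambda>(x, y, z). L3 x y z) us)) F = sum3 us (\<lambda>x y z. sum2 (L3 x y z) F)"
  "sum2 (concat (map (\<lambda>(x, y, z, w). L4 x y z w) vs)) F = sum4 vs (\<lambda>x y z w. sum2 (L4 x y z w) F)"
  "sum2 (map (\<lambda>(x, y). (p2 x y, q2 x y)) ts) F = sum2 ts (\<lambda>x y. F (p2 x y) (q2 x y))"
  "sum2 (map (\<lambda>(x, y, z). (p3 x y z, q3 x y z)) us) F = sum3 us (\<lambda>x y z. F (p3 x y z) (q3 x y z))"
  "sum2 (map (\<lambda>(x, y, z, w). (p4 x y z w, q4 x y z w)) vs) F =
    sum4 vs (\<lambda>x y z w. F (p4 x y z w) (q4 x y z w))"
  by ((induction ts; auto simp: sum2_append), (induction us; auto simp: sum2_append),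
    (induction vs; auto simp: sum2_append))+

lemma sum3_comprehension:
  fixes ts :: "('a::ring_1 \<times> 'a) list" and us :: "('a \<times> 'a \<times> 'a) list" and vs
    :: "('a \<times> 'a \<times> 'a \<times> 'a) list"
  shows
  "sum3 (concat (map (\<lambda>(x, y). L2 x y) ts)) F = sum2 ts (\<lambda>x y. sum3 (L2 x y) F)"
  "sum3 (concat (map (\<lambda>(x, y, z). L3 x y z) us)) F = sum3 us (\<lambda>x y z. sum3 (L3 x y z) F)"
  "sum3 (map (\<lambda>(x, y). (p2 x y, q2 x y, r2 x y)) ts) F =
    sum2 ts (\<lambda>x y. F (p2 x y) (q2 x y) (r2 x y))"
  "sum3 (map (\<lambda>(x, y, z). (p3 x y z, q3 x y z, r3 x y z)) us) F =
    sum3 us (\<lambda>x y z. F (p3 x y z) (q3 x y z) (r3 x y z))"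
  by ((induction ts; auto simp: sum3_append), (induction us; auto simp: sum3_append))+

lemma sum4_comprehension:
  fixes ts :: "('a::ring_1 \<times> 'a) list" and us :: "('a \<times> 'a \<times> 'a) list" and vs
    :: "('a \<times> 'a \<times> 'a \<times> 'a) list"
  shows
  "sum4 (concat (map (\<lambda>(x, y). L2 x y) ts)) F = sum2 ts (\<lambda>x y. sum4 (L2 x y) F)"
  "sum4 (concat (map (\<lambda>(x, y, z). L3 x y z) us)) F = sum3 us (\<lambda>x y z. sum4 (L3 x y z) F)"
  "sum4 (concat (map (\<lambda>(x, y, z, w). L4 x y z w) vs)) F = sum4 vs (\<lambda>x y z w. sum4 (L4 x y z w) F)"
  "sum4 (map (\<lambda>(x, y). (p2 x y, q2 x y, r2 x y, s2 x y)) ts) F =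
    sum2 ts (\<lambda>x y. F (p2 x y) (q2 x y) (r2 x y) (s2 x y))"
  "sum4 (map (\<lambda>(x, y, z). (p3 x y z, q3 x y z, r3 x y z, s3 x y z)) us) F =
    sum3 us (\<lambda>x y z. F (p3 x y z) (q3 x y z) (r3 x y z) (s3 x y z))"
  "sum4 (map (\<lambda>(x, y, z, w). (p4 x y z w, q4 x y z w, r4 x y z w, s4 x y z w)) vs) F =
    sum4 vs (\<lambda>x y z w. F (p4 x y z w) (q4 x y z w) (r4 x y z w) (s4 x y z w))"
  by ((induction ts; auto simp: sum4_append), (induction us; auto simp: sum4_append),
    (induction vs; auto simp: sum4_append))+

lemma sum_comprehension_Pair:
  "sum3 (map (Pair a) ts) F = sum2 ts (F a)"
  "sum4 (map (Pair a) us) G = sum3 us (G a)"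
  "sum4 (map (\<lambda>p. (a, b, p)) ts) G = sum2 ts (G a b)"
  by ((induction ts; auto), (induction us; auto), (induction ts; auto))

lemmas sum_comprehension = sum_comprehension_Pair sum2_comprehension sum3_comprehension
  sum4_comprehension

lemma sum_tmul:
  fixes t2 :: "('a::ring_1 \<times> 'a) list" and t3 :: "('a \<times> 'a \<times> 'a) list" and t4
    :: "('a \<times> 'a \<times> 'a \<times> 'a) list"
  shows
  "sum2 (tmul2 t2 u2) F2 = sum2 t2 (\<lambda>a b. sum2 u2 (\<lambda>a' b'. F2 (a * a') (b * b')))"
  "sum3 (tmul3 t3 u3) F3 = sum3 t3 (\<lambda>a b c. sum3 u3 (\<lambda>a' b' c'. F3 (a * a') (b * b') (c * c')))"
  "sum4 (tmul4 t4 u4) F4 = sum4 t4 (\<lambda>a b c d. sum4 u4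
    (\<lambda>a' b' c' d'. F4 (a * a') (b * b') (c * c') (d * d')))"
  by (simp_all add: tmul2_def tmul3_def tmul4_def sum_comprehension)

section \<open>The axioms of \<open>qh\<close> for a given quasi-Hopf algebra\<close>

context quasi_hopf_algebra
begin

lemma kalg_H: "kalg (scal H) (*) 1"
  by unfold_locales (auto simp: algebra_simps scale_mult_left[symmetric]
    scale_mult_right[symmetric])

interpretation A: kalg "scal H" "(*)" 1 by (rule kalg_H)

lemma comult_klin:
  assumes F: "mlin2 (scal H) (*) F" shows "klin (scal H) (*) (\<lambda>a. sum2 (comult H a) F)"
  unfolding klin_def
proof safe
  fix a b c
  show "sum2 (comult H (a + b)) F = sum2 (comult H a) F + sum2 (comult H b) F"
    using comult_add[of a b, unfolded tensor_eq2_iff] F by (simp add: sum2_append)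
  show "sum2 (comult H (scal H c a)) F = c * sum2 (comult H a) F"
    using comult_scale[of c a, unfolded tensor_eq2_iff] F
    by (simp add: sum2_comprehension mlin2D[OF F]
      sum2_hom[of "\<lambda>t. c * t", OF distrib_left mult_zero_right])
qed

lemma comult_mult':
  assumes F: "mlin2 (scal H) (*) F"
  shows "sum2 (comult H (a * b)) F =
    sum2 (comult H a) (\<lambda>x y. sum2 (comult H b) (\<lambda>x' y'. F (x * x') (y * y')))"
  using comult_mult[of a b, unfolded tensor_eq2_iff] F by (simp add: sum_tmul)

lemma comult_one':
  assumes F: "mlin2 (scal H) (*) F" shows "sum2 (comult H 1) F = F 1 1"
  using comult_one[unfolded tensor_eq2_iff] F by simp

definition "phinv = reassoc_inv H"

lemma reassoc_inv_inverse: "is_inverse3 H (reassoc H) phinv"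
  unfolding phinv_def reassoc_inv_def by (rule someI_ex[OF reassoc_invertible])

lemma phinv_mult:
  assumes F: "mlin3 (scal H) (*) F"
  shows "sum3 (reassoc H) (\<lambda>x y z. sum3 phinv (\<lambda>x' y' z'. F (x * x') (y * y') (z * z'))) = F 1 1 1"
    and "sum3 phinv (\<lambda>x y z. sum3 (reassoc H) (\<lambda>x' y' z'. F (x * x') (y * y') (z * z'))) = F 1 1 1"
  using reassoc_inv_inverse unfolding is_inverse3_def
  by (auto dest!: tensor_eq3D[OF _ F] simp: sum_tmul)

lemma coassoc':
  assumes F: "mlin3 (scal H) (*) F"
  shows "sum2 (comult H a) (\<lambda>a1 a2. sum2 (comult H a2)
    (\<lambda>a21 a22. sum3 (reassoc H) (\<lambda>x y z. F (a1 * x) (a21 * y) (a22 * z)))) =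
    sum2 (comult H a) (\<lambda>a1 a2. sum2 (comult H a1)
      (\<lambda>a11 a12. sum3 (reassoc H) (\<lambda>x y z. F (x * a11) (y * a12) (z * a2))))"
  using tensor_eq3D[OF quasi_coassoc[of a] F]
  by (simp add: sum_tmul sum_comprehension sum2_sum3)

lemma klin_mul: "klin (scal H) (scal H) (\<lambda>t. a * t)" "klin (scal H) (scal H) (\<lambda>t. t * a)"
  by (simp_all add: klin_def distrib_left distrib_right scale_mult_left[symmetric]
    scale_mult_right[symmetric])

lemmas Hlin = distrib_left distrib_right scale_mult_left[symmetric] scale_mult_right[symmetric]
  sum2_add sum3_add sum2_hom[of "\<lambda>t. _ * t", OF distrib_left mult_zero_right, symmetric]
  sum3_hom[of "\<lambda>t. _ * t", OF distrib_left mult_zero_right, symmetric]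
  klin_add[OF comult_klin] klin_scale[OF comult_klin] mlin_defs

text \<open>Quasi-coassociativity conjugated by \<phi>: the product of the inverse and \<phi> is
  inserted in front, \<phi> is moved across the coproducts, and it cancels against the inverse
  behind them.\<close>

lemma coassoc_inv':
  assumes F: "mlin3 (scal H) (*) F"
  shows "sum2 (comult H a) (\<lambda>a1 a2. sum2 (comult H a2)
    (\<lambda>a21 a22. sum3 phinv (\<lambda>x y z. F (x * a1) (y * a21) (z * a22)))) =
    sum2 (comult H a) (\<lambda>a1 a2. sum2 (comult H a1)
      (\<lambda>a11 a12. sum3 phinv (\<lambda>x y z. F (a11 * x) (a12 * y) (a2 * z))))"
    (is "?l = ?r")
proof -
  define G where "G = (\<lambda>u v w. sum2 (comult H a)
    (\<lambda>a1 a2. sum2 (comult H a1) (\<lambda>a11 a12. sum3 phinv (\<lambda>x y z.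
      F (u * a11 * x) (v * a12 * y) (w * a2 * z)))))"
  have G: "mlin3 (scal H) (*) G" by (simp add: G_def Hlin mlin3D[OF F])
  define K where "K = (\<lambda>p q r u v w. sum3 phinv (\<lambda>x y z. F (p * u * x) (q * v * y) (r * w * z)))"
  have K: "mlin3 (scal H) (*) (K p q r)" for p q r by (simp add: K_def Hlin mlin3D[OF F])
  have M: "mlin3 (scal H) (*) (\<lambda>u v w. F (p * (a * u)) (q * (b * v)) (r * (c * w)))" for p q r a b c
    by (simp add: Hlin mlin3D[OF F])
  have "?r = G 1 1 1" by (simp add: G_def)
  also have "\<dots> = sum3 phinv (\<lambda>p q r. sum3 (reassoc H) (\<lambda>x y z. G (p * x) (q * y) (r * z)))"
    by (rule phinv_mult(2)[OF G, symmetric])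
  also have "\<dots> = sum3 phinv (\<lambda>p q r. sum2 (comult H a)
    (\<lambda>a1 a2. sum2 (comult H a1) (\<lambda>a11 a12. sum3 (reassoc H) (\<lambda>x y z.
      K p q r (x * a11) (y * a12) (z * a2)))))"
    by (simp add: G_def K_def mult.assoc sum2_sum3)
  also have "\<dots> = sum3 phinv (\<lambda>p q r. sum2 (comult H a)
    (\<lambda>a1 a2. sum2 (comult H a2) (\<lambda>a21 a22. sum3 (reassoc H) (\<lambda>x y z.
      K p q r (a1 * x) (a21 * y) (a22 * z)))))"
    by (simp only: coassoc'[OF K])
  also have "\<dots> = ?l"
    by (simp add: K_def mult.assoc phinv_mult(1)[OF M]) (simp add: sum2_sum3)
  finally show ?thesis by simp
qed

text \<open>
  Left multiplication by the five factors of the pentagon, as operators on multilinear forms.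
\<close>

definition "oA L F = (\<lambda>a b c d. sum3 L (\<lambda>x y z. sum2 (comult H z)
  (\<lambda>z1 z2. F (x * a) (y * b) (z1 * c) (z2 * d))))"
definition "oB L F = (\<lambda>a b c d. sum3 L (\<lambda>x y z. sum2 (comult H x)
  (\<lambda>x1 x2. F (x1 * a) (x2 * b) (y * c) (z * d))))"
definition "oC L F = (\<lambda>a b c d. sum3 L (\<lambda>x y z. F a (x * b) (y * c) (z * d)))"
definition "oD L F = (\<lambda>a b c d. sum3 L (\<lambda>x y z. sum2 (comult H y)
  (\<lambda>y1 y2. F (x * a) (y1 * b) (y2 * c) (z * d))))"
definition "oE L F = (\<lambda>a b c d. sum3 L (\<lambda>x y z. F (x * a) (y * b) (z * c) d))"

lemmas o_defs = oA_def oB_def oC_def oD_def oE_def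

lemma o_mlin:
  assumes F: "mlin4 (scal H) (*) F"
  shows "mlin4 (scal H) (*) (oA L F)" "mlin4 (scal H) (*) (oB L F)" "mlin4 (scal H) (*) (oC L F)"
    "mlin4 (scal H) (*) (oD L F)" "mlin4 (scal H) (*) (oE L F)"
  by (simp_all add: o_defs Hlin mlin4D[OF F])

text \<open>The operator applied last contributes the factor nearest to the arguments, so composing
  with \<open>L\<close> and then with \<open>L'\<close> multiplies by \<open>L\<close> times
  \<open>L'\<close>.\<close>

lemma o_inverse:
  assumes F: "mlin4 (scal H) (*) F"
    and L: "\<And>G. mlin3 (scal H) (*) G \<Longrightarrow>
      sum3 L (\<lambda>x y z. sum3 L' (\<lambda>x' y' z'. G (x * x') (y * y') (z * z'))) = G 1 1 1"
  shows "oA L' (oA L F) = F" "oB L' (oB L F) = F" "oC L' (oC L F) = F" "oD L' (oD L F) = F"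
    "oE L' (oE L F) = F"
proof -
  show "oA L' (oA L F) = F"
  proof (intro ext)
    fix a b c d
    have m2: "mlin2 (scal H) (*) (\<lambda>u v. F p q (u * c) (v * d))" for p q
      by (simp add: Hlin mlin4D[OF F])
    have m3: "mlin3 (scal H) (*) (\<lambda>x y z. sum2 (comult H z)
      (\<lambda>u v. F (x * a) (y * b) (u * c) (v * d)))"
      by (simp add: Hlin mlin4D[OF F])
    have "oA L' (oA L F) a b c d =
        sum3 L (\<lambda>x y z. sum3 L' (\<lambda>x' y' z'.
          (\<lambda>x y z. sum2 (comult H z) (\<lambda>u v. F (x * a) (y * b) (u * c) (v * d))) (x * x') (y * y')
          (z * z')))"
      by (simp add: oA_def comult_mult'[OF m2] sum2_sum3 mult.assoc sum3_sum3[of L' L])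
        (subst sum2_sum2, rule refl)
    then show "oA L' (oA L F) a b c d = F a b c d"
      unfolding L[OF m3] by (simp add: comult_one'[OF m2])
  qed
  show "oB L' (oB L F) = F"
  proof (intro ext)
    fix a b c d
    have m2: "mlin2 (scal H) (*) (\<lambda>u v. F (u * a) (v * b) p q)" for p q
      by (simp add: Hlin mlin4D[OF F])
    have m3: "mlin3 (scal H) (*) (\<lambda>x y z. sum2 (comult H x)
      (\<lambda>u v. F (u * a) (v * b) (y * c) (z * d)))"
      by (simp add: Hlin mlin4D[OF F])
    have "oB L' (oB L F) a b c d =
        sum3 L (\<lambda>x y z. sum3 L' (\<lambda>x' y' z'.
          (\<lambda>x y z. sum2 (comult H x) (\<lambda>u v. F (u * a) (v * b) (y * c) (z * d))) (x * x') (y * y')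
          (z * z')))"
      by (simp add: oB_def comult_mult'[OF m2] sum2_sum3 mult.assoc sum3_sum3[of L' L])
        (subst sum2_sum2, rule refl)
    then show "oB L' (oB L F) a b c d = F a b c d"
      unfolding L[OF m3] by (simp add: comult_one'[OF m2])
  qed
  show "oC L' (oC L F) = F"
  proof (intro ext)
    fix a b c d
    have m3: "mlin3 (scal H) (*) (\<lambda>x y z. F a (x * b) (y * c) (z * d))"
      by (simp add: Hlin mlin4D[OF F])
    show "oC L' (oC L F) a b c d = F a b c d"
      using L[OF m3] by (simp add: oC_def mult.assoc sum3_sum3[of L' L])
  qed
  show "oD L' (oD L F) = F"
  proof (intro ext)
    fix a b c d
    have m2: "mlin2 (scal H) (*) (\<lambda>u v. F p (u * b) (v * c) q)" for p q
      by (simp add: Hlin mlin4D[OF F])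
    have m3: "mlin3 (scal H) (*) (\<lambda>x y z. sum2 (comult H y)
      (\<lambda>u v. F (x * a) (u * b) (v * c) (z * d)))"
      by (simp add: Hlin mlin4D[OF F])
    have "oD L' (oD L F) a b c d =
        sum3 L (\<lambda>x y z. sum3 L' (\<lambda>x' y' z'.
          (\<lambda>x y z. sum2 (comult H y) (\<lambda>u v. F (x * a) (u * b) (v * c) (z * d))) (x * x') (y * y')
          (z * z')))"
      by (simp add: oD_def comult_mult'[OF m2] sum2_sum3 mult.assoc sum3_sum3[of L' L])
        (subst sum2_sum2, rule refl)
    then show "oD L' (oD L F) a b c d = F a b c d"
      unfolding L[OF m3] by (simp add: comult_one'[OF m2])
  qed
  show "oE L' (oE L F) = F"
  proof (intro ext)
    fix a b c d
    have m3: "mlin3 (scal H) (*) (\<lambda>x y z. F (x * a) (y * b) (z * c) d)"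
      by (simp add: Hlin mlin4D[OF F])
    show "oE L' (oE L F) a b c d = F a b c d"
      using L[OF m3] by (simp add: oE_def mult.assoc sum3_sum3[of L' L])
  qed
qed

lemma pentagon':
  assumes F: "mlin4 (scal H) (*) F"
  shows "sum3 (reassoc H) (\<lambda>x y z. sum2 (comult H z)
    (\<lambda>z1 z2. sum3 (reassoc H) (\<lambda>x' y' z'. sum2 (comult H x') (\<lambda>x1 x2.
            F (x * x1) (y * x2) (z1 * y') (z2 * z'))))) =
          sum3 (reassoc H) (\<lambda>x y z. sum3 (reassoc H)
            (\<lambda>x' y' z'. sum2 (comult H y') (\<lambda>y1 y2. sum3 (reassoc H) (\<lambda>u v w.
            F (x' * u) (x * (y1 * v)) (y * (y2 * w)) (z * z')))))"
  using tensor_eq4D[OF pentagon F]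
  by (simp add: sum_tmul sum_comprehension mult.assoc)

lemma o_pentagon:
  assumes F: "mlin4 (scal H) (*) F"
  shows "oB (reassoc H) (oA (reassoc H) F) = oE (reassoc H) (oD (reassoc H) (oC (reassoc H) F))"
proof (intro ext)
  fix a b c d
  have m: "mlin4 (scal H) (*) (\<lambda>p q r s. F (p * a) (q * b) (r * c) (s * d))"
    by (simp add: Hlin mlin4D[OF F])
  show "oB (reassoc H) (oA (reassoc H) F) a b c d =
    oE (reassoc H) (oD (reassoc H) (oC (reassoc H) F)) a b c d"
  proof -
    let ?sum = "sum3 (reassoc H)"
    define K where "K x y z x' y' z' = sum2 (comult H x') (\<lambda>x1 x2. sum2 (comult H z) (\<lambda>z1 z2.
      F (x * (x1 * a)) (y * (x2 * b)) (z1 * (y' * c)) (z2 * (z' * d))))" for x y z x' y' z'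
    define K' where "K' x y z x' y' z' u v w = sum2 (comult H y') (\<lambda>y1 y2.
      F (x' * (u * a)) (x * (y1 * (v * b))) (y * (y2 * (w * c))) (z * (z' * d)))"
      for x y z x' y' z' u v w
    have "oB (reassoc H) (oA (reassoc H) F) a b c d =
      ?sum (\<lambda>x' y' z'. ?sum (\<lambda>x y z. K x y z x' y' z'))"
      by (simp add: oA_def oB_def K_def sum2_sum3)
    also have "\<dots> = ?sum (\<lambda>x y z. ?sum (\<lambda>x' y' z'. K x y z x' y' z'))"
      by (rule sum3_sum3)
    also have "\<dots> = ?sum (\<lambda>x y z. ?sum (\<lambda>x' y' z'. ?sum (\<lambda>u v w. K' x y z x' y' z' u v w)))"
      unfolding K_def K'_def by (subst sum2_sum2)
        (use pentagon'[OF m] in \<open>simp add: sum2_sum3 mult.assoc\<close>)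
    also have "\<dots> = ?sum (\<lambda>x' y' z'. ?sum (\<lambda>x y z. ?sum (\<lambda>u v w. K' x y z x' y' z' u v w)))"
      by (rule sum3_sum3)
    also have "\<dots> = ?sum (\<lambda>x' y' z'. ?sum (\<lambda>u v w. ?sum (\<lambda>x y z. K' x y z x' y' z' u v w)))"
      by (rule arg_cong[where f = "sum3 (reassoc H)"], rule ext, rule ext, rule ext, rule sum3_sum3)
    also have "\<dots> = ?sum (\<lambda>u v w. ?sum (\<lambda>x' y' z'. ?sum (\<lambda>x y z. K' x y z x' y' z' u v w)))"
      by (rule sum3_sum3)
    also have "\<dots> = oE (reassoc H) (oD (reassoc H) (oC (reassoc H) F)) a b c d"
      by (simp add: oC_def oD_def oE_def K'_def sum2_sum3)
    finally show ?thesis .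
  qed
qed

text \<open>With all five factors invertible as operators, the inverse pentagon is plain
  cancellation instead of a computation in the fourfold tensor power.\<close>

lemma o_pentagon_inv:
  assumes F: "mlin4 (scal H) (*) F"
  shows "oA phinv (oB phinv F) = oC phinv (oD phinv (oE phinv F))"
proof -
  let ?G = "oC phinv (oD phinv (oE phinv F))"
  note i = o_inverse[OF _ phinv_mult(1)] o_inverse[OF _ phinv_mult(2)]
  have m: "mlin4 (scal H) (*) (oE phinv F)" "mlin4 (scal H) (*) (oD phinv (oE phinv F))"
    "mlin4 (scal H) (*) ?G"
    "mlin4 (scal H) (*) (oA (reassoc H) ?G)"
    by (intro o_mlin F)+
  have "oB (reassoc H) (oA (reassoc H) ?G) = F"
    by (simp add: o_pentagon[OF m(3)] i[OF m(2)] i[OF m(1)] i[OF F])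
  then have "oA phinv (oB phinv F) = oA phinv (oB phinv (oB (reassoc H) (oA (reassoc H) ?G)))"
    by simp
  then show ?thesis by (simp add: i[OF m(4)] i[OF m(3)])
qed

lemma pentagon_inv':
  assumes F: "mlin4 (scal H) (*) F"
  shows "sum3 phinv (\<lambda>x y z. sum2 (comult H z)
    (\<lambda>z1 z2. sum3 phinv (\<lambda>x' y' z'. sum2 (comult H x') (\<lambda>x1 x2.
            F (x1 * x) (x2 * y) (y' * z1) (z' * z2))))) =
          sum3 phinv (\<lambda>x y z. sum3 phinv (\<lambda>x' y' z'. sum2 (comult H y') (\<lambda>y1 y2. sum3 phinv (\<lambda>u v w.
            F (u * x') (v * (y1 * x)) (w * (y2 * y)) (z' * z)))))"
  using fun_cong[OF fun_cong[OF fun_cong[OF fun_cong[OF o_pentagon_inv[OF F], of 1], of 1], of 1],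
    of 1]
  by (simp add: o_defs)

lemma bij_antipode: "antipode H (antipode_inv H a) = a" "antipode_inv H (antipode H a) = a"
  using antipode_bij by (simp_all add: antipode_inv_def bij_is_surj surj_f_inv_f bij_is_inj)

lemma klin_iff_linear: "Vector_Spaces.linear (scal H) (*) f \<longleftrightarrow> klin (scal H) (*) f"
  "Vector_Spaces.linear (scal H) (scal H) g \<longleftrightarrow> klin (scal H) (scal H) g"
  using vector_space_axioms vector_space_mult by (auto simp: Vector_Spaces.linear_iff klin_def)

lemma qh_axioms_H:
  assumes B: "finite_dimensional_vector_space (scal H) B" "1 \<in> B"
  shows "qh (scal H) (*) 1 B (comult H) (counit H) (reassoc H) phinv (antipode H) (antipode_inv H)
    (alpha_elt H) (beta_elt H)"
proof -
  interpret FB: finite_dimensional_vector_space "scal H" B by (rule B(1))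
  have S: "klin (scal H) (scal H) (antipode H)" using antipode_linear by (simp add: klin_iff_linear)
  have T: "klin (scal H) (scal H) (antipode_inv H)"
    unfolding klin_def using klin_add[OF S] klin_scale[OF S] bij_antipode by metis
  have ep: "klin (scal H) (*) (counit H)" using counit_linear by (simp add: klin_iff_linear)
  have ep_ph: "sum3 (reassoc H) (\<lambda>x y z. counit H y * F x z) = F 1 1" if F: "mlin2 (scal H) (*) F"
    for F
    using counit_reassoc F by (auto simp: tensor_eq2_iff sum2_comprehension mlin2D[OF F])
  have ep_pi: "sum3 phinv (\<lambda>x y z. counit H y * F x z) = F 1 1" if F: "mlin2 (scal H) (*) F" for F
  proof -
    have m2: "mlin2 (scal H) (*) (\<lambda>u v. counit H y * F (u * x) (v * z))" for x y z
      by (simp add: Hlin mlin2D[OF F] mult.left_commute)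
    have m3: "mlin3 (scal H) (*) (\<lambda>x y z. counit H y * F x z)"
      by (simp add: Hlin mlin2D[OF F] mult.left_commute klin_add[OF ep] klin_scale[OF ep])
    \<comment> \<open>A copy of \<phi> with the counit in its middle factor is inserted for free;
      multiplicativity of the counit then merges it with the inverse.\<close>
    have "sum3 phinv (\<lambda>x y z. counit H y * F x z) =
      sum3 phinv (\<lambda>x y z. sum3 (reassoc H)
        (\<lambda>x' y' z'. counit H y' * (counit H y * F (x' * x) (z' * z))))"
      by (simp add: ep_ph[OF m2])
    also have "\<dots> = F 1 1"
      using phinv_mult(1)[OF m3] by (simp add: counit_mult counit_one mult.assoc
        sum3_sum3[of "reassoc H" phinv])
    finally show ?thesis .
  qed
  show ?thesis
    apply unfold_locales
    apply (simp_all add: A.mul_assoc distrib_left distrib_right scale_mult_left[symmetric]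
      scale_mult_right[symmetric]
        B(2) comult_klin comult_one' ep counit_mult counit_one S T antipode_mult antipode_one
          bij_antipode
        ep_ph ep_pi counit_alpha counit_beta)
    subgoal by (rule comult_mult')
    subgoal by (rule phinv_mult)
    subgoal by (rule phinv_mult)
    subgoal by (rule coassoc')
    subgoal by (rule coassoc_inv')
    subgoal using pentagon' by (simp add: mult.assoc)
    subgoal using pentagon_inv' by (simp add: mult.assoc)
    subgoal using counit_left by (simp add: sum2_def)
    subgoal using counit_right by (simp add: sum2_def)
    subgoal by (metis antipode_mult bij_antipode)
    subgoal by (metis antipode_one bij_antipode)
    subgoal using antipode_left by (simp add: sum2_def mult.assoc)
    subgoal using antipode_right by (simp add: sum2_def mult.assoc)
    subgoal using antipode_reassoc by (simp add: sum3_def mult.assoc)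
    subgoal using antipode_reassoc_inv by (simp add: sum3_def mult.assoc phinv_def)
    done
qed

end

section \<open>One-sided inverses in the tensor square\<close>

text \<open>Formulated for a subspace inside the span of a finite set, since it serves for bilinear
  forms within the space of all functions. A missed vector together with the image of a basis would
  be independent and too large.\<close>

lemma (in vector_space) injective_endo_surj:
  assumes f: "klin scale scale f" and W: "subspace W" "W \<subseteq> span D" "finite D" "f ` W \<subseteq> W"
    "inj_on f W"
  shows "f ` W = W"
proof (rule antisym[OF W(4)], rule subsetI, rule ccontr)
  interpret P: vector_space_pair scale scale ..
  have lin: "Vector_Spaces.linear scale scale f"
    using f vector_space_axioms by (simp add: Vector_Spaces.linear_iff klin_def)
  fix F assume F: "F \<in> W" "F \<notin> f ` W"
  obtain A where A: "A \<subseteq> W" "independent A" "W \<subseteq> span A"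
    using basis_exists[of W] by metis
  have fin: "finite A" using independent_span_bound[OF W(3) A(2)] A(1) W(2) by blast
  have sp: "span A = W" using A(1,3) W(1) span_minimal by blast
  have ind: "independent (f ` A)"
    using P.linear_independent_injective_image[OF lin A(2)] W(5) sp by simp
  have "span (f ` A) = f ` W" using P.linear_span_image[OF lin, of A] sp by simp
  with F have nF: "F \<notin> span (f ` A)" by simp
  then have "independent (insert F (f ` A))" using ind by (simp add: independent_insertI)
  moreover have "insert F (f ` A) \<subseteq> span A" using F(1) A(1) W(4) sp by auto
  ultimately have "card (insert F (f ` A)) \<le> card A" using independent_span_bound[OF fin] by blast
  moreover have "F \<notin> f ` A" using nF span_base by blast
  moreover have "card (f ` A) = card A" using W(5) A(1) by (intro card_image) (rule inj_on_subset)
  ultimately show False using fin by simp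
qed

lemma sum_fun_eval: "(\<Sum>i\<in>I. F i) x = (\<Sum>i\<in>I. F i x)"
  by (induction I rule: infinite_finite_induct) auto

locale fd_quasi_hopf = quasi_hopf_algebra H + FD: finite_dimensional_vector_space "scal H" B
  for H :: "('k::field, 'a::ring_1) quasi_hopf_data" and B :: "'a set" +
  assumes one_in_B: "1 \<in> B"
begin

abbreviation "S \<equiv> antipode H"
abbreviation "T \<equiv> antipode_inv H"
abbreviation "al \<equiv> alpha_elt H"
abbreviation "be \<equiv> beta_elt H"
abbreviation "sc \<equiv> scal H"

sublocale Q: qh sc "(*)" 1 B "comult H" "counit H" "reassoc H" phinv S T al be
  by (rule qh_axioms_H[OF FD.finite_dimensional_vector_space_axioms one_in_B])

definition p_list :: "('a \<times> 'a) list" where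
  "p_list = map (\<lambda>(x, y, z). (x, y * (be * S z))) phinv"

definition U_list :: "('a \<times> 'a) list" where
  "U_list = concat (map (\<lambda>(x, y, z). tmul2 (comult H (S x * (al * y))) (tmul2 p_list [(1, S z)]))
    phinv)"

text \<open>A representative of the right inverse of f found in
  \<open>Dr_right_inverse\<close>.\<close>

definition g_list :: "('a \<times> 'a) list" where
  "g_list = concat (map (\<lambda>(x, y, z). tmul2 (comult H (S x)) (tmul2 U_list [(y * (be * S z), 1)]))
    phinv)"

text \<open>Multiplication by \<open>t\<close> acts on the finite dimensional space of bilinear
  forms, with \<open>L u\<close> as a left inverse of \<open>L t\<close>. So \<open>L t\<close> is
  bijective and \<open>L u\<close> inverts it from the other side too.\<close>

lemma is_inverse2_if_right_inverse:
  assumes "tensor_eq2 H (tmul2 t u) [(1, 1)]"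
  shows "is_inverse2 H t u"
proof -
  interpret F: vector_space "fscale :: 'k \<Rightarrow> ('a \<times> 'a \<Rightarrow> 'k) \<Rightarrow> 'a \<times> 'a \<Rightarrow> 'k"
    by (rule vector_space_fscale)
  define W where "W = {F :: 'a \<times> 'a \<Rightarrow> 'k. mlin2 sc (*) (\<lambda>a b. F (a, b))}"
  define L where "L t F = (\<lambda>(a, b). sum2 t (\<lambda>x y. F (x * a, y * b)))" for t and F :: "'a \<times> 'a \<Rightarrow> 'k"
  have WD: "F (a + b, y) = F (a, y) + F (b, y)" "F (y, a + b) = F (y, a) + F (y, b)"
    "F (sc c a, y) = c * F (a, y)" "F (y, sc c a) = c * F (y, a)" if "F \<in> W" for F a b c y
    using that unfolding W_def mlin2_def klin_def by blast+
  have mW: "mlin2 sc (*) (\<lambda>x y. F (x * a, y * b))" if F: "F \<in> W" for F a b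
    by (simp add: mlin2_def klin_def WD[OF F] distrib_right scale_mult_left[symmetric])
  have LW: "L t F \<in> W" if F: "F \<in> W" for t F
    by (simp add: W_def L_def mlin2_def klin_def WD[OF F] distrib_left scale_mult_right[symmetric]
      sum2_add
        sum2_hom[of "\<lambda>t. _ * t", OF distrib_left mult_zero_right])
  have Lu: "L u (L t F) = F" if F: "F \<in> W" for F
  proof (rule ext, clarify)
    fix a b
    have "L u (L t F) (a, b) = sum2 (tmul2 t u) (\<lambda>x y. F (x * a, y * b))"
      by (simp add: L_def sum_tmul mult.assoc sum2_sum2[of u t])
    then show "L u (L t F) (a, b) = F (a, b)"
      using assms mW[OF F] by (simp add: tensor_eq2_iff)
  qed
  have lin: "klin fscale fscale (L t)"
    by (simp add: klin_def L_def fscale_def fun_eq_iff sum2_add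
      sum2_hom[of "\<lambda>t. _ * t", OF distrib_left mult_zero_right])
  have sub: "F.subspace W"
    unfolding F.subspace_def
    by (auto simp: W_def mlin2_def klin_def fscale_def distrib_left mult.left_commute)
  \<comment> \<open>Products of two coordinate functionals; finitely many of them span the bilinear
    forms.\<close>
  define \<delta> :: "'a \<times> 'a \<Rightarrow> 'a \<times> 'a \<Rightarrow> 'k" where
    "\<delta> = (\<lambda>p v. representation B (fst v) (fst p) * representation B (snd v) (snd p))"
  define D where "D = \<delta> ` (B \<times> B)"
  have "W \<subseteq> F.span D"
  proof
    fix F assume F: "F \<in> W"
    have k: "klin sc (*) (\<lambda>x. F (x, y))" "klin sc (*) (\<lambda>x. F (y, x))" for y
      by (simp_all add: klin_def WD[OF F])
    have "F = (\<Sum>p\<in>B \<times> B. fscale (F p) (\<delta> p))"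
    proof (rule ext)
      fix v :: "'a \<times> 'a"
      have "F v = (\<Sum>b\<in>B. representation B (fst v) b *
        (\<Sum>c\<in>B. representation B (snd v) c * F (b, c)))"
      proof -
        have "F v = F (fst v, snd v)" by simp
        also have "\<dots> = (\<Sum>b\<in>B. representation B (fst v) b * F (b, snd v))"
          by (rule Q.klin_rep[OF k(1)])
        also have "\<dots> = (\<Sum>b\<in>B. representation
          B (fst v) b * (\<Sum>c\<in>B. representation B (snd v) c * F (b, c)))"
          by (intro sum.cong refl arg_cong[where f = "\<lambda>t. _ * t"]) (rule Q.klin_rep[OF k(2)])
        finally show ?thesis .
      qed
      also have "\<dots> = (\<Sum>b\<in>B. \<Sum>c\<in>B. fscale (F (b, c)) (\<delta> (b, c)) v)"
        unfolding sum_distrib_left by (intro sum.cong refl) (simp add: fscale_def \<delta>_def)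
      also have "\<dots> = (\<Sum>p\<in>B \<times> B. fscale (F p) (\<delta> p) v)"
        by (simp add: sum.cartesian_product case_prod_unfold)
      also have "\<dots> = (\<Sum>p\<in>B \<times> B. fscale (F p) (\<delta> p)) v"
        by (simp only: sum_fun_eval)
      finally show "F v = (\<Sum>p\<in>B \<times> B. fscale (F p) (\<delta> p)) v" .
    qed
    moreover have "(\<Sum>p\<in>B \<times> B. fscale (F p) (\<delta> p)) \<in> F.span D"
      unfolding D_def by (intro F.span_sum F.span_scale F.span_base imageI)
    ultimately show "F \<in> F.span D" by simp
  qed
  moreover have "finite D" by (simp add: D_def FD.finite_Basis)
  moreover have "inj_on (L t) W" by (rule inj_on_inverseI) (rule Lu)
  ultimately have surj: "L t ` W = W"
    using LW by (intro F.injective_endo_surj[OF lin sub]) auto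
  have "tensor_eq2 H (tmul2 u t) [(1, 1)]"
    unfolding tensor_eq2_iff
  proof safe
    fix F assume F: "mlin2 sc (*) F"
    let ?F = "\<lambda>(a, b). F a b"
    have "?F \<in> W" using F by (simp add: W_def)
    then obtain G where G: "G \<in> W" "?F = L t G" using surj by blast
    have "sum2 (tmul2 u t) F = L t (L u ?F) (1, 1)"
      by (simp add: L_def sum_tmul mult.assoc sum2_sum2[of u t])
    also have "\<dots> = L t G (1, 1)" using Lu[OF G(1)] G(2) by simp
    also have "\<dots> = F 1 1" using G(2) by (metis case_prod_conv)
    finally show "sum2 (tmul2 u t) F = sum2 [(1, 1)] F" by simp
  qed
  with assms show ?thesis by (simp add: is_inverse2_def)
qed

end

section \<open>Evaluating the special elements\<close>

locale fdqh_rep = fd_quasi_hopf H B + R: kalg sr mr o1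
  for H :: "('k::field, 'a::ring_1) quasi_hopf_data" and B :: "'a set"
    and sr :: "'k \<Rightarrow> 'r::ab_group_add \<Rightarrow> 'r" and mr :: "'r \<Rightarrow> 'r \<Rightarrow> 'r" (infixl "\<star>" 70)
    and o1 :: 'r
begin

sublocale R: qh_rep sc "(*)" 1 B "comult H" "counit H" "reassoc H" phinv S T al be sr mr o1
  using Q.qh_axioms R.kalg_axioms by (simp add: qh_rep_def)

definition ev :: "('a \<Rightarrow> 'r) \<Rightarrow> ('a \<Rightarrow> 'r) \<Rightarrow> ('a \<times> 'a) list \<Rightarrow> 'r" where
  "ev f g ts = sum2 ts (\<lambda>x y. f x \<star> g y)"

lemma ev_tmul2:
  assumes l: "R.legs2 f g" shows "ev f g (tmul2 t u) = ev f g t \<star> ev f g u"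
proof -
  note d = R.legs2D[OF l]
  show ?thesis
    unfolding ev_def sum_tmul R.mul_sum_left
    unfolding R.mul_sum_right
    by (simp add: R.ahom_mult[OF d(1)] R.ahom_mult[OF d(2)] R.mul_assoc R.cms2[OF d(3)])
qed

lemma ev_comult: "ev f g (comult H a) = R.cop f g a"
  by (simp add: ev_def R.cop_def)

lemma ev_concat: "ev f g (concat (map (\<lambda>(x, y, z). L x y z) us)) =
  sum3 us (\<lambda>x y z. ev f g (L x y z))"
  for us :: "('a \<times> 'a \<times> 'a) list"
  by (simp add: ev_def sum_comprehension)

lemma ev_single: "ev f g [(a, b)] = f a \<star> g b"
  by (simp add: ev_def)

lemma ev_tensor_eq2:
  assumes l: "R.legs2 f g" and t: "tensor_eq2 H t u"
  shows "ev f g t = ev f g u"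
  unfolding ev_def
proof (rule R.klin_separates)
  fix k assume k: "klin sr (*) k"
  note d = R.legs2D[OF l]
  have "mlin2 sc (*) (\<lambda>x y. k (f x \<star> g y))"
    by (rule mlin2_comp[OF R.mlin2_legs[OF d(1,2)] k])
  with t show "k (sum2 t (\<lambda>x y. f x \<star> g y)) = k (sum2 u (\<lambda>x y. f x \<star> g y))"
    by (simp add: klin_sum2[OF k] tensor_eq2_iff)
qed

lemma ev_p_list: "ev f g p_list = R.pR f g"
  by (simp add: ev_def p_list_def R.pR_def sum_comprehension)

lemma ev_U_list:
  assumes l: "R.legs2 f g" shows "ev f g U_list = R.Uel f g"
  by (simp add: U_list_def ev_concat ev_tmul2[OF l] ev_comult ev_p_list ev_single R.Uel_def
      R.ahom_one[OF R.legs2D(1)[OF l]])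

lemma ev_g_list:
  assumes l: "R.legs2 f g"
  shows "ev f g g_list = sum3 phinv (\<lambda>x y z. R.cop f g (S x) \<star> (R.Uel f g \<star> f (y * (be * S z))))"
  by (simp add: g_list_def ev_concat ev_tmul2[OF l] ev_comult ev_U_list[OF l] ev_single
      R.ahom_one[OF R.legs2D(2)[OF l]])

lemma ev_drinfeld:
  assumes l: "R.legs2 f g" shows "ev f g (drinfeld_f H) = R.Dr f g"
proof -
  have 1: "ev f g [(S x2, S x1). (x1, x2) \<leftarrow> comult H x] = R.sD f g x" for x
    by (simp add: ev_def R.sD_def sum_comprehension)
  have 2: "ev f g (gamma_elt H) = R.gam f g"
    by (simp add: ev_def R.gam_def gamma_elt_def TUVW_def sum_comprehension sum_tmul
      phinv_def[symmetric] mult.assoc)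
  show ?thesis
    unfolding drinfeld_f_def
    by (simp add: ev_concat ev_tmul2[OF l] 1 2 ev_comult R.Dr_def phinv_def[symmetric] R.mul_assoc
      mult.assoc)
qed

end

context fd_quasi_hopf
begin

lemma fdqh_rep_lop: "fdqh_rep H B lop_scale (lop_mul :: (nat \<Rightarrow> 'a, 'k) lop \<Rightarrow> _) lop_one"
  using fd_quasi_hopf_axioms kalg_lop by (simp add: fdqh_rep_def)

interpretation E: fdqh_rep H B lop_scale "lop_mul :: (nat \<Rightarrow> 'a, 'k) lop \<Rightarrow> _" lop_one
  by (rule fdqh_rep_lop)

lemma leg_legs2: "n \<noteq> k \<Longrightarrow> E.R.legs2 (Q.leg n) (Q.leg k)"
  using Q.leg_ahom Q.leg_cms by (simp add: E.R.legs2_def)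

lemma leg_legs3: "E.R.legs3 (Q.leg 0) (Q.leg 1) (Q.leg 2)"
  by (simp add: E.R.legs3_def leg_legs2)

lemma sum2_ev:
  assumes "klin lop_scale (*) L" "\<And>a b. L (lop_mul (Q.leg 0 a) (Q.leg 1 b)) = F a b"
  shows "sum2 ts F = L (E.ev (Q.leg 0) (Q.leg 1) ts)"
  by (simp add: E.ev_def klin_sum2[OF assms(1)] assms(2)[unfolded One_nat_def])

text \<open>Only now does the choice in \<open>tinv2\<close> yield an actual inverse of f, and with
  it the definition of U acquires its meaning.\<close>

lemma drinfeld_invertible: "is_inverse2 H (drinfeld_f H) (tinv2 H (drinfeld_f H))"
proof -
  have "tensor_eq2 H (tmul2 (drinfeld_f H) g_list) [(1, 1)]"
    unfolding tensor_eq2_iff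
  proof safe
    fix F assume F: "mlin2 sc (*) F"
    obtain L where L: "klin lop_scale (*) L" "\<And>a b. L (lop_mul (Q.leg 0 a) (Q.leg 1 b)) = F a b"
      using Q.legs_separate2[OF F] by blast
    have l: "E.R.legs2 (Q.leg 0) (Q.leg 1)" by (rule leg_legs2) simp
    have "sum2 (tmul2 (drinfeld_f H) g_list) F = L lop_one"
      unfolding sum2_ev[OF L] E.ev_tmul2[OF l] E.ev_drinfeld[OF l] E.ev_g_list[OF l]
        E.R.Dr_right_inverse[OF l] ..
    also have "\<dots> = F 1 1" using L(2)[of 1 1] by (simp add: Q.leg_one)
    finally show "sum2 (tmul2 (drinfeld_f H) g_list) F = sum2 [(1, 1)] F" by simp
  qed
  from is_inverse2_if_right_inverse[OF this] show ?thesis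
    unfolding tinv2_def by (rule someI)
qed

end

context fdqh_rep
begin

interpretation O: fdqh_rep H B sr "\<lambda>a b. b \<star> a" o1
  using fd_quasi_hopf_axioms R.kalg_op by (simp add: fdqh_rep_def)

text \<open>By \<open>Dr_Uel\<close> the prescribed U is the inverse of f times f times
  \<open>Uel\<close>.\<close>

lemma ev_U_elt:
  assumes l: "R.legs2 f g" shows "ev f g (U_elt H) = R.Uel f g"
proof -
  have "ev f g [(S y, S x). (x, y) \<leftarrow> q_R H] = R.sq f g"
    by (simp add: ev_def R.sq_def q_R_def sum_comprehension Q.S_mult mult.assoc del: map_map)
  then have "ev f g (U_elt H) = ev f g (tinv2 H (drinfeld_f H)) \<star>
    (ev f g (drinfeld_f H) \<star> R.Uel f g)"
    unfolding U_elt_def ev_tmul2[OF l] ev_drinfeld[OF l] R.Dr_Uel[OF l] by simp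
  also have "\<dots> = ev f g (tmul2 (tinv2 H (drinfeld_f H)) (drinfeld_f H)) \<star> R.Uel f g"
    unfolding ev_tmul2[OF l] R.mul_assoc ..
  also have "\<dots> = R.Uel f g"
    using ev_tensor_eq2[OF l, of "tmul2 (tinv2 H (drinfeld_f H)) (drinfeld_f H)" "[(1, 1)]"]
      drinfeld_invertible
    by (simp add: is_inverse2_def ev_single R.ahom_one[OF R.legs2D(1)[OF l]]
      R.ahom_one[OF R.legs2D(2)[OF l]])
  finally show ?thesis .
qed

lemma ev_V_elt:
  assumes l: "R.legs2 f g" shows "ev f g (V_elt H) = R.Vel f g"
proof -
  note d = R.legs2D[OF l]
  let ?F = "\<lambda>a. g (T a)" and ?G = "\<lambda>a. f (T a)"
  have L: "O.R.legs2 ?F ?G"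
    using d(3) by (auto simp: O.R.legs2_def O.R.ahom_def O.R.cms_def R.cms_def R.lin_all Q.T_mult
      Q.T_one
        d(1,2)[THEN R.ahom_add] d(1,2)[THEN R.ahom_scale] d(1,2)[THEN R.ahom_mult]
          d(1,2)[THEN R.ahom_one])
  have h: "ev f g (h_elt H) = O.R.Dr ?F ?G"
    unfolding O.ev_drinfeld[OF L, symmetric]
    by (simp add: ev_def O.ev_def h_elt_def sum_comprehension del: map_map)
  have p: "ev f g [(T y, T x). (x, y) \<leftarrow> p_R H] = O.R.pR ?F ?G"
    by (simp add: ev_def O.R.pR_def p_R_def sum_comprehension phinv_def[symmetric] mult.assoc
      del: map_map)
  show ?thesis
    unfolding V_elt_def ev_tmul2[OF l] h p R.Vel_eq[OF l] ..
qed

lemma ev_comult_bar: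
  assumes l: "R.legs2 f g"
  shows "ev f g (comult_bar H a) = R.Vel f g \<star> (R.cop f g a \<star> R.Uel f g)"
  by (simp add: comult_bar_def ev_tmul2[OF l] ev_V_elt[OF l] ev_U_elt[OF l] ev_comult R.mul_assoc)

lemma ev_comult_bar_add:
  assumes l: "R.legs2 f g"
  shows "ev f g (comult_bar H (a + b)) = ev f g (comult_bar H a) + ev f g (comult_bar H b)"
    "ev f g (comult_bar H (sc c a)) = sr c (ev f g (comult_bar H a))"
  by (simp_all add: ev_comult_bar[OF l] R.ahom_add[OF R.legs2D(4)[OF l]]
    R.ahom_scale[OF R.legs2D(4)[OF l]]
      R.mul_add_left R.mul_add_right R.mul_scl_left R.mul_scl_right)

end

section \<open>Properties of the deformed coproduct\<close>

context fd_quasi_hopf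
begin

interpretation E: fdqh_rep H B lop_scale "lop_mul :: (nat \<Rightarrow> 'a, 'k) lop \<Rightarrow> _" lop_one
  by (rule fdqh_rep_lop)

lemma cb_klin0:
  assumes F: "mlin2 sc (*) F" shows "klin sc (*) (\<lambda>a. sum2 (comult_bar H a) F)"
proof -
  obtain L where L: "klin lop_scale (*) L" "\<And>a b. L (lop_mul (Q.leg 0 a) (Q.leg 1 b)) = F a b"
    using Q.legs_separate2[OF F] by blast
  have l: "E.R.legs2 (Q.leg 0) (Q.leg 1)" by (rule leg_legs2) simp
  show ?thesis
    unfolding sum2_ev[OF L] by (simp add: klin_def E.ev_comult_bar_add[OF l] klin_add[OF L(1)]
      klin_scale[OF L(1)] del: One_nat_def)
qed

lemma cb_right0:
  assumes F: "mlin2 sc (*) F"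
  shows "sum2 (comult_bar H x) (\<lambda>y z. F y (z * S a)) =
    sum2 (comult H a) (\<lambda>a1 a2. sum2 (comult_bar H (x * S a1)) (\<lambda>y z. F (y * a2) z))"
proof -
  obtain L where L: "klin lop_scale (*) L" "\<And>a b. L (lop_mul (Q.leg 0 a) (Q.leg 1 b)) = F a b"
    using Q.legs_separate2[OF F] by blast
  let ?f = "Q.leg 0" and ?g = "Q.leg 1"
  have l: "E.R.legs2 ?f ?g" by (rule leg_legs2) simp
  note d = E.R.legs2D[OF l]
  have 1: "sum2 ts (\<lambda>y z. F y (z * w)) = L (lop_mul (E.ev ?f ?g ts) (?g w))" for ts w
    by (simp add: E.ev_def E.R.mul_sum_left klin_sum2[OF L(1)] L(2)[symmetric]
      E.R.ahom_mult[OF d(2)] E.R.mul_assoc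
        del: One_nat_def)
  have 2: "sum2 ts (\<lambda>y z. F (y * w) z) = L (lop_mul (E.ev ?f ?g ts) (?f w))" for ts w
    by (simp add: E.ev_def E.R.mul_sum_left klin_sum2[OF L(1)] L(2)[symmetric]
      E.R.ahom_mult[OF d(1)] E.R.mul_assoc
        E.R.cms1[OF d(3)] del: One_nat_def)
  show ?thesis
    unfolding 1 2 E.ev_comult_bar[OF l] E.R.mul_assoc E.R.Uel_twine[OF l, symmetric]
    by (simp add: E.R.mul_sum_right klin_sum2[OF L(1)] E.R.ahom_mult[OF d(4)] E.R.mul_assoc
      del: One_nat_def)
qed

lemma cb_left0:
  assumes F: "mlin2 sc (*) F"
  shows "sum2 (comult_bar H x) (\<lambda>y z. F y (T a * z)) =
    sum2 (comult H a) (\<lambda>a1 a2. sum2 (comult_bar H (T a1 * x)) (\<lambda>y z. F (a2 * y) z))"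
proof -
  obtain L where L: "klin lop_scale (*) L" "\<And>a b. L (lop_mul (Q.leg 0 a) (Q.leg 1 b)) = F a b"
    using Q.legs_separate2[OF F] by blast
  let ?f = "Q.leg 0" and ?g = "Q.leg 1"
  have l: "E.R.legs2 ?f ?g" by (rule leg_legs2) simp
  note d = E.R.legs2D[OF l]
  have 1: "sum2 ts (\<lambda>y z. F y (w * z)) = L (lop_mul (?g w) (E.ev ?f ?g ts))" for ts w
    by (simp add: E.ev_def E.R.mul_sum_right klin_sum2[OF L(1)] L(2)[symmetric]
      E.R.ahom_mult[OF d(2)] E.R.mul_assoc
        E.R.cms2[OF d(3)] del: One_nat_def)
  have 2: "sum2 ts (\<lambda>y z. F (w * y) z) = L (lop_mul (?f w) (E.ev ?f ?g ts))" for ts w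
    by (simp add: E.ev_def E.R.mul_sum_right klin_sum2[OF L(1)] L(2)[symmetric]
      E.R.ahom_mult[OF d(1)] E.R.mul_assoc
        del: One_nat_def)
  show ?thesis
    unfolding 1 2 E.ev_comult_bar[OF l] E.R.mul_assoc[symmetric] E.R.Vel_twine[OF l, symmetric]
    by (simp add: E.R.mul_sum_left klin_sum2[OF L(1)] E.R.ahom_mult[OF d(4)] E.R.mul_assoc
      del: One_nat_def)
qed

lemma cb_counit0:
  assumes F: "klin sc (*) F"
  shows "sum2 (comult_bar H x) (\<lambda>y z. counit H y * F z) = F x"
proof -
  have F2: "mlin2 sc (*) (\<lambda>y z. F y * counit H z)"
    by (simp add: mlin2_def klin_def klin_add[OF F] klin_scale[OF F] klin_add[OF Q.ep_klin]
      klin_scale[OF Q.ep_klin]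
        algebra_simps)
  obtain L where L: "klin lop_scale (*) L"
    "\<And>a b. L (lop_mul (Q.leg 0 a) (Q.leg 1 b)) = F a * counit H b"
    using Q.legs_separate2[OF F2] by blast
  let ?f = "Q.leg 0"
  have a: "E.R.ahom ?f" by (rule Q.leg_ahom)
  have l: "E.R.legs2 E.R.el ?f" using a by (simp add: E.R.legs2_def E.R.el_ahom E.R.el_cms)
  have Lf: "L (?f y) = F y" for y using L(2)[of y 1] by (simp add: Q.leg_one Q.ep_one)
  have "E.ev E.R.el ?f (comult_bar H x) = ?f x"
    by (simp add: E.ev_comult_bar[OF l] E.R.Vel_counit[OF a] E.R.Uel_counit[OF a]
      E.R.cop_el_left[OF a])
  then have "L (E.ev E.R.el ?f (comult_bar H x)) = F x" by (simp add: Lf)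
  then show ?thesis by (simp add: E.ev_def klin_sum2[OF L(1)] klin_scale[OF L(1)] Lf)
qed

text \<open>The V-factors and the U-factors of the iterated coproduct are rewritten separately. The
  former supply a \<open>Pi\<close>, which carries the inner coproduct to the other bracketing and
  then starts the identity for the U-factors.\<close>

lemma cb_coassoc0:
  assumes F: "mlin3 sc (*) F"
  shows "sum2 (comult_bar H x) (\<lambda>y z. sum2 (comult_bar H z) (\<lambda>u v. F y u v)) =
    sum3 phinv (\<lambda>p q r. sum3 (reassoc H) (\<lambda>X Y Z. sum2 (comult_bar H (T p * (x * S X))) (\<lambda>y z.
      sum2 (comult H y) (\<lambda>y1 y2. F (q * (y1 * Y)) (r * (y2 * Z)) z))))"
proof -
  obtain L where L: "klin lop_scale (*) L"
    "\<And>a b c. L (lop_mul (Q.leg 0 a) (lop_mul (Q.leg 1 b) (Q.leg 2 c))) = F a b c"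
    using Q.legs_separate3[OF F] by blast
  let ?f = "Q.leg 0" and ?g = "Q.leg 1" and ?h = "Q.leg 2"
  note l = leg_legs3
  note d = E.R.legs3D[OF l]
  let ?E = "E.R.cop ?g ?h" and ?C = "E.R.cop ?f ?g"
  let ?D = "E.R.cop ?C ?h" and ?D' = "E.R.cop ?f ?E"
  have aD: "E.R.ahom ?D" "E.R.ahom ?E" "E.R.ahom ?C" using d(5,3,1) by (auto dest: E.R.legs2D(4))
  have cE: "E.R.cms ?f ?E" "E.R.cms ?C ?h" using d(4,5) by (auto dest: E.R.legs2D(3))
  have "sum2 (comult_bar H x) (\<lambda>y z. sum2 (comult_bar H z) (\<lambda>u v. F y u v)) =
      L (sum2 (comult_bar H x) (\<lambda>y z. lop_mul (?f y) (E.ev ?g ?h (comult_bar H z))))"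
    by (simp add: klin_sum2[OF L(1)] E.ev_def E.R.mul_sum_right L(2)[symmetric] del: One_nat_def)
  \<comment> \<open>The inner V lives on the legs \<open>g\<close> and \<open>h\<close> and commutes
    with \<open>f\<close>, so it can be pulled to the front.\<close>
  also have "sum2 (comult_bar H x) (\<lambda>y z. lop_mul (?f y) (E.ev ?g ?h (comult_bar H z))) =
      lop_mul (E.R.Vel ?g ?h) (lop_mul (E.ev ?f ?E (comult_bar H x)) (E.R.Uel ?g ?h))"
  proof -
    have "lop_mul (?f y) (lop_mul (E.R.Vel ?g ?h) r) = lop_mul (E.R.Vel ?g ?h) (lop_mul (?f y) r)"
      for y r
    proof -
      have "E.R.cms ?f (\<lambda>_. E.R.Vel ?g ?h)"
        unfolding E.R.cms_def E.ev_V_elt[OF d(3), symmetric]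
        by (simp add: E.ev_def E.R.mul_sum E.R.mul_assoc E.R.cms2[OF d(12)] E.R.cms1[OF d(13)]
          del: One_nat_def)
      then show ?thesis by (rule E.R.cms4)
    qed
    then show ?thesis
      unfolding E.ev_comult_bar[OF d(3)]
      by (simp add: E.ev_def E.R.mul_sum E.R.mul_assoc del: One_nat_def)
  qed
  also have "\<dots> = lop_mul (lop_mul (E.R.Vel ?g ?h) (E.R.Vel ?f ?E))
    (lop_mul (?D' x) (lop_mul (E.R.Uel ?f ?E) (E.R.Uel ?g ?h)))"
    by (simp add: E.ev_comult_bar[OF d(4)] E.R.mul_assoc del: One_nat_def)
  also have "\<dots> = sum3 phinv (\<lambda>p q r. lop_mul (?f q)
    (lop_mul (?g r) (lop_mul (E.R.Vel ?C ?h) (lop_mul (?D (T p)) (lop_mul (?D x)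
      (lop_mul (E.R.Pi ?f ?g ?h) (lop_mul (E.R.Uel ?f ?E) (E.R.Uel ?g ?h))))))))"
    unfolding E.R.Vel_comult'[OF l] by (simp add: E.R.mul_sum_left E.R.mul_assoc
      E.R.Pi_coassoc'[OF l] del: One_nat_def)
  also have "\<dots> = sum3 phinv (\<lambda>p q r. sum3 (reassoc H) (\<lambda>X Y Z. lop_mul (?f q) (lop_mul (?g r)
      (lop_mul (E.ev ?C ?h (comult_bar H (T p * (x * S X)))) (lop_mul (?f Y) (?g Z))))))"
    unfolding E.R.Uel_comult[OF l]
    by (simp add: E.R.mul_sum_right E.R.mul_assoc E.ev_comult_bar[OF d(5)] E.R.ahom_mult[OF aD(1)]
      del: One_nat_def)
  finally show ?thesis
    by (simp add: klin_sum3[OF L(1)] klin_sum2[OF L(1)] E.ev_def E.R.cop_def[of ?f ?g] E.R.mul_sum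
      L(2)[symmetric]
        d(9-11)[THEN E.R.ahom_mult] E.R.mul_assoc d(12-14)[THEN E.R.cms1] d(12-14)[THEN E.R.cms2]
          del: One_nat_def)
qed

end

lemma klin_sum_scale:
  assumes "klin s t f" shows "f (\<Sum>i\<in>I. s (c i) (v i)) = (\<Sum>i\<in>I. t (c i) (f (v i)))"
  by (simp add: klin_sum[OF assms] klin_scale[OF assms])

context fd_quasi_hopf
begin

interpretation E: fdqh_rep H B lop_scale "lop_mul :: (nat \<Rightarrow> 'a, 'k) lop \<Rightarrow> _" lop_one
  by (rule fdqh_rep_lop)

lemma pR_collapse0:
  assumes F: "mlin2 sc (*) F"
  shows "sum3 (reassoc H) (\<lambda>x y z. sum3 phinv (\<lambda>p q r. sum2 (comult H x) (\<lambda>x1 x2.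
    F (x1 * p) (x2 * (q * (be * (S r * (S y * (al * z)))))))) ) = F 1 1"
proof -
  obtain L where L: "klin lop_scale (*) L" "\<And>a b. L (lop_mul (Q.leg 0 a) (Q.leg 1 b)) = F a b"
    using Q.legs_separate2[OF F] by blast
  let ?f = "Q.leg 0" and ?g = "Q.leg 1"
  have l: "E.R.legs2 ?f ?g" by (rule leg_legs2) simp
  note d = E.R.legs2D[OF l]
  have "L lop_one = F 1 1" using L(2)[of 1 1] by (simp add: Q.leg_one)
  then show ?thesis
    using arg_cong[where f = L, OF E.R.pR_collapse[OF l]]
    by (simp add: E.R.pR_def E.R.cop_def E.R.mul_sum klin_sum3[OF L(1)] klin_sum2[OF L(1)]
      L(2)[symmetric] sum2_sum3
        d(1,2)[THEN E.R.ahom_mult] E.R.mul_assoc E.R.cms1[OF d(3)] E.R.cms2[OF d(3)] Q.S_mult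
          del: One_nat_def)
qed

section \<open>The coaction and the projection onto the coinvariants\<close>

text \<open>
  The coaction \<open>\<rho>(\<psi>) = \<psi>\<^sub>0 \<otimes> \<psi>\<^sub>1\<close>, an element of \<open>H\<^sup>* \<otimes> H\<close>, regarded as the endomorphism
  \<open>x \<mapsto> \<psi>\<^sub>0(x) \<psi>\<^sub>1\<close>.
\<close>

definition rr :: "('a \<Rightarrow> 'k) \<Rightarrow> 'a \<Rightarrow> 'a" where
  "rr \<psi> x = sum2 (comult_bar H x) (\<lambda>y z. sc (\<psi> z) y)"

lemma klin_eqI: "(\<And>l. klin sc (*) l \<Longrightarrow> l x = l y) \<Longrightarrow> x = y"
  by (rule klin_separates)

lemma klin_rr: "klin sc s l \<Longrightarrow> l (rr \<psi> x) = sum2 (comult_bar H x) (\<lambda>y z. s (\<psi> z) (l y))"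
  by (simp add: rr_def klin_sum2 klin_scale)

lemma klin_mul2: "klin sc (*) l \<Longrightarrow> klin sc (*) \<psi> \<Longrightarrow> mlin2 sc (*) (\<lambda>y z. \<psi> z * l y)"
  by (simp add: mlin2_def klin_def algebra_simps)

lemma rr_klin:
  assumes \<psi>: "klin sc (*) \<psi>" shows "klin sc sc (rr \<psi>)"
  unfolding klin_def
proof safe
  fix x y c
  show "rr \<psi> (x + y) = rr \<psi> x + rr \<psi> y"
    by (rule klin_eqI) (simp add: klin_rr klin_add klin_add[OF cb_klin0] klin_mul2 \<psi>)
  show "rr \<psi> (sc c x) = sc c (rr \<psi> x)"
    by (rule klin_eqI) (simp add: klin_rr klin_scale klin_scale[OF cb_klin0] klin_mul2 \<psi>)
qed

lemma rr_lin: "rr (\<lambda>x. \<psi> x + \<chi> x) v = rr \<psi> v + rr \<chi> v" "rr (\<lambda>x. c * \<psi> x) v = sc c (rr \<psi> v)"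
  by (simp_all add: rr_def sum2_add scale_left_distrib Q.scl_sum2)

text \<open>In terms of the coaction: \<rho>(\<psi> \<cdot> a) = \<rho>(\<psi>) \<Delta>(a). It
  rests on the twining relation for U, and \<open>rr_left\<close> likewise on that for V.\<close>

lemma rr_right:
  assumes \<psi>: "klin sc (*) \<psi>"
  shows "rr (\<lambda>x. \<psi> (x * S a)) x = sum2 (comult H a) (\<lambda>a1 a2. rr \<psi> (x * S a1) * a2)"
proof (rule klin_eqI)
  fix l assume l: "klin sc (*) l"
  show "l (rr (\<lambda>x. \<psi> (x * S a)) x) = l (sum2 (comult H a) (\<lambda>a1 a2. rr \<psi> (x * S a1) * a2))"
    using cb_right0[OF klin_mul2[OF l \<psi>]]
    by (simp add: klin_rr[OF l] klin_sum2[OF l] klin_rr[OF klin_comp[OF klin_mul(2) l]])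
qed

lemma rr_left:
  assumes \<psi>: "klin sc (*) \<psi>"
  shows "rr (\<lambda>x. \<psi> (T a * x)) x = sum2 (comult H a) (\<lambda>a1 a2. a2 * rr \<psi> (T a1 * x))"
proof (rule klin_eqI)
  fix l assume l: "klin sc (*) l"
  show "l (rr (\<lambda>x. \<psi> (T a * x)) x) = l (sum2 (comult H a) (\<lambda>a1 a2. a2 * rr \<psi> (T a1 * x)))"
    using cb_left0[OF klin_mul2[OF l \<psi>]]
    by (simp add: klin_rr[OF l] klin_sum2[OF l] klin_rr[OF klin_comp[OF klin_mul(1) l]])
qed

lemma rr_counit: "klin sc (*) \<psi> \<Longrightarrow> counit H (rr \<psi> x) = \<psi> x"
  using cb_counit0[of \<psi> x] by (simp add: klin_rr[OF Q.ep_klin] mult.commute)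

text \<open>The left side is (\<rho> \<otimes> id)(\<rho>(\<psi>)) at \<open>x\<close>, tested
  against \<open>G\<close>; the right side is (id \<otimes> \<Delta>)(\<rho>(\<psi>)) multiplied by
  the inverse of \<phi> on the left and by \<phi> on the right.\<close>

lemma rr_coassoc0:
  assumes \<psi>: "klin sc (*) \<psi>" and G: "mlin2 sc (*) G"
  shows "sum2 (comult_bar H x) (\<lambda>y z. G y (rr \<psi> z)) =
    sum3 phinv (\<lambda>p q r. sum3 (reassoc H) (\<lambda>X Y Z. sum2 (comult H (rr \<psi> (T p * (x * S X)))) (\<lambda>s t.
      G (q * (s * Y)) (r * (t * Z)))))"
proof -
  have F: "mlin3 sc (*) (\<lambda>y u v. \<psi> v * G y u)"
    using \<psi> by (simp add: mlin3_def klin_def mlin2D[OF G] algebra_simps)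
  have k: "klin sc (*) (\<lambda>t. G y t)" for y using G by (simp add: mlin2_def)
  have m: "mlin2 sc (*) (\<lambda>s t. G (q * (s * Y)) (r * (t * Z)))" for q r Y Z
    by (simp add: Hlin mlin2D[OF G])
  show ?thesis
    using cb_coassoc0[OF F, of x]
    by (simp add: klin_rr[OF k] klin_rr[OF comult_klin[OF m]]
      sum2_hom[of "\<lambda>t. _ * t", OF distrib_left mult_zero_right])
qed

lemma rr_coassoc:
  assumes \<psi>: "klin sc (*) \<psi>" and G: "mlin2 sc sc G"
  shows "sum2 (comult_bar H x) (\<lambda>y z. G y (rr \<psi> z)) =
    sum3 phinv (\<lambda>p q r. sum3 (reassoc H) (\<lambda>X Y Z. sum2 (comult H (rr \<psi> (T p * (x * S X)))) (\<lambda>s t.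
      G (q * (s * Y)) (r * (t * Z)))))"
proof (rule klin_eqI)
  fix l assume l: "klin sc (*) l"
  show "l (sum2 (comult_bar H x) (\<lambda>y z. G y (rr \<psi> z))) =
    l (sum3 phinv (\<lambda>p q r. sum3 (reassoc H) (\<lambda>X Y Z. sum2 (comult H (rr \<psi> (T p * (x * S X)))) (\<lambda>s t.
      G (q * (s * Y)) (r * (t * Z))))))"
    using rr_coassoc0[OF \<psi> mlin2_comp[OF G l], of x] by (simp add: klin_sum2[OF l] klin_sum3[OF l])
qed

lemma be_abs:
  assumes G: "klin sc s G"
  shows "sum2 (comult H c) (\<lambda>c1 c2. G (c1 * (be * (S c2 * v)))) = s (counit H c) (G (be * v))"
proof -
  have "sum2 (comult H c) (\<lambda>c1 c2. G (c1 * (be * (S c2 * v)))) =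
    G (sum2 (comult H c) (\<lambda>c1 c2. c1 * be * S c2) * v)"
    by (simp add: Q.mul_sum2_left klin_sum2[OF G] mult.assoc)
  then show ?thesis by (simp add: Q.S_be scale_mult_left[symmetric] klin_scale[OF G])
qed

lemma al_abs:
  assumes G: "klin sc s G"
  shows "sum2 (comult H c) (\<lambda>c1 c2. G (v * (S c1 * (al * (c2 * w))))) =
    s (counit H c) (G (v * (al * w)))"
proof -
  have "sum2 (comult H c) (\<lambda>c1 c2. G (v * (S c1 * (al * (c2 * w))))) =
    G (v * (sum2 (comult H c) (\<lambda>c1 c2. S c1 * al * c2) * w))"
    by (simp add: Q.mul_sum klin_sum2[OF G] mult.assoc)
  then show ?thesis by (simp add: Q.S_al scale_mult_left[symmetric] scale_mult_right[symmetric]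
    klin_scale[OF G])
qed

end

section \<open>Traces and the invariance properties of the projection\<close>

text \<open>Two bases coexist: \<open>B\<close> contains 1, as the faithful evaluation requires,
  while \<open>B0\<close> is an arbitrary basis, the one over which E is summed.\<close>

locale fd_quasi_hopf_basis = fd_quasi_hopf H B + N: finite_dimensional_vector_space "scal H" B0
  for H :: "('k::field, 'a::ring_1) quasi_hopf_data" and B B0 :: "'a set"
begin

abbreviation "rep \<equiv> representation B0"

lemma rep_klin: "klin sc (*) (\<lambda>x. rep x b)"
  by (simp add: klin_def representation_add representation_scale N.independent_Basis N.span_Basis)

lemmas rep_lin = klin_add[OF rep_klin] klin_scale[OF rep_klin] klin_sum2[OF rep_klin]
  klin_sum3[OF rep_klin]

lemma rep_sum: "(\<Sum>b\<in>B0. sc (rep x b) b) = x"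
  by (rule sum_representation_eq) (use N.independent_Basis N.span_Basis N.finite_Basis in auto)

lemma rep_expand:
  assumes "klin sc s G" shows "(\<Sum>b\<in>B0. s (rep x b) (G b)) = G x"
  using klin_sum_scale[OF assms, of "rep x" "\<lambda>b. b" B0] by (simp add: rep_sum)

definition tr :: "('a \<Rightarrow> 'a) \<Rightarrow> 'k" where "tr f = (\<Sum>b\<in>B0. rep (f b) b)"

lemma tr_lin: "tr (\<lambda>b. f b + g b) = tr f + tr g" "tr (\<lambda>b. sc c (f b)) = c * tr f"
    "tr (\<lambda>b. sum2 ts (F b)) = sum2 ts (\<lambda>x y. tr (\<lambda>b. F b x y))"
    "tr (\<lambda>b. sum3 us (K b)) = sum3 us (\<lambda>x y z. tr (\<lambda>b. K b x y z))"
  by (simp_all add: tr_def rep_lin sum.distrib sum_distrib_left sum_sum2 sum_sum3)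

lemma tr_cyclic:
  assumes f: "klin sc sc f" and g: "klin sc sc g"
  shows "tr (\<lambda>b. f (g b)) = tr (\<lambda>b. g (f b))"
proof -
  have *: "tr (\<lambda>b. f (g b)) = (\<Sum>b\<in>B0. \<Sum>c\<in>B0. rep (g b) c * rep (f c) b)" if f: "klin sc sc f" for f
    g
    unfolding tr_def by (rule sum.cong[OF refl])
      (rule rep_expand[OF klin_comp[OF f rep_klin], symmetric])
  show ?thesis
    unfolding *[OF f] *[OF g] by (subst sum.swap) (simp add: mult.commute)
qed

lemma tr_rank_one:
  assumes "klin sc (*) l" shows "tr (\<lambda>b. sc (l b) v) = l v"
  using rep_expand[OF assms, of v] by (simp add: tr_def rep_lin mult.commute)

text \<open>Cyclicity of the trace for a pair of maps H \<rightarrow> H \<otimes> H \<rightarrow> H: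
  a trace over the tensor square becomes one over H.\<close>

lemma tr_comult:
  assumes M: "mlin2 sc sc M"
  shows "(\<Sum>b\<in>B0. \<Sum>i\<in>B0. sum2 (comult H (M b i)) (\<lambda>s t. rep (q * (s * Y)) b * rep (r * (t * Z)) i)) =
    tr (\<lambda>b. sum2 (comult H b) (\<lambda>s t. M (q * (s * Y)) (r * (t * Z))))"
proof -
  have m: "mlin2 sc (*) (\<lambda>s t. rep (q * (s * Y)) b * rep (r * (t * Z)) i)" for b i
    by (simp add: Hlin rep_lin mult.left_commute)
  have k: "klin sc (*) (\<lambda>b. rep (M b i) c)" "klin sc (*) (\<lambda>i. rep (M b i) c)" for b i c
    by (simp_all add: klin_def mlin2D[OF M] rep_lin)
  have 1: "(\<Sum>b\<in>B0. \<Sum>i\<in>B0. rep (M b i) c * (rep u b * rep v i)) = rep (M u v) c" for c u v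
  proof -
    have "rep (M u v) c = (\<Sum>b\<in>B0. rep u b * (\<Sum>i\<in>B0. rep v i * rep (M b i) c))"
      by (simp add: rep_expand[OF k(1)] rep_expand[OF k(2)])
    then show ?thesis by (simp add: sum_distrib_left mult_ac)
  qed
  have "(\<Sum>b\<in>B0. \<Sum>i\<in>B0. sum2 (comult H (M b i)) (\<lambda>s t. rep (q * (s * Y)) b * rep (r * (t * Z)) i)) =
    (\<Sum>b\<in>B0. \<Sum>i\<in>B0. \<Sum>c\<in>B0. rep (M b i) c * sum2 (comult H c)
      (\<lambda>s t. rep (q * (s * Y)) b * rep (r * (t * Z)) i))"
    by (simp add: rep_expand[OF comult_klin[OF m]])
  also have "\<dots> = (\<Sum>c\<in>B0. \<Sum>b\<in>B0. \<Sum>i\<in>B0. rep (M b i) c * sum2 (comult H c)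
    (\<lambda>s t. rep (q * (s * Y)) b * rep (r * (t * Z)) i))"
    (is "_ = (\<Sum>c\<in>B0. \<Sum>b\<in>B0. \<Sum>i\<in>B0. ?g b i c)")
  proof -
    have "(\<Sum>b\<in>B0. \<Sum>i\<in>B0. \<Sum>c\<in>B0. ?g b i c) = (\<Sum>b\<in>B0. \<Sum>c\<in>B0. \<Sum>i\<in>B0. ?g b i c)"
      by (rule sum.cong[OF refl]) (rule sum.swap)
    also have "\<dots> = (\<Sum>c\<in>B0. \<Sum>b\<in>B0. \<Sum>i\<in>B0. ?g b i c)" by (rule sum.swap)
    finally show ?thesis .
  qed
  also have "\<dots> = (\<Sum>c\<in>B0. sum2 (comult H c) (\<lambda>s t. rep (M (q * (s * Y)) (r * (t * Z))) c))"
    by (simp add: sum2_hom[of "\<lambda>t. _ * t", OF distrib_left mult_zero_right] sum_sum2 1)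
  finally show ?thesis by (simp add: tr_def rep_lin)
qed

text \<open>
  The projection $E$: its sum over dual bases is a trace.
\<close>

definition Ev :: "('a \<Rightarrow> 'k) \<Rightarrow> 'a \<Rightarrow> 'k" where
  "Ev \<psi> a = sum3 (reassoc H) (\<lambda>x y z. tr
    (\<lambda>b. rr \<psi> (T x * (a * S (be * (S b * (S y * (al * z))))))))"

lemma coinv_proj_eq: "coinv_proj H B0 \<psi> = Ev \<psi>"
proof (rule ext)
  fix a
  have "sum2 ts g a = sum2 ts (\<lambda>q1 q2. g q1 q2 a)"
    for g :: "'a \<Rightarrow> 'a \<Rightarrow> 'a \<Rightarrow> 'k" and ts
    by (induction ts) auto
  then have "coinv_proj H B0 \<psi> a = sum2 (q_R H) (\<lambda>q1 q2. \<Sum>b\<in>B0.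
      dual_act H q1 (conv H (dual_basis H B0 b) \<psi>) (be * S (q2 * b)) a)"
    unfolding coinv_proj_def sum2_def[symmetric] by (simp add: sum_fun_eval)
  also have "\<dots> = sum2 (q_R H) (\<lambda>q1 q2. \<Sum>b\<in>B0. rep (rr \<psi> (T q1 * a * S (be * S (q2 * b)))) b)"
    by (simp add: dual_act_def conv_def dual_basis_def klin_rr[OF rep_klin] sum2_def[symmetric]
      mult.commute)
  finally have "coinv_proj H B0 \<psi> a = sum2 (q_R H)
    (\<lambda>q1 q2. \<Sum>b\<in>B0. rep (rr \<psi> (T q1 * a * S (be * S (q2 * b)))) b)" .
  then show "coinv_proj H B0 \<psi> a = Ev \<psi> a"
    by (simp add: Ev_def tr_def q_R_def sum_comprehension Q.S_mult mult.assoc)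
qed

lemma Ev_lin: "Ev (\<lambda>x. \<psi> x + \<chi> x) a = Ev \<psi> a + Ev \<chi> a" "Ev (\<lambda>x. c * \<psi> x) a = c * Ev \<psi> a"
  by (simp_all add: Ev_def rr_lin tr_lin sum3_add
    sum3_hom[of "\<lambda>t. _ * t", OF distrib_left mult_zero_right])

lemma Ev_sum: "Ev (\<lambda>x. \<Sum>i\<in>I. \<psi> i x) a = (\<Sum>i\<in>I. Ev (\<psi> i) a)"
proof -
  have "Ev (\<lambda>x. 0) a = 0" using Ev_lin(2)[of 0 "\<lambda>_. 0" a] by simp
  then show ?thesis by (induction I rule: infinite_finite_induct) (simp_all add: Ev_lin)
qed

lemma Ev_klin:
  assumes \<psi>: "klin sc (*) \<psi>" shows "klin sc (*) (Ev \<psi>)"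
  by (simp add: klin_def Ev_def Hlin klin_add[OF rr_klin[OF \<psi>]] klin_scale[OF rr_klin[OF \<psi>]] tr_lin)

lemmas S_lin = klin_add[OF Q.S_klin] klin_scale[OF Q.S_klin] klin_add[OF Q.T_klin]
  klin_scale[OF Q.T_klin]

text \<open>By \<open>rr_right\<close> the action produces a right factor \<open>c2\<close> on the
  coaction. Cyclicity of the trace moves it into the antipode, where it meets \<open>c1\<close>
  across \<open>be\<close> and is absorbed.\<close>

lemma Ev_right:
  assumes \<psi>: "klin sc (*) \<psi>"
  shows "Ev (\<lambda>x. \<psi> (x * S c)) a = counit H c * Ev \<psi> a"
proof -
  note rl = klin_add[OF rr_klin[OF \<psi>]] klin_scale[OF rr_klin[OF \<psi>]]
  have 1: "tr (\<lambda>b. rr \<psi> (T x * (a * S (be * (S b * w))) * S c1) * c2) =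
      tr (\<lambda>b. rr \<psi> (T x * (a * S (c1 * (be * (S c2 * (S b * w)))))))" for x w c1 c2
    using tr_cyclic[OF klin_mul(2)[of c2], of "\<lambda>b. rr \<psi> (T x * (a * S (be * (S b * w))) * S c1)"]
    by (simp add: klin_def Hlin S_lin rl Q.S_mult mult.assoc)
  have k: "klin sc sc (\<lambda>t. rr \<psi> (T x * (a * S t)))" for x
    by (simp add: Hlin S_lin rl)
  have 2: "sum2 (comult H c) (\<lambda>c1 c2. tr
    (\<lambda>b. rr \<psi> (T x * (a * S (c1 * (be * (S c2 * (S b * w)))))))) =
    counit H c * tr (\<lambda>b. rr \<psi> (T x * (a * S (be * (S b * w)))))" for x w
    by (simp only: tr_lin(3)[symmetric] be_abs[OF k] tr_lin(2))
  show ?thesis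
    by (simp add: Ev_def rr_right[OF \<psi>] tr_lin 1 2
      sum3_hom[of "\<lambda>t. _ * t", OF distrib_left mult_zero_right])
qed

text \<open>Coassociativity of the coaction and \<open>tr_comult\<close> turn the two sums over the
  basis into a single trace. There \<phi> cancels its inverse, \<open>al\<close> absorbs the
  coproduct, and the surviving rank-one trace is the counit of the coaction.\<close>

lemma Ev_reconstruct:
  assumes \<psi>: "klin sc (*) \<psi>"
  shows "(\<Sum>i\<in>B0. Ev (\<lambda>x. rep (rr \<psi> x) i) (a * S i)) = \<psi> a"
proof -
  note rl = klin_add[OF rr_klin[OF \<psi>]] klin_scale[OF rr_klin[OF \<psi>]]
  have mG: "mlin2 sc (*) (\<lambda>u v. rep u b * rep v i)" for b i
    by (simp add: Hlin rep_lin mult.left_commute)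
  define M where "M = (\<lambda>x p w X u v. rr \<psi> (T p * (T x * (a * (S v * S (be * (S u * w)))) * S X)))"
  have M: "mlin2 sc sc (M x p w X)" for x p w X
    by (simp add: M_def Hlin S_lin rl)
  have 1: "rep (rr (\<lambda>x. rep (rr \<psi> x) i) t) b =
    sum2 (comult_bar H t) (\<lambda>y z. rep y b * rep (rr \<psi> z) i)" for i t b
    by (simp add: rr_def[of "\<lambda>x. rep (rr \<psi> x) i"] rep_lin mult.commute)
  have "(\<Sum>i\<in>B0. Ev (\<lambda>x. rep (rr \<psi> x) i) (a * S i)) =
    sum3 (reassoc H) (\<lambda>x y z. \<Sum>i\<in>B0. \<Sum>b\<in>B0. sum3 phinv (\<lambda>p q r. sum3 (reassoc H) (\<lambda>X Y Z.
      sum2 (comult H (M x p (S y * (al * z)) X b i))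
        (\<lambda>s t. rep (q * (s * Y)) b * rep (r * (t * Z)) i))))"
    by (simp add: Ev_def tr_def 1 rr_coassoc0[OF \<psi> mG] M_def sum_sum3 mult.assoc)
  also have "\<dots> = sum3 (reassoc H) (\<lambda>x y z. sum3 phinv
    (\<lambda>p q r. sum3 (reassoc H) (\<lambda>X Y Z. \<Sum>b\<in>B0. \<Sum>i\<in>B0.
      sum2 (comult H (M x p (S y * (al * z)) X b i))
        (\<lambda>s t. rep (q * (s * Y)) b * rep (r * (t * Z)) i))))"
    by (subst sum.swap) (simp add: sum_sum3)
  also have "\<dots> = sum3 (reassoc H) (\<lambda>x y z. sum3 phinv (\<lambda>p q r. sum3 (reassoc H) (\<lambda>X Y Z.
      tr (\<lambda>b. sum2 (comult H b) (\<lambda>s t. rr \<psi>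
        (T (x * p) * (a * S (X * (be * (S Y *
        (S s * (S (y * q) * (al * ((z * r) * (t * Z)))))))))))))))"
    unfolding tr_comult[OF M] by (simp add: M_def Q.T_mult Q.S_mult mult.assoc)
  \<comment> \<open>The reassociator coming from q_R in E cancels against the inverse supplied by
    the coassociativity of the coaction.\<close>
  also have "\<dots> = sum3 (reassoc H) (\<lambda>X Y Z. tr (\<lambda>b. sum2 (comult H b) (\<lambda>s t.
      rr \<psi> (a * S (X * (be * (S Y * (S s * (al * (t * Z))))))))))"
  proof -
    have m: "mlin3 sc (*) (\<lambda>u v w. sum3 (reassoc H) (\<lambda>X Y Z. tr (\<lambda>b. sum2 (comult H b) (\<lambda>s t.
        rr \<psi> (T u * (a * S (X * (be * (S Y * (S s * (S v * (al * (w * (t * Z))))))))))))))"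
      by (simp add: Hlin S_lin rl tr_lin Q.scl_sum2[symmetric])
    show ?thesis using phinv_mult(1)[OF m] by (simp add: Q.T_one Q.S_one)
  qed
  \<comment> \<open>The two halves of the coproduct of \<open>b\<close> surround \<open>al\<close>
    and are absorbed, so the map under the trace has rank one.\<close>
  also have "\<dots> = sum3 (reassoc H) (\<lambda>X Y Z. tr
    (\<lambda>b. sc (counit H b) (rr \<psi> (a * S (X * (be * (S Y * (al * Z))))))))"
  proof -
    have k: "klin sc sc (\<lambda>t. rr \<psi> (a * S (X * (be * t))))" for X
      by (simp add: Hlin S_lin rl)
    show ?thesis by (simp add: al_abs[OF k])
  qed
  also have "\<dots> = counit H (rr \<psi> (a * S (sum3 (reassoc H) (\<lambda>x y z. x * be * S y * al * z))))"
    by (simp add: tr_rank_one[OF Q.ep_klin] klin_sum3[OF Q.ep_klin] klin_sum3[OF rr_klin[OF \<psi>]]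
      klin_sum3[OF Q.S_klin]
        Q.mul_sum3_right mult.assoc)
  also have "\<dots> = \<psi> a"
    by (simp add: Q.S_ph Q.S_one rr_counit[OF \<psi>])
  finally show ?thesis .
qed

text \<open>
  The value at \<open>a\<close> of the first factor of \<open>(E \<otimes> id)(g)\<close>, where \<open>g\<close> is an endomorphism regarded as an
  element of \<open>H\<^sup>* \<otimes> H\<close>.
\<close>

definition ES :: "'a \<Rightarrow> ('a \<Rightarrow> 'a) \<Rightarrow> 'a" where
  "ES a g = (\<Sum>i\<in>B0. sc (Ev (\<lambda>x. rep (g x) i) a) i)"

lemma ES_lin:
  "ES a (\<lambda>x. g x + h x) = ES a g + ES a h" "ES a (\<lambda>x. sc c (g x)) = sc c (ES a g)"
  by (simp_all add: ES_def rep_lin Ev_lin scale_left_distrib sum.distrib scale_sum_right)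

lemma ES_sum: "ES a (\<lambda>x. sum2 ts (\<lambda>y z. K2 x y z)) = sum2 ts (\<lambda>y z. ES a (\<lambda>x. K2 x y z))"
  "ES a (\<lambda>x. sum3 us (\<lambda>y z w. K3 x y z w)) = sum3 us (\<lambda>y z w. ES a (\<lambda>x. K3 x y z w))"
proof -
  have z: "ES a (\<lambda>x. 0) = 0" using ES_lin(2)[of a 0 "\<lambda>_. 0"] by simp
  show "ES a (\<lambda>x. sum2 ts (\<lambda>y z. K2 x y z)) = sum2 ts (\<lambda>y z. ES a (\<lambda>x. K2 x y z))"
    by (induction ts) (auto simp: ES_lin z)
  show "ES a (\<lambda>x. sum3 us (\<lambda>y z w. K3 x y z w)) = sum3 us (\<lambda>y z w. ES a (\<lambda>x. K3 x y z w))"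
    by (induction us) (auto simp: ES_lin z)
qed

text \<open>E acts on the first tensor factor only, so linear maps of the second factor pass through
  it.\<close>

lemma ES_comp:
  assumes h: "klin sc sc h" shows "ES a (\<lambda>x. h (g x)) = h (ES a g)"
proof -
  have "rep (h (g x)) i = (\<Sum>j\<in>B0. rep (h j) i * rep (g x) j)" for x i
    by (subst rep_expand[OF klin_comp[OF h rep_klin], symmetric]) (simp add: mult.commute)
  then have "ES a (\<lambda>x. h (g x)) = (\<Sum>i\<in>B0. sc (\<Sum>j\<in>B0. rep (h j) i * Ev (\<lambda>x. rep (g x) j) a) i)"
    by (simp add: ES_def Ev_sum Ev_lin)
  also have "\<dots> = (\<Sum>j\<in>B0. sc (Ev (\<lambda>x. rep (g x) j) a) (\<Sum>i\<in>B0. sc (rep (h j) i) i))"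
    by (simp add: scale_sum_left scale_sum_right mult.commute) (rule sum.swap)
  also have "\<dots> = h (ES a g)"
    by (simp add: rep_sum ES_def klin_sum_scale[OF h])
  finally show ?thesis .
qed

lemma ES_right:
  assumes g: "klin sc sc g" shows "ES a (\<lambda>x. g (x * S d)) = sc (counit H d) (ES a g)"
  by (simp add: ES_def Ev_right[OF klin_comp[OF g rep_klin]] scale_sum_right)

lemma ES_rank_one: "ES a (\<lambda>x. sc (\<chi> x) v) = sc (Ev \<chi> a) v"
proof -
  have "rep (sc (\<chi> x) v) i = rep v i * \<chi> x" for x i
    by (simp add: rep_lin mult.commute)
  then have "ES a (\<lambda>x. sc (\<chi> x) v) = (\<Sum>i\<in>B0. sc (Ev (\<lambda>x. rep v i * \<chi> x) a) i)"
    unfolding ES_def by (simp only:)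
  also have "\<dots> = (\<Sum>i\<in>B0. sc (Ev \<chi> a) (sc (rep v i) i))"
    by (simp add: Ev_lin(2)) (simp add: mult.commute)
  finally have "ES a (\<lambda>x. sc (\<chi> x) v) = (\<Sum>i\<in>B0. sc (Ev \<chi> a) (sc (rep v i) i))" .
  then show ?thesis by (simp only: scale_sum_right[symmetric] rep_sum)
qed

lemma ES_act:
  assumes \<chi>: "klin sc (*) \<chi>"
  shows "ES a (rr (\<lambda>x. \<chi> (T c * x * S d))) =
    sum2 (comult H c) (\<lambda>c1 c2. c2 * ES a (\<lambda>x. rr \<chi> (T c1 * x)) * d)"
proof -
  note rl = klin_add[OF rr_klin[OF \<chi>]] klin_scale[OF rr_klin[OF \<chi>]]
  have \<chi>': "klin sc (*) (\<lambda>x. \<chi> (T c * x))"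
    using \<chi> by (simp add: klin_def Hlin)
  have rd: "sum2 (comult H d) (\<lambda>d1 d2. sc (counit H d1) (u * d2)) = u * d" for u
    using arg_cong[where f = "\<lambda>t. u * t", OF Q.counit_l[of d]]
    by (simp add: Q.mul_sum2_right scale_mult_right[symmetric])
  have k: "klin sc sc (\<lambda>t. c2 * rr \<chi> (T c1 * t))" for c1 c2
    by (simp add: Hlin rl)
  have "ES a (rr (\<lambda>x. \<chi> (T c * x * S d))) =
    ES a (\<lambda>x. sum2 (comult H d) (\<lambda>d1 d2. sum2 (comult H c)
      (\<lambda>c1 c2. c2 * rr \<chi> (T c1 * (x * S d1))) * d2))"
    by (rule arg_cong[where f = "ES a"], rule ext)
      (use rr_right[OF \<chi>', of d] rr_left[OF \<chi>, of c] in \<open>simp add: mult.assoc\<close>)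
  also have "\<dots> = sum2 (comult H d) (\<lambda>d1 d2. sum2 (comult H c)
    (\<lambda>c1 c2. sc (counit H d1) (ES a (\<lambda>x. c2 * rr \<chi> (T c1 * x)) * d2)))"
    by (simp add: Q.mul_sum2_left ES_sum ES_comp[OF klin_mul(2)] ES_right[OF k]
      scale_mult_left[symmetric])
  also have "\<dots> = sum2 (comult H c) (\<lambda>c1 c2. c2 * ES a (\<lambda>x. rr \<chi> (T c1 * x)) * d)"
    by (subst sum2_sum2) (simp add: rd ES_comp[OF klin_mul(1)])
  finally show ?thesis .
qed

text \<open>E is written out and its actions are moved through the coaction. The right invariance of
  E then removes one reassociator and \<open>be\<close> absorbs a coproduct; in the end p_R and q_R
  cancel as in \<open>pR_collapse\<close>.\<close>

lemma ES_coinvariant: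
  assumes \<psi>: "klin sc (*) \<psi>"
  shows "ES a (rr (Ev \<psi>)) = sc (Ev \<psi> a) 1"
proof -
  note rl = klin_add[OF rr_klin[OF \<psi>]] klin_scale[OF rr_klin[OF \<psi>]]
  have kb: "klin sc (*) (\<lambda>x. rep (rr \<psi> x) b)" for b
    by (rule klin_comp[OF rr_klin[OF \<psi>] rep_klin])
  have Ks: "ES a (rr (\<lambda>v. sum3 us (\<lambda>x y z. \<Sum>b\<in>B0. F x y z b v))) =
      sum3 us (\<lambda>x y z. \<Sum>b\<in>B0. ES a (rr (F x y z b)))" for us :: "('a \<times> 'a \<times> 'a) list" and F
  proof -
    have z: "rr (\<lambda>x. 0) v = 0" for v using rr_lin(2)[of 0 "\<lambda>_. 0" v] by simp
    have z': "ES a (\<lambda>x. 0) = 0" using ES_lin(2)[of a 0 "\<lambda>_. 0"] by simp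
    have i: "ES a (rr (\<lambda>v. \<Sum>b\<in>I. G b v)) = (\<Sum>b\<in>I. ES a (rr (G b)))" for I and G :: "'a \<Rightarrow> 'a \<Rightarrow> 'k"
      by (induction I rule: infinite_finite_induct)
        (simp_all add: rr_lin[abs_def] z[abs_def] z' ES_lin)
    show ?thesis
      by (induction us) (auto simp: rr_lin[abs_def] z[abs_def] z' ES_lin i)
  qed
  have "ES a (rr (Ev \<psi>)) = ES a (rr (\<lambda>v. sum3 (reassoc H) (\<lambda>x y z. \<Sum>b\<in>B0.
      rep (rr \<psi> (T x * v * S (be * (S b * (S y * (al * z)))))) b)))"
    by (simp add: Ev_def[abs_def] tr_def mult.assoc)
  also have "\<dots> = sum3 (reassoc H) (\<lambda>x y z. \<Sum>b\<in>B0. sum2 (comult H x) (\<lambda>x1 x2.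
      x2 * ES a (\<lambda>v. rr (\<lambda>x. rep (rr \<psi> x) b) (T x1 * v)) * (be * (S b * (S y * (al * z))))))"
    unfolding Ks by (simp only: ES_act[OF kb])
  \<comment> \<open>Summation over the dual bases substitutes the second component of the coaction
    for \<open>b\<close>, which makes the coaction occur iterated.\<close>
  also have "\<dots> = sum3 (reassoc H) (\<lambda>x y z. sum2 (comult H x) (\<lambda>x1 x2.
      x2 * ES a (\<lambda>v. sum2 (comult_bar H (T x1 * v)) (\<lambda>s t. s * (be * S (rr \<psi> t)))) *
        (S y * (al * z))))"
  proof -
    have 1: "(\<Sum>b\<in>B0. x2 * ES a (\<lambda>v. rr (\<lambda>x. rep (rr \<psi> x) b) (T x1 * v)) * (be * (S b * w))) =
       x2 * ES a (\<lambda>v. sum2 (comult_bar H (T x1 * v)) (\<lambda>s t. s * (be * S (rr \<psi> t)))) * w" for x1 x2 w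
    proof -
      have k: "klin sc sc (\<lambda>u. x2 * (u * (be * (S b * w))))" for b
        by (simp add: Hlin)
      have k': "klin sc sc (\<lambda>u. x2 * (u * w))" by (simp add: Hlin)
      have r: "rr (\<lambda>x. rep (rr \<psi> x) b) t = sum2 (comult_bar H t) (\<lambda>y z. sc (rep (rr \<psi> z) b) y)" for
        b t
        by (simp add: rr_def[of "\<lambda>x. rep (rr \<psi> x) b"])
      have s: "(\<Sum>b\<in>B0. sc (rep u b) (x2 * (y * (be * (S b * w))))) = x2 * (y * (be * (S u * w)))"
        for u y
        by (rule rep_expand) (simp add: Hlin S_lin)
      have "(\<Sum>b\<in>B0. x2 * ES a (\<lambda>v. rr (\<lambda>x. rep (rr \<psi> x) b) (T x1 * v)) * (be * (S b * w))) =
        (\<Sum>b\<in>B0. ES a (\<lambda>v. x2 * (rr (\<lambda>x. rep (rr \<psi> x) b) (T x1 * v) * (be * (S b * w)))))"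
        using ES_comp[OF k] by (simp add: mult.assoc)
      also have "\<dots> = ES a (\<lambda>v. \<Sum>b\<in>B0. x2 * (rr (\<lambda>x. rep (rr \<psi> x) b) (T x1 * v) * (be * (S b * w))))"
      proof -
        have z': "ES a (\<lambda>x. 0) = 0" using ES_lin(2)[of a 0 "\<lambda>_. 0"] by simp
        have "(\<Sum>b\<in>I. ES a (G b)) = ES a (\<lambda>v. \<Sum>b\<in>I. G b v)" for I and G :: "'a \<Rightarrow> 'a \<Rightarrow> 'a"
          by (induction I rule: infinite_finite_induct) (simp_all add: z' ES_lin)
        then show ?thesis by simp
      qed
      also have "\<dots> = ES a (\<lambda>v. x2 * (sum2 (comult_bar H (T x1 * v))
        (\<lambda>s t. s * (be * S (rr \<psi> t))) * w))"
        by (simp add: r Q.mul_sum scale_mult_left[symmetric] scale_mult_right[symmetric]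
            sum_sum2 s mult.assoc)
      finally show ?thesis using ES_comp[OF k'] by (simp add: mult.assoc)
    qed
    show ?thesis by (simp add: sum_sum2 1)
  qed
  also have "\<dots> = sum3 (reassoc H) (\<lambda>x y z. sum2 (comult H x) (\<lambda>x1 x2.
      x2 * sum3 phinv (\<lambda>p q r. sc (Ev (\<lambda>v. \<psi> (T (x1 * p) * v)) a) (q * (be * S r))) *
        (S y * (al * z))))"
  proof -
    have "ES a (\<lambda>v. sum2 (comult_bar H (T x1 * v)) (\<lambda>s t. s * (be * S (rr \<psi> t)))) =
      sum3 phinv (\<lambda>p q r. sc (Ev (\<lambda>v. \<psi> (T (x1 * p) * v)) a) (q * (be * S r)))" for x1
    proof -
      have mG: "mlin2 sc sc (\<lambda>s t. s * (be * S t))" by (simp add: Hlin S_lin)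
      define g where "g = (\<lambda>p q r Y Z v. sum2 (comult H (rr \<psi> (T p * (T x1 * v)))) (\<lambda>s t.
          q * (s * Y) * (be * S (r * (t * Z)))))"
      have g: "klin sc sc (g p q r Y Z)" for p q r Y Z
      proof -
        have "mlin2 sc (*) (\<lambda>s t. l (q * (s * Y) * (be * S (r * (t * Z)))))" if "klin sc (*) l" for
          l
          using klin_add[OF that] klin_scale[OF that] by (simp add: Hlin S_lin)
        then have k: "klin sc (*) (\<lambda>v. l (g p q r Y Z v))" if "klin sc (*) l" for l
          using that klin_add[OF comult_klin] klin_scale[OF comult_klin]
          by (simp add: klin_sum2[OF that] g_def klin_def Hlin rl)
        show ?thesis
          unfolding klin_def
          by (intro conjI allI; rule klin_eqI) (use k in \<open>simp add: klin_def\<close>)+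
      qed
      have "ES a (\<lambda>v. sum2 (comult_bar H (T x1 * v)) (\<lambda>s t. s * (be * S (rr \<psi> t)))) =
        sum3 phinv (\<lambda>p q r. sum3 (reassoc H) (\<lambda>X Y Z. ES a (\<lambda>v. g p q r Y Z (v * S X))))"
        by (simp add: rr_coassoc[OF \<psi> mG] ES_sum g_def mult.assoc)
      \<comment> \<open>Under E the right action of \<open>X\<close> is multiplication by its
        counit; afterwards the whole reassociator reduces to the unit.\<close>
      also have "\<dots> = sum3 phinv (\<lambda>p q r. sum3 (reassoc H)
        (\<lambda>X Y Z. sc (counit H X) (ES a (g p q r Y Z))))"
        by (simp add: ES_right[OF g])
      also have "\<dots> = sum3 phinv (\<lambda>p q r. ES a (g p q r 1 1))"
      proof -
        have m: "mlin2 sc (*) (\<lambda>Y Z. l (ES a (g p q r Y Z)))" if l: "klin sc (*) l" for l p q r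
          by (simp add: mlin2_def klin_def g_def Hlin S_lin ES_lin[abs_def] Q.scl_sum2[symmetric]
            klin_add[OF l] klin_scale[OF l])
        have "sum3 (reassoc H) (\<lambda>X Y Z. sc (counit H X) (ES a (g p q r Y Z))) = ES a (g p q r 1 1)"
          for p q r
          by (rule klin_eqI) (simp add: klin_sum3 klin_scale Q.ep_sides0[OF m])
        then show ?thesis by simp
      qed
      \<comment> \<open>The coproduct of the coaction's second component is absorbed by
        \<open>be\<close>, and the counit of the coaction gives \<psi> back.\<close>
      also have "\<dots> = sum3 phinv (\<lambda>p q r. sc (Ev (\<lambda>v. \<psi> (T (x1 * p) * v)) a) (q * (be * S r)))"
      proof -
        have "g p q r 1 1 v = sc (\<psi> (T (x1 * p) * v)) (q * (be * S r))" for p q r v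
          using be_abs[OF klin_mul(1), of "rr \<psi> (T p * (T x1 * v))" q "S r"]
          by (simp add: g_def Q.S_mult Q.S_one mult.assoc rr_counit[OF \<psi>] Q.T_mult)
        then have "g p q r 1 1 = (\<lambda>v. sc (\<psi> (T (x1 * p) * v)) (q * (be * S r)))" for p q r by blast
        then show ?thesis by (simp add: ES_rank_one)
      qed
      finally show ?thesis .
    qed
    then show ?thesis by simp
  qed
  also have "\<dots> = sum3 (reassoc H) (\<lambda>x y z. sum3 phinv (\<lambda>p q r. sum2 (comult H x) (\<lambda>x1 x2.
      sc (Ev (\<lambda>v. \<psi> (T (x1 * p) * v)) a) (x2 * (q * (be * (S r * (S y * (al * z)))))))))"
    by (simp add: Q.mul_sum scale_mult_left[symmetric] scale_mult_right[symmetric] mult.assoc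
      sum2_sum3)
  \<comment> \<open>What remains pairs p_R, formed from \<open>phinv\<close>, with q_R, formed from
    \<phi>; their product is the unit tensor.\<close>
  also have "\<dots> = sc (Ev \<psi> a) 1"
  proof (rule klin_eqI)
    fix l assume l: "klin sc (*) l"
    have m: "mlin2 sc (*) (\<lambda>u v. Ev (\<lambda>x. \<psi> (T u * x)) a * l v)"
      using klin_add[OF \<psi>] klin_scale[OF \<psi>]
      by (simp add: mlin2_def klin_def Hlin S_lin Ev_lin klin_add[OF l] klin_scale[OF l]
        mult.left_commute)
    show "l (sum3 (reassoc H) (\<lambda>x y z. sum3 phinv (\<lambda>p q r. sum2 (comult H x) (\<lambda>x1 x2.
      sc (Ev (\<lambda>v. \<psi> (T (x1 * p) * v)) a) (x2 * (q * (be * (S r * (S y * (al * z)))))))))) =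
        l (sc (Ev \<psi> a) 1)"
      using pR_collapse0[OF m] by (simp add: klin_sum2[OF l] klin_sum3[OF l] klin_scale[OF l]
        Q.T_one)
  qed
  finally show ?thesis .
qed

text \<open>Of \<Delta>(c), the first half acts on the functional and E reduces it to its counit;
  the second half multiplies the 1 supplied by coinvariance.\<close>

lemma cointegral_action:
  assumes \<psi>: "klin sc (*) \<psi>"
  shows "ES a (rr (\<lambda>x. Ev \<psi> (x * S c))) = sc (Ev \<psi> a) c"
proof -
  note \<lambda> = Ev_klin[OF \<psi>]
  have rl: "klin sc sc (rr (Ev \<psi>))" by (rule rr_klin[OF \<lambda>])
  have c: "sum2 (comult H c) (\<lambda>c1 c2. sc (counit H c1) (u * c2)) = u * c" for u
    using arg_cong[where f = "\<lambda>t. u * t", OF Q.counit_l[of c]]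
    by (simp add: Q.mul_sum2_right scale_mult_right[symmetric])
  have "ES a (rr (\<lambda>x. Ev \<psi> (x * S c))) =
      ES a (\<lambda>x. sum2 (comult H c) (\<lambda>c1 c2. rr (Ev \<psi>) (x * S c1) * c2))"
    by (rule arg_cong[where f = "ES a"], rule ext) (rule rr_right[OF \<lambda>])
  also have "\<dots> = ES a (rr (Ev \<psi>)) * c"
    by (simp add: ES_sum ES_comp[OF klin_mul(2)] ES_right[OF rl] scale_mult_left[symmetric] c)
  finally show ?thesis by (simp add: ES_coinvariant[OF \<psi>] scale_mult_left[symmetric])
qed

end

section \<open>Bases and nondegenerate bilinear forms\<close>

lemma (in k_algebra) one_in_basis:
  assumes "finite_dimensional_vector_space s B0"
  obtains B where "finite_dimensional_vector_space s B" "1 \<in> B"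
proof -
  interpret N: finite_dimensional_vector_space s B0 by (rule assms)
  have i: "independent {1}" by simp
  define B where "B = extend_basis {1}"
  have B: "1 \<in> B" "independent B" "span B = UNIV"
    using extend_basis_superset[OF i] independent_extend_basis[OF i] span_extend_basis[OF i]
    by (auto simp: B_def)
  have "finite_dimensional_vector_space s B"
    by unfold_locales (use N.finiteI_independent[OF B(2)] B in auto)
  then show ?thesis using that B(1) by blast
qed

text \<open>\<open>G\<close> stores the functional \<beta>(_, a) as the vector whose coordinates are
  its values on the basis. An injective map into the dual thus becomes an injective endomorphism,
  which is onto.\<close>

lemma (in finite_dimensional_vector_space) bilinear_representable:
  assumes \<beta>: "mlin2 scale (*) \<beta>" and inj: "\<And>a. (\<And>x. \<beta> x a = 0) \<Longrightarrow> a = 0"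
    and \<psi>: "klin scale (*) \<psi>"
  obtains a where "\<And>x. \<psi> x = \<beta> x a"
proof -
  define G where "G a = (\<Sum>b\<in>Basis. scale (\<beta> b a) b)" for a
  have kx: "klin scale (*) (\<lambda>x. \<beta> x a)" for a using \<beta> by (simp add: mlin2_def)
  have rep: "(\<Sum>b\<in>Basis. scale (representation Basis x b) b) = x" for x
    by (rule sum_representation_eq) (use independent_Basis span_Basis finite_Basis in auto)
  have ex: "f x = (\<Sum>b\<in>Basis. representation Basis x b * f b)" if "klin scale (*) f" for f x
    using klin_sum_scale[OF that, of "representation Basis x" "\<lambda>b. b" Basis] by (simp add: rep)
  have eq: "f b = g b" if "(\<Sum>b\<in>Basis. scale (f b) b) = (\<Sum>b\<in>Basis. scale (g b) b)" "b \<in> Basis" for f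
    g b
  proof -
    have "(\<Sum>b\<in>Basis. scale (f b - g b) b) = 0"
      using that(1) by (simp add: scale_left_diff_distrib sum_subtractf)
    then have "f b - g b = 0"
      using independentD[OF independent_Basis finite_Basis order_refl, of "\<lambda>b. f b - g b"] that(2)
        by simp
    then show ?thesis by simp
  qed
  have lin: "Vector_Spaces.linear scale scale G"
    using vector_space_axioms
    by (simp add: Vector_Spaces.linear_iff G_def mlin2D[OF \<beta>] scale_left_distrib sum.distrib
      scale_sum_right)
  interpret P: finite_dimensional_vector_space_pair scale Basis scale Basis ..
  have "inj G"
    unfolding P.linear_inj_iff_eq_0[OF lin]
  proof safe
    fix a assume "G a = 0"
    then have "\<beta> b a = 0" if "b \<in> Basis" for b
      using eq[of "\<lambda>b. \<beta> b a" "\<lambda>_. 0" b] that by (simp add: G_def)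
    then have "\<beta> x a = 0" for x by (subst ex[OF kx]) simp
    then show "a = 0" by (rule inj)
  qed
  then have "surj G" by (rule linear_inj_imp_surj[OF lin])
  then obtain a where a: "G a = (\<Sum>b\<in>Basis. scale (\<psi> b) b)" by (metis surjD)
  have "\<psi> b = \<beta> b a" if "b \<in> Basis" for b
    using eq[OF a[unfolded G_def] that] by simp
  then have "\<psi> x = \<beta> x a" for x using ex[OF \<psi>, of x] ex[OF kx, of x a] by simp
  then show ?thesis by (rule that)
qed

text \<open>Every functional has the form \<beta>(_, a) and so vanishes at \<open>x\<close>;
  functionals separate points.\<close>

lemma (in finite_dimensional_vector_space) nondegenerate_flip:
  assumes \<beta>: "mlin2 scale (*) \<beta>" and inj: "\<And>a. (\<And>x. \<beta> x a = 0) \<Longrightarrow> a = 0"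
    and x: "\<And>a. \<beta> x a = 0"
  shows "x = 0"
proof (rule klin_separates)
  fix l assume l: "klin scale (*) l"
  obtain a where "\<And>x. l x = \<beta> x a" using bilinear_representable[OF \<beta> inj l] by blast
  then have "l x = 0" using x by simp
  then show "l x = l 0" using klin_zero[OF l] by simp
qed

section \<open>Cointegrals and integrals\<close>

lemma (in vector_space) dim_span_singleton: "v \<noteq> 0 \<Longrightarrow> dim (span {v}) = 1"
  using dim_span_eq_card_independent[of "{v}"] by simp

text \<open>The Frobenius form represents the counit as l(_ u) and as l(v _). Multiplicativity of
  the counit makes \<open>u\<close> a left and \<open>v\<close> a right integral, and nondegeneracy
  makes every other one a multiple.\<close>

lemma (in quasi_hopf_algebra) dim_integrals:
  assumes B0: "finite_dimensional_vector_space (scal H) B0"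
    and l: "klin (scal H) (*) l" and nd: "nondegenerate l"
  shows "dim (left_integrals H) = 1" and "dim (right_integrals H) = 1"
proof -
  interpret N: finite_dimensional_vector_space "scal H" B0 by (rule B0)
  let ?sc = "scal H" and ?ep = "counit H"
  have ep: "klin ?sc (*) ?ep" using counit_linear by (simp add: klin_iff_linear)
  have ld: "l (a - b) = l a - l b" for a b using klin_add[OF l, of "a - b" b] by simp
  have m: "mlin2 ?sc (*) (\<lambda>x y. l (x * y))" "mlin2 ?sc (*) (\<lambda>x y. l (y * x))"
    using klin_add[OF l] klin_scale[OF l] by (simp_all add: Hlin)
  have inj: "\<And>a. (\<And>x. l (x * a) = 0) \<Longrightarrow> a = 0" "\<And>a. (\<And>x. l (a * x) = 0) \<Longrightarrow> a = 0"
    using nd unfolding nondegenerate_def by blast+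
  have eqI: "\<And>a b. (\<And>x. l (x * a) = l (x * b)) \<Longrightarrow> a = b" "\<And>a b. (\<And>x. l (a * x) = l (b * x)) \<Longrightarrow> a = b"
  proof -
    fix a b assume "\<And>x. l (x * a) = l (x * b)"
    then show "a = b" using inj(1)[of "a - b"] by (simp add: right_diff_distrib ld)
  next
    fix a b assume "\<And>x. l (a * x) = l (b * x)"
    then show "a = b" using inj(2)[of "a - b"] by (simp add: left_diff_distrib ld)
  qed
  obtain u where u: "\<And>x. ?ep x = l (x * u)"
    using N.bilinear_representable[OF m(1) inj(1) ep] by blast
  obtain v where v: "\<And>x. ?ep x = l (v * x)"
    using N.bilinear_representable[OF m(2) inj(2) ep] by blast
  note sm = scale_mult_left[symmetric] scale_mult_right[symmetric] klin_scale[OF l] u[symmetric]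
    v[symmetric]
    counit_mult
  have "u \<noteq> 0" "v \<noteq> 0"
    using u[of 1] v[of 1] klin_zero[OF l] counit_one by auto
  moreover have "left_integrals H = span {u}"
  proof (intro set_eqI iffI)
    fix r assume "r \<in> left_integrals H"
    then have r: "a * r = ?sc (?ep a) r" for a by (simp add: left_integrals_def)
    \<comment> \<open>The scalar is found by pairing with any \<open>x\<close>: l(x r) =
      \<epsilon>(x) l(r) = l(r) l(x u).\<close>
    have "r = ?sc (l r) u"
      by (rule eqI(1)) (simp add: r sm mult.commute)
    then show "r \<in> span {u}" by (metis span_base span_scale singletonI)
  next
    fix r assume "r \<in> span {u}"
    then obtain k where k: "r = ?sc k u" by (auto simp: span_singleton)
    have "a * u = ?sc (?ep a) u" for a
      by (rule eqI(1)) (simp add: sm mult.assoc[symmetric] mult.commute)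
    then show "r \<in> left_integrals H"
      by (simp add: left_integrals_def k sm mult.commute)
  qed
  moreover have "right_integrals H = span {v}"
  proof (intro set_eqI iffI)
    fix r assume "r \<in> right_integrals H"
    then have r: "r * a = ?sc (?ep a) r" for a by (simp add: right_integrals_def)
    have "r = ?sc (l r) v"
      by (rule eqI(2)) (simp add: r sm mult.commute)
    then show "r \<in> span {v}" by (metis span_base span_scale singletonI)
  next
    fix r assume "r \<in> span {v}"
    then obtain k where k: "r = ?sc k v" by (auto simp: span_singleton)
    have "v * a = ?sc (?ep a) v" for a
      by (rule eqI(2)) (simp add: sm mult.assoc)
    then show "r \<in> right_integrals H"
      by (simp add: right_integrals_def k sm mult.commute)
  qed
  ultimately show "dim (left_integrals H) = 1" "dim (right_integrals H) = 1"
    by (metis dim_span_singleton)+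
qed

context fd_quasi_hopf_basis
begin

lemma left_cointegrals_eq: "left_cointegrals H B0 = {Ev \<psi> | \<psi>. klin sc (*) \<psi>}"
  by (auto simp: left_cointegrals_def dual_space_def coinv_proj_eq klin_iff_linear)

lemma ES_rr_zero: "ES a (rr (\<lambda>x. 0)) = 0"
proof -
  have "rr (\<lambda>x. 0) = (\<lambda>x. 0)" using rr_lin(2)[of 0 "\<lambda>_. 0"] by (simp add: fun_eq_iff)
  then show ?thesis using ES_lin(2)[of a 0 "\<lambda>_. 0"] by simp
qed

text \<open>If \<open>a\<close> acts on \<lambda> by zero, \<open>cointegral_action\<close> gives
  \<lambda>(x) a = 0 for every x; a point where \<lambda> does not vanish yields the claim.\<close>

lemma left_cointegral_form:
  assumes "klin sc (*) \<psi>" and "Ev \<psi> \<noteq> 0"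
  shows "mlin2 sc (*) (\<lambda>x a. Ev \<psi> (x * S a))" and "(\<And>x. Ev \<psi> (x * S a) = 0) \<Longrightarrow> a = 0"
proof -
  note \<lambda> = Ev_klin[OF assms(1)]
  show "mlin2 sc (*) (\<lambda>x a. Ev \<psi> (x * S a))"
    using klin_add[OF \<lambda>] klin_scale[OF \<lambda>] by (simp add: Hlin S_lin)
  assume a: "\<And>x. Ev \<psi> (x * S a) = 0"
  obtain x where x: "Ev \<psi> x \<noteq> 0" using assms(2) by (auto simp: fun_eq_iff)
  have "sc (Ev \<psi> x) a = 0"
    using cointegral_action[OF assms(1), of x a] by (simp add: a ES_rr_zero)
  then show "a = 0" using x by simp
qed

lemma left_cointegral_nondegenerate:
  assumes \<psi>: "klin sc (*) \<psi>" and "Ev \<psi> \<noteq> 0"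
  shows "nondegenerate (Ev \<psi>)"
  unfolding nondegenerate_def
proof (intro conjI allI impI)
  note f = left_cointegral_form[OF assms]
  fix a assume "\<forall>b. Ev \<psi> (a * b) = 0"
  then show "a = 0" by (intro N.nondegenerate_flip[OF f]) auto
next
  note f = left_cointegral_form[OF assms]
  fix b assume "\<forall>a. Ev \<psi> (a * b) = 0"
  \<comment> \<open>The form has S in its second argument, so \<open>b\<close> is written as
    \<open>S (T b)\<close>.\<close>
  then have "T b = 0" by (intro f(2)) simp
  then have "S (T b) = 0" using klin_zero[OF Q.S_klin] by simp
  then show "b = 0" by simp
qed

lemma left_cointegral_unique:
  assumes \<psi>: "klin sc (*) \<psi>" and nz: "Ev \<psi> \<noteq> 0" and \<chi>: "klin sc (*) \<chi>"
  obtains k where "Ev \<chi> = fscale k (Ev \<psi>)"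
proof -
  note f = left_cointegral_form[OF \<psi> nz]
  obtain c where c: "\<And>x. Ev \<chi> x = Ev \<psi> (x * S c)"
    using N.bilinear_representable[OF f Ev_klin[OF \<chi>]] by blast
  then have e: "Ev \<chi> = (\<lambda>x. Ev \<psi> (x * S c))" by blast
  have 1: "sc (Ev \<chi> x) 1 = sc (Ev \<psi> x) c" for x
    using ES_coinvariant[OF \<chi>, of x] cointegral_action[OF \<psi>, of x c] unfolding e by simp
  \<comment> \<open>The counit on the second factor of \<mu> \<otimes> 1 = \<lambda> \<otimes> c
    produces the scalar \<epsilon>(c).\<close>
  have "Ev \<chi> x = counit H c * Ev \<psi> x" for x
    using arg_cong[where f = "counit H", OF 1[of x]]
      by (simp add: klin_scale[OF Q.ep_klin] Q.ep_one)
  then have "Ev \<chi> = fscale (counit H c) (Ev \<psi>)" by (simp add: fscale_def fun_eq_iff)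
  then show ?thesis by (rule that)
qed

text \<open>Reconstruction of the counit at 1, where its value is 1, must contain a nonzero
  term.\<close>

lemma left_cointegral_exists:
  obtains \<psi> where "klin sc (*) \<psi>" "Ev \<psi> \<noteq> 0"
proof -
  let ?\<psi> = "\<lambda>i x. rep (rr (counit H) x) i"
  have k: "klin sc (*) (?\<psi> i)" for i by (rule klin_comp[OF rr_klin[OF Q.ep_klin] rep_klin])
  have "(\<Sum>i\<in>B0. Ev (?\<psi> i) (1 * S i)) \<noteq> 0"
    unfolding Ev_reconstruct[OF Q.ep_klin] by (simp add: Q.ep_one)
  then obtain i where "Ev (?\<psi> i) (1 * S i) \<noteq> 0" by (meson sum.neutral)
  then have "Ev (?\<psi> i) \<noteq> 0" by auto
  with k show ?thesis by (rule that)
qed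

lemma frobenius:
  "vector_space.dim fscale (left_cointegrals H B0) = 1 \<and>
    (\<forall>l\<in>left_cointegrals H B0. l \<noteq> 0 \<longrightarrow> nondegenerate l) \<and>
    frobenius_algebra (scal H) \<and> dim (left_integrals H) = 1 \<and> dim (right_integrals H) = 1"
proof -
  interpret F: vector_space "fscale :: 'k \<Rightarrow> ('a \<Rightarrow> 'k) \<Rightarrow> 'a \<Rightarrow> 'k" by (rule vector_space_fscale)
  obtain \<psi> where \<psi>: "klin sc (*) \<psi>" "Ev \<psi> \<noteq> 0" by (rule left_cointegral_exists)
  note nd = left_cointegral_nondegenerate[OF \<psi>]
  have "left_cointegrals H B0 = F.span {Ev \<psi>}"
  proof (intro set_eqI iffI)
    fix \<mu> assume "\<mu> \<in> left_cointegrals H B0"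
    then obtain \<chi> where \<chi>: "klin sc (*) \<chi>" "\<mu> = Ev \<chi>" by (auto simp: left_cointegrals_eq)
    obtain k where "\<mu> = fscale k (Ev \<psi>)" using left_cointegral_unique[OF \<psi> \<chi>(1)] \<chi>(2) by metis
    then show "\<mu> \<in> F.span {Ev \<psi>}" by (simp add: F.span_scale F.span_base)
  next
    fix \<mu> assume "\<mu> \<in> F.span {Ev \<psi>}"
    then obtain k where k: "\<mu> = fscale k (Ev \<psi>)" by (auto simp: F.span_singleton)
    have "klin sc (*) (\<lambda>x. k * \<psi> x)" using \<psi>(1) by (simp add: klin_def algebra_simps)
    moreover have "\<mu> = Ev (\<lambda>x. k * \<psi> x)" by (simp add: k Ev_lin fscale_def fun_eq_iff)
    ultimately show "\<mu> \<in> left_cointegrals H B0" by (auto simp: left_cointegrals_eq)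
  qed
  then have "F.dim (left_cointegrals H B0) = 1" using F.dim_span_singleton[OF \<psi>(2)] by metis
  moreover have "\<forall>l\<in>left_cointegrals H B0. l \<noteq> 0 \<longrightarrow> nondegenerate l"
    using left_cointegral_nondegenerate by (auto simp: left_cointegrals_eq)
  moreover have "frobenius_algebra (scal H)"
    unfolding frobenius_algebra_def
    using k_algebra_axioms N.finite_dimensional_vector_space_axioms Ev_klin[OF \<psi>(1)] nd
    by (auto simp: klin_iff_linear)
  ultimately show ?thesis
    using dim_integrals[OF N.finite_dimensional_vector_space_axioms Ev_klin[OF \<psi>(1)] nd] by blast
qed

end

theorem theorem4p3:
  fixes H :: "('k::field, 'a::ring_1) quasi_hopf_data" and B :: "'a set"
  assumes "quasi_hopf_algebra H"
    and "finite_dimensional_vector_space (scal H) B"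
  shows "vector_space.dim fscale (left_cointegrals H B) = 1 \<and>
    (\<forall>l\<in>left_cointegrals H B. l \<noteq> 0 \<longrightarrow> nondegenerate l) \<and>
    frobenius_algebra (scal H) \<and>
    vector_space.dim (scal H) (left_integrals H) = 1 \<and>
    vector_space.dim (scal H) (right_integrals H) = 1"
proof -
  interpret quasi_hopf_algebra H by (rule assms(1))
  obtain B1 where B1: "finite_dimensional_vector_space (scal H) B1" "1 \<in> B1"
    by (rule one_in_basis[OF assms(2)])
  have "fd_quasi_hopf_basis H B1 B"
    using assms B1 by (simp add: fd_quasi_hopf_basis_def fd_quasi_hopf_def fd_quasi_hopf_axioms_def)
  then show ?thesis by (rule fd_quasi_hopf_basis.frobenius)
qed

end
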